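(* Let $n$ be a positive integer and run the sum-free process on $\mathbb{Z}_{2n}$ (defined in the context), and let $S$ be the final (maximal) sum-free set it produces. Then with high probability (i.e. with probability tending to $1$ as $n\to\infty$), $$|S| \ \ge\ i_0 := \frac{1}{\sqrt{3}}\left(1 - 20\cdot\frac{\log\log n}{\log n}\right) n^{1/2}\log^{1/2} n .$$
   Context: A set $S\subseteq \mathbb{Z}_{2n}$ is sum-free if there are no $a,b,c\in S$ (not necessarily distinct) with $a+b=c$ in $\mathbb{Z}_{2n}$. The sum-free process (random greedy algorithm for sum-free sets) on $\mathbb{Z}_{2n}$: start with $S(0)=\emptyset$ and $Q(0)=\mathbb{Z}_{2n}\setminus\{0\}$. At step $i$, if $Q(i)$ is empty the process terminates with the maximal sum-free set $S(i)$; otherwise choose an element $s(i)$ uniformly at random from $Q(i)$, set $S(i+1)=S(i)\cup\{s(i)\}$, and let $Q(i+1)$ be the set of all $x\in\mathbb{Z}_{2n}\setminus S(i+1)$ such that $S(i+1)\cup\{x\}$ is sum-free. Here $\log$ denotes the natural logarithm. *)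

theory Defs
  imports "HOL-Probability.Probability" "HOL-Number_Theory.Residues"
begin

definition sum_free :: "('a, 'b) ring_scheme \<Rightarrow> 'a set \<Rightarrow> bool" where
  "sum_free R S \<longleftrightarrow> \<not> (\<exists>a\<in>S. \<exists>b\<in>S. \<exists>c\<in>S. a \<oplus>\<^bsub>R\<^esub> b = c)"

definition open_elements :: "('a, 'b) ring_scheme \<Rightarrow> 'a set \<Rightarrow> 'a set" where
  "open_elements R S = {x \<in> carrier R - S. sum_free R (insert x S)}"

text \<open>A state of the process is a pair (S, Q). A state with empty Q is terminal;
  it is made absorbing, so that the process is defined for all times.\<close>

definition sf_step :: "('a, 'b) ring_scheme \<Rightarrow> 'a set \<times> 'a set \<Rightarrow> ('a set \<times> 'a set) pmf" where
  "sf_step R = (\<lambda>(S, Q).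
     if Q = {} then return_pmf (S, Q)
     else map_pmf (\<lambda>s. (insert s S, open_elements R (insert s S))) (pmf_of_set Q))"

primrec sf_process :: "('a, 'b) ring_scheme \<Rightarrow> nat \<Rightarrow> ('a set \<times> 'a set) pmf" where
  "sf_process R 0 = return_pmf ({}, carrier R - {\<zero>\<^bsub>R\<^esub>})"
| "sf_process R (Suc i) = bind_pmf (sf_process R i) (sf_step R)"

text \<open>Every step before termination adds a new element to S, so the process on a finite carrier
  has terminated by time \<open>card (carrier R)\<close> (lemma \<open>sf_process_terminated\<close> below); the
  first component at that time is the set it produces.\<close>

definition sf_final :: "('a, 'b) ring_scheme \<Rightarrow> 'a set pmf" where
  "sf_final R = map_pmf fst (sf_process R (card (carrier R)))"

text \<open>For n = 0 the carrier is empty; only positive n are meant.\<close>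

abbreviation Z2n :: "nat \<Rightarrow> int ring" where
  "Z2n n \<equiv> residue_ring (2 * int n)"

lemma sf_process_invariant:
  assumes "finite (carrier R)" and "(S, Q) \<in> set_pmf (sf_process R i)"
  shows "S \<subseteq> carrier R \<and> Q \<subseteq> carrier R - S \<and> (Q = {} \<or> card S = i)"
  using assms(2)
proof (induction i arbitrary: S Q)
  case 0
  then show ?case by auto
next
  case (Suc i)
  from Suc.prems obtain S' Q' where prev: "(S', Q') \<in> set_pmf (sf_process R i)"
    and step: "(S, Q) \<in> set_pmf (sf_step R (S', Q'))"
    by auto
  note IH = Suc.IH[OF prev]
  show ?case
  proof (cases "Q' = {}")
    case True
    then show ?thesis using step IH by (auto simp: sf_step_def)
  next
    case False
    have fin: "finite Q'" "finite S'"
      using IH assms(1) by (auto intro: finite_subset)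
    then obtain s where s: "s \<in> Q'" "S = insert s S'" "Q = open_elements R S"
      using step False by (auto simp: sf_step_def)
    then show ?thesis using IH fin False by (auto simp: open_elements_def)
  qed
qed

lemma sf_process_terminated:
  assumes "finite (carrier R)" and "(S, Q) \<in> set_pmf (sf_process R (card (carrier R)))"
  shows "Q = {}"
  using sf_process_invariant[OF assms] assms(1) card_subset_eq by blast

lemma sf_process_stationary:
  assumes "finite (carrier R)"
  shows "sf_process R (card (carrier R) + k) = sf_process R (card (carrier R))"
proof (induction k)
  case (Suc k)
  have "bind_pmf (sf_process R (card (carrier R))) (sf_step R)
      = bind_pmf (sf_process R (card (carrier R))) return_pmf"
  proof (rule bind_pmf_cong[OF refl])
    fix x assume "x \<in> set_pmf (sf_process R (card (carrier R)))"
    then show "sf_step R x = return_pmf x"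
      using sf_process_terminated[OF assms, of "fst x" "snd x"]
      by (cases x) (auto simp: sf_step_def)
  qed
  then show ?case using Suc by (simp add: bind_return_pmf')
qed simp

end

theory Submission
  imports Defs "HOL-Real_Asymp.Real_Asymp"
begin

text \<open>
  Let N = 2n and follow a state (S, Q) with |S| = i, |Q| = q. Choosing s closes those x in Q
  with x - s, s - x or x + s in S, about 3 i q / N of them if S and Q look independent, so that q
  follows N times the product of 1 - 3 j / N over j < i, and q is still about N^(3/4) at the target
  time. To see that the number of closed elements does not depend on s, one follows, for the
  maps g(x) = v + x and g(x) = v - x, the numbers of a in S with g(a) in Q and of y in Q with
  g(y) in Q. Only differences of these numbers for two maps are controlled: the error of a difference
  grows at the same rate as the main term decays, so in absolute terms it stays about n^(1/4) up to
  powers of log n, whereas comparing with a fixed trajectory would double that rate. The averages over v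
  are known exactly, and so every single number is known too.

  The concentration needs no martingale theory: the sum over all pairs of maps of
  exp(lam * (difference / bound - 1)) hardly grows in expectation as long as no difference has
  exceeded its bound, and it is at least 1 as soon as one has. Backward induction along the process
  bounds the probability of an early end by the initial value of this sum.
\<close>

subsection \<open>Exponential potentials\<close>

text \<open>The two families of differences feed each other. The new element s adds 1 to a count on
  S when g(s) is open, so the second family is a source for the first; and pairs of open elements
  disappear at a rate known only up to the oscillation of the first family. Both bounds u and w must
  therefore be closed in one induction. With T = sqrt N and r = 1 / (T + i), the choice w = 4 N p u
  r makes the source at most 6 r u, so u may grow like (T + i)^8, which is a power of log n over the
  whole run. The argument lasts while a count on S, about T p up to logarithms, stays above u, about
  n^(1/4); here this means p \<ge> n^(-1/4) (log n)^9. Since p is about exp(- 3 i^2 / (2 N)) and N =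
  2 n, the time i = (1 - x) sqrt(n log n / 3) gives log p = - (1 - x)^2 (log n) / 4. So x = 20 log
  log n / log n buys ten powers of log n, one more than used, and that one absorbs the lower order
  terms.\<close>

lemma exp_le_quadratic:
  fixes x :: real
  assumes "x \<le> 1"
  shows "exp x \<le> 1 + x + x^2"
proof (cases "0 \<le> x")
  case True
  then show ?thesis using exp_bound[of x] assms by simp
next
  case False
  define y where "y = - x"
  have y: "y > 0" using False by (simp add: y_def)
  have "exp x = 1 / exp y" by (simp add: y_def exp_minus inverse_eq_divide)
  also have "\<dots> \<le> 1 / (1 + y)"
    using exp_ge_add_one_self[of y] y by (intro divide_left_mono) auto
  also have "\<dots> \<le> 1 - y + y^2"
  proof -
    have "(1 - y + y^2) * (1 + y) = 1 + y ^ 3"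
      by (simp add: algebra_simps power2_eq_square power3_eq_cube)
    moreover have "y ^ 3 \<ge> 0" using y by simp
    ultimately have "1 \<le> (1 - y + y^2) * (1 + y)" by simp
    then show ?thesis using y by (simp add: pos_divide_le_eq)
  qed
  finally show ?thesis by (simp add: y_def)
qed

text \<open>One of two things happens. If D lies within a fraction \<delta> of its bound, the drift
  condition makes the second order expansion nonpositive, so the mean does not grow. Otherwise even
  the largest jump, at most 1 in the exponent, keeps the exponent below 1 - lam * \<delta>, and the
  additive term covers it. The bound itself moves from \<open>b\<close> to \<open>b'\<close> in the
  same step.\<close>

lemma potential_step:
  fixes \<Delta> :: "'a \<Rightarrow> real" and D b b' J V \<mu> lam \<delta> :: real
  assumes fin: "finite Q" and Q: "Q \<noteq> {}"
    and pos: "b > 0" "b' > 0" "lam > 0" and D: "\<bar>D\<bar> \<le> b"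
    and jump: "\<And>s. s \<in> Q \<Longrightarrow> \<bar>\<Delta> s\<bar> \<le> J"
    and mean: "(\<Sum>s\<in>Q. \<Delta> s) \<le> real (card Q) * \<mu>"
    and var: "(\<Sum>s\<in>Q. (\<Delta> s)^2) \<le> real (card Q) * V"
    and small: "lam * (J / b' + \<bar>1 - b / b'\<bar>) \<le> 1"
    and drift: "D \<ge> (1 - \<delta>) * b \<Longrightarrow>
       \<mu> / b' - D / b * (1 - b / b') + lam * (2 * V / b'^2 + 2 * (1 - b / b')^2) \<le> 0"
  shows "(\<Sum>s\<in>Q. exp (lam * ((D + \<Delta> s) / b' - 1)))
         \<le> real (card Q) * (exp (lam * (D / b - 1)) + exp (1 - lam * \<delta>))"
proof -
  define w where "w = 1 - b / b'"
  \<comment> \<open>\<open>z s\<close> is the increment of the normalised difference: the jump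
    measured in the new bound, minus what D / b changes because the bound moves.\<close>
  define z where "z s = \<Delta> s / b' - D / b * w" for s
  define c where "c = real (card Q)"
  have c: "c > 0" using fin Q by (simp add: c_def card_gt_0_iff)
  have z_eq: "(D + \<Delta> s) / b' - 1 = (D / b - 1) + z s" for s
    using pos by (simp add: z_def w_def field_simps)
  have Db: "\<bar>D / b\<bar> \<le> 1" using D pos by (simp add: field_simps)
  have Dw: "\<bar>D / b * w\<bar> \<le> \<bar>w\<bar>"
    using mult_right_mono[OF Db, of "\<bar>w\<bar>"] by (simp add: abs_mult)
  have zl: "lam * z s \<le> 1" if "s \<in> Q" for s
  proof -
    have "\<Delta> s / b' \<le> J / b'" using jump[OF that] pos by (intro divide_right_mono) auto
    moreover have "- (D / b * w) \<le> \<bar>w\<bar>" using Dw by (rule abs_le_D2)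
    ultimately have "z s \<le> J / b' + \<bar>w\<bar>" unfolding z_def by linarith
    then have "lam * z s \<le> lam * (J / b' + \<bar>w\<bar>)" using pos by (intro mult_left_mono) auto
    then show ?thesis using small by (simp add: w_def)
  qed
  have z2: "(z s)^2 \<le> 2 * (\<Delta> s)^2 / b'^2 + 2 * w^2" for s
  proof -
    have "(x - y)^2 \<le> 2 * x^2 + 2 * y^2" for x y :: real
      using zero_le_power2[of "x + y"] by (simp add: power2_eq_square algebra_simps)
    then have "(z s)^2 \<le> 2 * (\<Delta> s / b')^2 + 2 * (D / b * w)^2" unfolding z_def .
    moreover have "(D / b * w)^2 \<le> w^2" using Dw abs_le_square_iff by blast
    ultimately show ?thesis by (simp add: power_divide)
  qed
  show ?thesis
  proof (cases "D \<ge> (1 - \<delta>) * b")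
    case False
    have "exp (lam * ((D + \<Delta> s) / b' - 1)) \<le> exp (1 - lam * \<delta>)" if "s \<in> Q" for s
    proof -
      have "D / b \<le> 1 - \<delta>" using False pos by (simp add: pos_divide_le_eq)
      then have "lam * (D / b - 1) \<le> lam * (- \<delta>)" using pos by (intro mult_left_mono) auto
      then show ?thesis using zl[OF that] by (simp add: z_eq algebra_simps)
    qed
    then have "(\<Sum>s\<in>Q. exp (lam * ((D + \<Delta> s) / b' - 1))) \<le> c * exp (1 - lam * \<delta>)"
      unfolding c_def by (rule sum_bounded_above)
    also have "\<dots> \<le> c * (exp (lam * (D / b - 1)) + exp (1 - lam * \<delta>))"
      using c by (intro mult_left_mono) auto
    finally show ?thesis by (simp add: c_def)
  next
    case True
    have s1: "(\<Sum>s\<in>Q. z s) \<le> c * (\<mu> / b' - D / b * w)"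
    proof -
      have "(\<Sum>s\<in>Q. z s) = (\<Sum>s\<in>Q. \<Delta> s) / b' - c * (D / b * w)"
        by (simp add: z_def sum_subtractf c_def sum_divide_distrib)
      also have "\<dots> \<le> c * \<mu> / b' - c * (D / b * w)"
        using mean pos by (intro diff_right_mono divide_right_mono) (auto simp: c_def)
      finally show ?thesis by (simp add: algebra_simps)
    qed
    have s2: "(\<Sum>s\<in>Q. (z s)^2) \<le> c * (2 * V / b'^2 + 2 * w^2)"
    proof -
      have "(\<Sum>s\<in>Q. (z s)^2) \<le> (\<Sum>s\<in>Q. 2 * (\<Delta> s)^2 / b'^2 + 2 * w^2)"
        by (intro sum_mono z2)
      also have "\<dots> = 2 * (\<Sum>s\<in>Q. (\<Delta> s)^2) / b'^2 + c * (2 * w^2)"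
        by (simp add: sum.distrib c_def sum_divide_distrib sum_distrib_left)
      also have "\<dots> \<le> 2 * (c * V) / b'^2 + c * (2 * w^2)"
        using var by (intro add_right_mono divide_right_mono mult_left_mono) (auto simp: c_def)
      finally show ?thesis by (simp add: algebra_simps)
    qed
    have "(\<Sum>s\<in>Q. exp (lam * z s)) \<le> (\<Sum>s\<in>Q. 1 + lam * z s + (lam * z s)^2)"
      by (intro sum_mono exp_le_quadratic zl)
    also have "\<dots> = c + lam * ((\<Sum>s\<in>Q. z s) + lam * (\<Sum>s\<in>Q. (z s)^2))"
    proof -
      have "(\<Sum>s\<in>Q. 1 + lam * z s + (lam * z s)^2) = c + lam * (\<Sum>s\<in>Q. z s) + lam^2 * (\<Sum>s\<in>Q. (z s)^2)"
        by (simp add: sum.distrib c_def sum_distrib_left power_mult_distrib)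
      then show ?thesis by (simp only: power2_eq_square[of lam] distrib_left mult.assoc add.assoc)
    qed
    also have "\<dots> \<le> c + lam * (c * (\<mu> / b' - D / b * w) + lam * (c * (2 * V / b'^2 + 2 * w^2)))"
      using s1 s2 pos by (intro add_left_mono mult_left_mono add_mono) auto
    also have "\<dots> = c + lam * c * (\<mu> / b' - D / b * w + lam * (2 * V / b'^2 + 2 * w^2))"
      by (simp add: algebra_simps)
    also have "\<dots> \<le> c"
      using drift[OF True] c pos by (simp add: w_def mult_nonneg_nonpos)
    finally have E: "(\<Sum>s\<in>Q. exp (lam * z s)) \<le> c" .
    have "(\<Sum>s\<in>Q. exp (lam * ((D + \<Delta> s) / b' - 1))) = exp (lam * (D / b - 1)) * (\<Sum>s\<in>Q. exp (lam * z s))"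
      unfolding sum_distrib_left exp_add[symmetric] z_eq by (simp only: distrib_left)
    also have "\<dots> \<le> exp (lam * (D / b - 1)) * c" using E by (intro mult_left_mono) auto
    also have "\<dots> \<le> c * (exp (lam * (D / b - 1)) + exp (1 - lam * \<delta>))"
      using c by (simp add: algebra_simps)
    finally show ?thesis by (simp add: c_def)
  qed
qed

subsection \<open>Sum-free states modulo N\<close>

definition mod_sum_free :: "int \<Rightarrow> int set \<Rightarrow> bool" where
  "mod_sum_free N S \<longleftrightarrow> (\<forall>a\<in>S. \<forall>b\<in>S. (a + b) mod N \<notin> S)"

definition valid_state :: "int \<Rightarrow> int set \<Rightarrow> int set \<Rightarrow> bool" where
  "valid_state N S Q \<longleftrightarrow> S \<subseteq> {0..<N} \<and> mod_sum_free N S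
     \<and> Q = {x \<in> {0..<N} - S. mod_sum_free N (insert x S)}"

text \<open>Apart from \<open>x = s\<close>, which records that s itself leaves the open set, the
  alternatives are the sums formed by s, x and at most one element of \<open>S\<close>. The relation
  is symmetric, and every double count below rests on that.\<close>

definition clash :: "int \<Rightarrow> int set \<Rightarrow> int \<Rightarrow> int \<Rightarrow> bool" where
  "clash N S s x \<longleftrightarrow> x = s \<or> x = (2 * s) mod N \<or> s = (2 * x) mod N
     \<or> (x - s) mod N \<in> S \<or> (s - x) mod N \<in> S \<or> (x + s) mod N \<in> S"

definition closed_by :: "int \<Rightarrow> int set \<Rightarrow> int set \<Rightarrow> int \<Rightarrow> int set" where
  "closed_by N S Q s = {x \<in> Q. clash N S s x}"

text \<open>The dihedral group acting on residues: \<open>(True, v)\<close> is the translation by v,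
  \<open>(False, v)\<close> the reflection v - x.\<close>

definition act :: "int \<Rightarrow> bool \<times> int \<Rightarrow> int \<Rightarrow> int" where
  "act N g x = ((if fst g then x else - x) + snd g) mod N"

definition cnt :: "int \<Rightarrow> bool \<times> int \<Rightarrow> int set \<Rightarrow> int set \<Rightarrow> nat" where
  "cnt N g X Y = card {x \<in> X. act N g x \<in> Y}"

definition overlap :: "int \<Rightarrow> bool \<times> int \<Rightarrow> bool \<times> int \<Rightarrow> int set \<Rightarrow> nat" where
  "overlap N g h X = card (act N g ` X \<inter> act N h ` X)"

text \<open>The maps with nonzero shift that are excluded here send \<open>S\<close> entirely
  outside the open set (\<open>cnt_inactive\<close>): for v in S both v + a and v - a are closed,
  and for - v in S the translate a + v is a difference of elements of S. Their counts are 0 and must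
  not be compared with the others.\<close>

definition active :: "int \<Rightarrow> int set \<Rightarrow> bool \<times> int \<Rightarrow> bool" where
  "active N S g \<longleftrightarrow> snd g \<in> {1..<N} \<and> snd g \<notin> S \<and> (fst g \<longrightarrow> (- snd g) mod N \<notin> S)"

text \<open>The maps whose images of \<open>S\<close> get closed when y is chosen: S + y, y - S and
  S - y.\<close>

definition closers :: "int \<Rightarrow> int \<Rightarrow> (bool \<times> int) set" where
  "closers N y = {(True, y), (False, y), (True, (- y) mod N)}"

lemma clash_sym: "clash N S s x \<longleftrightarrow> clash N S x s"
  by (auto simp: clash_def add.commute)

lemma act_range: "N > 0 \<Longrightarrow> act N g x \<in> {0..<N}"
  by (simp add: act_def)

lemma act_eq_iff: "act N g x = act N h y \<longleftrightarrow>
   N dvd ((if fst g then x else - x) + snd g) - ((if fst h then y else - y) + snd h)"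
  unfolding act_def by (rule mod_eq_dvd_iff)

lemma residue_eqI: "N dvd x - y \<Longrightarrow> x \<in> {0..<N} \<Longrightarrow> y \<in> {0..<N} \<Longrightarrow> x = (y::int)"
  by (metis mod_eq_dvd_iff atLeastLessThan_iff mod_pos_pos_trivial)

lemma act_inj: "inj_on (act N g) {0..<N}"
proof (rule inj_onI)
  fix x y assume xy: "x \<in> {0..<N}" "y \<in> {0..<N}" "act N g x = act N g y"
  then have "N dvd x - y" unfolding act_eq_iff by (auto split: if_splits simp: dvd_diff_commute)
  then show "x = y" using xy by (intro residue_eqI)
qed

text \<open>With c reduced to its residue, k x - c = N j forces 0 \<le> j < k, and j determines
  x.\<close>

lemma card_linear_residues:
  assumes "N > 0" "k > 0"
  shows "card {x \<in> {0..<N}. N dvd int k * x - c} \<le> k"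
proof -
  let ?A = "{x \<in> {0..<N}. N dvd int k * x - c}"
  let ?f = "\<lambda>x. (int k * x - c mod N) div N"
  have d: "N * ?f x = int k * x - c mod N" if "x \<in> ?A" for x
  proof -
    have "N dvd (int k * x - c) + (c - c mod N)" using that by (intro dvd_add) (auto simp: minus_mod_eq_mult_div)
    then show ?thesis by simp
  qed
  have "inj_on ?f ?A"
  proof (rule inj_onI)
    fix x y assume xy: "x \<in> ?A" "y \<in> ?A" "?f x = ?f y"
    have "int k * x - c mod N = int k * y - c mod N"
      using d[OF xy(1)] d[OF xy(2)] xy(3) by metis
    then have "int k * x = int k * y" by linarith
    then show "x = y" using assms(2) by (metis mult_cancel_left of_nat_eq_0_iff less_irrefl)
  qed
  moreover have "?f ` ?A \<subseteq> {0..<int k}"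
  proof (rule image_subsetI)
    fix x assume x: "x \<in> ?A"
    have c: "0 \<le> c mod N" "c mod N < N" using assms by auto
    have "0 \<le> int k * x" using x by simp
    then have "N * ?f x > N * (- 1)" unfolding d[OF x] using c by simp
    then have "?f x > -1" using assms by (metis mult_less_cancel_left_pos)
    moreover have "int k * x < int k * N" using x assms by simp
    then have "N * ?f x < N * int k" unfolding d[OF x] using c by (simp add: mult.commute)
    then have "?f x < int k" using assms by (metis mult_less_cancel_left_pos)
    ultimately show "?f x \<in> {0..<int k}" by simp
  qed
  ultimately have "card ?A \<le> card {0..<int k}" by (intro card_inj_on_le) auto
  then show ?thesis by simp
qed

lemma valid_stateD:
  assumes "valid_state N S Q"
  shows "S \<subseteq> {0..<N}" "Q \<subseteq> {0..<N}" "S \<inter> Q = {}" "finite S" "finite Q"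
  using assms by (auto simp: valid_state_def intro: finite_subset[of _ "{0..<N}"])

lemma open_not_closed:
  assumes "valid_state N S Q" "y \<in> Q" "a \<in> S" "b \<in> S"
  shows "(a + b) mod N \<noteq> y" "(a + y) mod N \<noteq> b" "(a - b) mod N \<noteq> y"
proof -
  have sf: "mod_sum_free N (insert y S)" and y: "y \<in> {0..<N}" and S: "S \<subseteq> {0..<N}"
    using assms by (auto simp: valid_state_def)
  show "(a + b) mod N \<noteq> y" "(a + y) mod N \<noteq> b"
    using sf assms(3,4) by (auto simp: mod_sum_free_def)
  have "(b + (a - b) mod N) mod N = a" using S assms(3) by (simp add: mod_simps subset_eq)
  then show "(a - b) mod N \<noteq> y" using sf assms(3,4) by (auto simp: mod_sum_free_def)
qed

lemma open_nonzero:
  assumes "valid_state N S Q" "y \<in> Q"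
  shows "y \<in> {1..<N}"
proof -
  have "y \<noteq> 0" using assms by (auto simp: valid_state_def mod_sum_free_def)
  then show ?thesis using valid_stateD(2)[OF assms(1)] assms(2) by force
qed

lemma cnt_inactive:
  assumes "valid_state N S Q" "snd g \<in> {1..<N}" "\<not> active N S g"
  shows "cnt N g S Q = 0"
proof -
  have "act N g a \<notin> Q" if a: "a \<in> S" for a
  proof
    assume q: "act N g a \<in> Q"
    consider "snd g \<in> S" | "fst g" "(- snd g) mod N \<in> S" using assms by (auto simp: active_def)
    then show False
    proof cases
      case 1
      then show False using open_not_closed(1)[OF assms(1) q a 1] open_not_closed(3)[OF assms(1) q 1 a]
        by (auto simp: act_def split: if_splits)
    next
      case 2
      then show False using open_not_closed(3)[OF assms(1) q a 2(2)]
        by (auto simp: act_def mod_simps)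
    qed
  qed
  then have e: "{x \<in> S. act N g x \<in> Q} = {}" by blast
  show ?thesis unfolding cnt_def e by simp
qed

text \<open>A sum in the enlarged set that involves both s and x is one of the clashes, and a sum
  that avoids one of them is excluded because s and x were both open before.\<close>

lemma valid_state_step:
  assumes v: "valid_state N S Q" and s: "s \<in> Q"
  shows "valid_state N (insert s S) (Q - closed_by N S Q s)"
proof -
  have S: "S \<subseteq> {0..<N}" and s': "s \<in> {0..<N}" "s \<notin> S" and sfs: "mod_sum_free N (insert s S)"
    using v s by (auto simp: valid_state_def)
  have Q: "x \<in> Q \<longleftrightarrow> x \<in> {0..<N} \<and> x \<notin> S \<and> mod_sum_free N (insert x S)" for x
    using v by (auto simp: valid_state_def)
  have "x \<in> Q - closed_by N S Q s \<longleftrightarrow>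
        x \<in> {0..<N} \<and> x \<notin> insert s S \<and> mod_sum_free N (insert x (insert s S))" (is "?l \<longleftrightarrow> ?r") for x
  proof
    assume l: ?l
    then have x: "x \<in> Q" "x \<in> {0..<N}" "x \<notin> S" and sfx: "mod_sum_free N (insert x S)" and c: "\<not> clash N S s x"
      using Q by (auto simp: closed_by_def)
    have nz: "x \<in> {1..<N}" "s \<in> {1..<N}" using open_nonzero[OF v] x(1) s by auto
    have n1: "(s + s) mod N \<noteq> x" "(x + x) mod N \<noteq> s" "(x + s) mod N \<notin> S" "(s + x) mod N \<notin> S" "x \<noteq> s"
      using c by (auto simp: clash_def add.commute)
    have n2: "(s + a) mod N \<noteq> x" "(a + s) mod N \<noteq> x" if "a \<in> S" for a
    proof -
      have "(s + a) mod N = x \<Longrightarrow> (x - s) mod N = a"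
        using that S by (auto simp: mod_simps)
      then show "(s + a) mod N \<noteq> x" using c that by (auto simp: clash_def)
      then show "(a + s) mod N \<noteq> x" by (simp add: add.commute)
    qed
    have n3: "(x + a) mod N \<noteq> s" "(a + x) mod N \<noteq> s" if "a \<in> S" for a
    proof -
      have "(x + a) mod N = s \<Longrightarrow> (s - x) mod N = a"
        using that S by (auto simp: mod_simps)
      then show "(x + a) mod N \<noteq> s" using c that by (auto simp: clash_def)
      then show "(a + x) mod N \<noteq> s" by (simp add: add.commute)
    qed
    \<comment> \<open>A sum of two nonzero residues equals neither summand, and 0 is never
      open.\<close>
    have n4: "(x + s) mod N \<noteq> x" "(x + s) mod N \<noteq> s" "(s + x) mod N \<noteq> x" "(s + x) mod N \<noteq> s"
    proof -
      have *: "(y + z) mod N \<noteq> y" if "y \<in> {1..<N}" "z \<in> {1..<N}" for y z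
      proof
        assume "(y + z) mod N = y"
        then have "(y + z) mod N = y mod N" using that by simp
        then have "N dvd z" unfolding mod_eq_dvd_iff by simp
        then show False using that zdvd_imp_le by force
      qed
      show "(x + s) mod N \<noteq> x" "(x + s) mod N \<noteq> s" "(s + x) mod N \<noteq> x" "(s + x) mod N \<noteq> s"
        using *[OF nz] *[OF nz(2,1)] by (simp_all add: add.commute)
    qed
    have "mod_sum_free N (insert x (insert s S))"
      unfolding mod_sum_free_def
    proof (intro ballI)
      fix a b assume ab: "a \<in> insert x (insert s S)" "b \<in> insert x (insert s S)"
      have f1: "\<And>a b. a \<in> insert s S \<Longrightarrow> b \<in> insert s S \<Longrightarrow> (a + b) mod N \<notin> insert s S"
        using sfs unfolding mod_sum_free_def by blast
      have f2: "\<And>a b. a \<in> insert x S \<Longrightarrow> b \<in> insert x S \<Longrightarrow> (a + b) mod N \<notin> insert x S"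
        using sfx unfolding mod_sum_free_def by blast
      consider "a = x" "b = x" | "a = x" "b = s" | "a = s" "b = x" | "a = s" "b = s"
        | "a = x" "b \<in> S" | "a \<in> S" "b = x" | "a = s" "b \<in> S" | "a \<in> S" "b = s" | "a \<in> S" "b \<in> S"
        using ab by blast
      then show "(a + b) mod N \<notin> insert x (insert s S)"
      proof cases
        case 1 show ?thesis unfolding 1 using f2[of x x] n1 by blast
      next
        case 2 show ?thesis unfolding 2 using n4 n1 by blast
      next
        case 3 show ?thesis unfolding 3 using n4 n1 by blast
      next
        case 4 show ?thesis unfolding 4 using f1[of s s] n1 by blast
      next
        case 5 show ?thesis unfolding 5(1) using 5(2) f2[of x b] n3[of b] by blast
      next
        case 6 show ?thesis unfolding 6(2) using 6(1) f2[of a x] n3[of a] by blast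
      next
        case 7 show ?thesis unfolding 7(1) using 7(2) f1[of s b] n2[of b] by blast
      next
        case 8 show ?thesis unfolding 8(2) using 8(1) f1[of a s] n2[of a] by blast
      next
        case 9 show ?thesis using 9 f1[of a b] f2[of a b] by blast
      qed
    qed
    then show ?r using x n1 by auto
  next
    assume r: ?r
    have sf: "\<And>a b. a \<in> insert x (insert s S) \<Longrightarrow> b \<in> insert x (insert s S) \<Longrightarrow> (a + b) mod N \<notin> insert x (insert s S)"
      using r unfolding mod_sum_free_def by blast
    have x: "x \<in> {0..<N}" using r by auto
    have "mod_sum_free N (insert x S)" unfolding mod_sum_free_def using sf by blast
    then have xQ: "x \<in> Q" using r Q by auto
    have "\<not> clash N S s x"
    proof
      assume "clash N S s x"
      moreover have "(s + (x - s) mod N) mod N = x" "(x + (s - x) mod N) mod N = s"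
        using x s' by (auto simp: mod_simps)
      moreover have "(s + s) mod N \<noteq> x" "(x + x) mod N \<noteq> s" "(x + s) mod N \<notin> S"
        using sf[of s s] sf[of x x] sf[of x s] by auto
      ultimately show False using sf[of s "(x - s) mod N"] sf[of x "(s - x) mod N"] r
        by (auto simp: clash_def)
    qed
    then show ?l using xQ by (auto simp: closed_by_def)
  qed
  then show ?thesis using S s' sfs by (auto simp: valid_state_def)
qed

subsection \<open>Elements closed by a choice\<close>

lemma real_card_Diff:
  assumes "finite A" "B \<subseteq> A"
  shows "real (card (A - B)) = real (card A) - real (card B)"
  using card_Diff_subset[of B A] card_mono[of A B] assms finite_subset[of B A] by (simp add: of_nat_diff)

lemma sum_card_swap:
  assumes "finite A" "finite B"
  shows "(\<Sum>s\<in>A. card {a \<in> B. P s a}) = (\<Sum>a\<in>B. card {s \<in> A. P s a})"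
proof -
  have "(\<Sum>s\<in>A. card {a \<in> B. P s a}) = (\<Sum>s\<in>A. \<Sum>a\<in>B. if P s a then 1 else 0)"
    using assms by (simp add: sum.If_cases Int_def)
  also have "\<dots> = (\<Sum>a\<in>B. \<Sum>s\<in>A. if P s a then 1 else 0)" by (rule sum.swap)
  also have "\<dots> = (\<Sum>a\<in>B. card {s \<in> A. P s a})"
    using assms by (simp add: sum.If_cases Int_def)
  finally show ?thesis .
qed

text \<open>The clashes that do not involve \<open>S\<close>: y, its double and its halves, of which
  there are at most two.\<close>

definition near :: "int \<Rightarrow> int \<Rightarrow> int set" where
  "near N y = {x \<in> {0..<N}. x = y \<or> x = (2 * y) mod N \<or> y = (2 * x) mod N}"

lemma card_near: assumes "N > 0" shows "card (near N y) \<le> 4"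
proof -
  have "near N y \<subseteq> {y, (2 * y) mod N} \<union> {x \<in> {0..<N}. N dvd int 2 * x - y}"
    by (auto simp: near_def mod_eq_dvd_iff[symmetric])
  then have "card (near N y) \<le> card ({y, (2 * y) mod N} \<union> {x \<in> {0..<N}. N dvd int 2 * x - y})"
    by (intro card_mono) (auto intro: finite_subset[of _ "{0..<N}"])
  also have "\<dots> \<le> card {y, (2 * y) mod N} + card {x \<in> {0..<N}. N dvd int 2 * x - y}" by (rule card_Un_le)
  also have "\<dots> \<le> 2 + 2"
    using card_linear_residues[OF assms, of 2 y] by (intro add_mono) (auto simp: card_insert_if)
  finally show ?thesis by simp
qed

lemma finite_near: "finite (near N y)"
  by (auto simp: near_def intro: finite_subset[of _ "{0..<N}"])

lemma card_act_image: "X \<subseteq> {0..<N} \<Longrightarrow> card (act N g ` X) = card X"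
  using act_inj[of N g] by (intro card_image) (rule inj_on_subset)

lemma cnt_eq_card_image:
  assumes "X \<subseteq> {0..<N}"
  shows "cnt N g X Y = card (act N g ` X \<inter> Y)"
proof -
  have "act N g ` X \<inter> Y = act N g ` {x \<in> X. act N g x \<in> Y}" by auto
  moreover have "card (act N g ` {x \<in> X. act N g x \<in> Y}) = card {x \<in> X. act N g x \<in> Y}"
    using assms by (intro card_act_image) auto
  ultimately show ?thesis by (simp add: cnt_def)
qed

lemma clash_iff:
  assumes "N > 0" "S \<subseteq> {0..<N}" "x \<in> {0..<N}" "y \<in> {0..<N}"
  shows "clash N S y x \<longleftrightarrow> x \<in> near N y \<or> (\<exists>h\<in>closers N y. x \<in> act N h ` S)"
proof -
  have 1: "(x - y) mod N \<in> S \<longleftrightarrow> x \<in> act N (True, y) ` S"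
  proof
    assume a: "(x - y) mod N \<in> S"
    have "x = act N (True, y) ((x - y) mod N)" using assms by (simp add: act_def mod_simps)
    then show "x \<in> act N (True, y) ` S" using a by blast
  next
    assume "x \<in> act N (True, y) ` S"
    then obtain a where "a \<in> S" "x = (a + y) mod N" by (auto simp: act_def)
    then show "(x - y) mod N \<in> S" using assms by (auto simp: mod_simps)
  qed
  have 2: "(y - x) mod N \<in> S \<longleftrightarrow> x \<in> act N (False, y) ` S"
  proof
    assume a: "(y - x) mod N \<in> S"
    have "x = act N (False, y) ((y - x) mod N)" using assms by (simp add: act_def mod_simps)
    then show "x \<in> act N (False, y) ` S" using a by blast
  next
    assume "x \<in> act N (False, y) ` S"
    then obtain a where "a \<in> S" "x = (- a + y) mod N" by (auto simp: act_def)
    then show "(y - x) mod N \<in> S" using assms by (auto simp: mod_simps)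
  qed
  have 3: "(x + y) mod N \<in> S \<longleftrightarrow> x \<in> act N (True, (- y) mod N) ` S"
  proof
    assume a: "(x + y) mod N \<in> S"
    have "x = act N (True, (- y) mod N) ((x + y) mod N)" using assms by (simp add: act_def mod_simps)
    then show "x \<in> act N (True, (- y) mod N) ` S" using a by blast
  next
    assume "x \<in> act N (True, (- y) mod N) ` S"
    then obtain a where "a \<in> S" "x = (a - y) mod N" by (auto simp: act_def mod_simps)
    then show "(x + y) mod N \<in> S" using assms by (auto simp: mod_simps)
  qed
  have 4: "x \<in> near N y \<longleftrightarrow> x = y \<or> x = (2 * y) mod N \<or> y = (2 * x) mod N"
    using assms by (simp add: near_def)
  show ?thesis unfolding clash_def closers_def 4 by (simp add: 1 2 3)
qed

lemma card_closers: "card (closers N y) \<le> 3"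
  unfolding closers_def by (simp add: card_insert_if)

lemma closers_range: "y \<in> {1..<N} \<Longrightarrow> h \<in> closers N y \<Longrightarrow> snd h \<in> {1..<N}"
  by (auto simp: closers_def zmod_zminus1_eq_if)

text \<open>For exceptional y the sets S + y, y - S and S - y may miss Q or coincide, and y closes fewer
  elements than expected. Only the upper bound on what y closes survives.\<close>

definition exceptional :: "int \<Rightarrow> int set \<Rightarrow> int \<Rightarrow> bool" where
  "exceptional N S y \<longleftrightarrow> (- y) mod N \<in> insert y S"

text \<open>A snapshot on which all counting rests. \<open>kap\<close> bounds overlaps of distinct
  images of \<open>S\<close>, \<open>lo\<close> and \<open>hi\<close> enclose the active counts, and
  \<open>c\<close> is a reference value between them, later the average |S| |Q| / N. Main terms are
  expressed through \<open>c\<close>, errors through \<open>hi - lo\<close> and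
  \<open>kap\<close>.\<close>

locale good_state =
  fixes N :: int and S Q :: "int set" and lo hi kap c :: real
  assumes N: "N > 0" and valid: "valid_state N S Q"
    and kap: "\<And>g h. snd g \<in> {0..<N} \<Longrightarrow> snd h \<in> {0..<N} \<Longrightarrow> g \<noteq> h \<Longrightarrow> real (overlap N g h S) \<le> kap"
    and act_bounds: "\<And>g. active N S g \<Longrightarrow> lo \<le> cnt N g S Q \<and> cnt N g S Q \<le> hi"
    and c: "lo \<le> c" "c \<le> hi" "0 \<le> c"
begin

abbreviation "cl \<equiv> closed_by N S Q"
abbreviation "hM \<equiv> 3 * hi + 4"
abbreviation "hm \<equiv> 3 * lo - 3 * kap"

lemma kap0: "kap \<ge> 0"
  using kap[of "(True, 0)" "(False, 0)"] N by simp

lemma hi0: "hi \<ge> 0" using c by simp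

lemmas vD = valid_stateD[OF valid]

lemma cnt_le_hi: "snd g \<in> {1..<N} \<Longrightarrow> cnt N g S Q \<le> hi"
  using act_bounds[of g] cnt_inactive[OF valid, of g] hi0 by (cases "active N S g") auto

lemma closed_by_eq:
  assumes "y \<in> Q"
  shows "cl y = (near N y \<inter> Q) \<union> (\<Union>h\<in>closers N y. act N h ` S \<inter> Q)"
proof -
  have "clash N S y x \<longleftrightarrow> x \<in> near N y \<or> (\<exists>h\<in>closers N y. x \<in> act N h ` S)" if "x \<in> Q" for x
    using clash_iff[OF N vD(1)] assms vD(2) that by blast
  then show ?thesis unfolding closed_by_def by blast
qed

lemma finite_cl: "finite (cl y)"
  using vD by (auto simp: closed_by_def)

text \<open>Union bound over the three closing maps. Inactive maps contribute 0, so the bound also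
  covers exceptional y.\<close>

lemma card_cl_le:
  assumes y: "y \<in> Q" shows "real (card (cl y)) \<le> hM"
proof -
  have fin: "finite (closers N y)" by (simp add: closers_def)
  have "card (cl y) \<le> card (near N y \<inter> Q) + card (\<Union>h\<in>closers N y. act N h ` S \<inter> Q)"
    unfolding closed_by_eq[OF y] by (rule card_Un_le)
  also have "\<dots> \<le> 4 + (\<Sum>h\<in>closers N y. card (act N h ` S \<inter> Q))"
    using card_near[OF N, of y] card_mono[OF finite_near, of "near N y \<inter> Q" N y]
    by (intro add_mono card_UN_le fin) auto
  also have "(\<Sum>h\<in>closers N y. card (act N h ` S \<inter> Q)) = (\<Sum>h\<in>closers N y. cnt N h S Q)"
    using cnt_eq_card_image[OF vD(1)] by simp
  finally have "real (card (cl y)) \<le> 4 + (\<Sum>h\<in>closers N y. real (cnt N h S Q))"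
    by (simp flip: of_nat_sum)
  also have "(\<Sum>h\<in>closers N y. real (cnt N h S Q)) \<le> real (card (closers N y)) * hi"
    by (intro sum_bounded_above cnt_le_hi closers_range[OF open_nonzero[OF valid y]])
  also have "\<dots> \<le> 3 * hi" using card_closers[of N y] hi0 by (intro mult_right_mono) auto
  finally show ?thesis by simp
qed

text \<open>For unexceptional y the three closing maps are active and distinct, and Bonferroni's
  inequality loses only their three pairwise overlaps.\<close>

lemma card_cl_ge:
  assumes y: "y \<in> Q" and e: "\<not> exceptional N S y"
  shows "real (card (cl y)) \<ge> hm"
proof -
  have yr: "y \<in> {1..<N}" using open_nonzero[OF valid y] .
  have yS: "y \<notin> S" using vD y by auto
  let ?m = "(- y) mod N"
  have mr: "?m \<in> {1..<N}" using yr by (auto simp: zmod_zminus1_eq_if)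
  have mm: "(- ?m) mod N = y" using yr by (simp add: mod_simps)
  have em: "?m \<notin> S" "?m \<noteq> y" using e by (auto simp: exceptional_def)
  let ?A = "act N (True, y) ` S \<inter> Q" and ?B = "act N (False, y) ` S \<inter> Q"
    and ?C = "act N (True, ?m) ` S \<inter> Q"
  have lo3: "lo \<le> card ?A" "lo \<le> card ?B" "lo \<le> card ?C"
    using act_bounds[of "(True, y)"] act_bounds[of "(False, y)"] act_bounds[of "(True, ?m)"]
      yr mr mm yS em by (auto simp: active_def cnt_eq_card_image[OF vD(1)])
  have ov: "real (card ((act N g ` S \<inter> Q) \<inter> (act N h ` S \<inter> Q))) \<le> kap"
    if "g \<noteq> h" "snd g \<in> {0..<N}" "snd h \<in> {0..<N}" for g h
  proof -
    have "card ((act N g ` S \<inter> Q) \<inter> (act N h ` S \<inter> Q)) \<le> overlap N g h S"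
      unfolding overlap_def using vD by (intro card_mono) auto
    then show ?thesis using kap[OF that(2,3,1)] by linarith
  qed
  have "real (card ?A) + card ?B = card (?A \<union> ?B) + card (?A \<inter> ?B)"
    using card_Un_Int[of ?A ?B] vD by (simp flip: of_nat_add)
  moreover have "real (card (?A \<union> ?B)) + card ?C = card ((?A \<union> ?B) \<union> ?C) + card ((?A \<union> ?B) \<inter> ?C)"
    using card_Un_Int[of "?A \<union> ?B" ?C] vD by (simp flip: of_nat_add)
  moreover have "card ((?A \<union> ?B) \<inter> ?C) \<le> card (?A \<inter> ?C) + card (?B \<inter> ?C)"
    using card_Un_le[of "?A \<inter> ?C" "?B \<inter> ?C"] by (simp add: Int_Un_distrib2)
  moreover have "card ((?A \<union> ?B) \<union> ?C) \<le> card (cl y)"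
    unfolding closed_by_eq[OF y] using vD
    by (intro card_mono) (auto simp: closers_def finite_near)
  moreover have "real (card (?A \<inter> ?B)) \<le> kap" "real (card (?A \<inter> ?C)) \<le> kap" "real (card (?B \<inter> ?C)) \<le> kap"
    using ov[of "(True, y)" "(False, y)"] ov[of "(True, y)" "(True, ?m)"] ov[of "(False, y)" "(True, ?m)"]
      yr mr em by auto
  ultimately show ?thesis using lo3 by linarith
qed

text \<open>Since g differs from the three closing maps of s, each piece closed by s meets g(S) in
  an overlap of two distinct images.\<close>

lemma card_act_cl_le:
  assumes s: "s \<in> Q" and g: "snd g \<in> {0..<N}" "g \<notin> closers N s"
  shows "real (card {a \<in> S. act N g a \<in> cl s}) \<le> 3 * kap + 4"
proof -
  have fin: "finite (closers N s)" by (simp add: closers_def)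
  have sr: "s \<in> {1..<N}" using open_nonzero[OF valid s] .
  have "card {a \<in> S. act N g a \<in> cl s} = card (act N g ` S \<inter> cl s)"
    using cnt_eq_card_image[OF vD(1), of g "cl s"] by (simp add: cnt_def)
  also have "\<dots> \<le> card (near N s \<union> (\<Union>h\<in>closers N s. act N g ` S \<inter> act N h ` S))"
    unfolding closed_by_eq[OF s] using vD fin by (intro card_mono) (auto simp: finite_near)
  also have "\<dots> \<le> card (near N s) + card (\<Union>h\<in>closers N s. act N g ` S \<inter> act N h ` S)"
    by (rule card_Un_le)
  also have "\<dots> \<le> 4 + (\<Sum>h\<in>closers N s. card (act N g ` S \<inter> act N h ` S))"
    using card_near[OF N, of s] by (intro add_mono card_UN_le fin) auto
  finally have "real (card {a \<in> S. act N g a \<in> cl s}) \<le> 4 + (\<Sum>h\<in>closers N s. real (overlap N g h S))"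
    by (simp add: overlap_def flip: of_nat_sum)
  also have "(\<Sum>h\<in>closers N s. real (overlap N g h S)) \<le> real (card (closers N s)) * kap"
  proof (intro sum_bounded_above kap g(1))
    fix h assume "h \<in> closers N s"
    then show "snd h \<in> {0..<N}" "g \<noteq> h" using closers_range[OF sr, of h] g by auto
  qed
  also have "\<dots> \<le> 3 * kap" using card_closers[of N s] kap0 by (intro mult_right_mono) auto
  finally show ?thesis by simp
qed

text \<open>For y different from z and - z no closing map of y is one of z, so the nine pairs of
  maps cost one overlap each; the 8 counts the two \<open>near\<close> sets.\<close>

lemma card_cl_Int_le:
  assumes y: "y \<in> Q" and z: "z \<in> Q" and ne: "y \<noteq> z" "y \<noteq> (- z) mod N"
  shows "real (card (cl y \<inter> cl z)) \<le> 9 * kap + 8"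
proof -
  have fin: "finite (closers N x)" for x by (simp add: closers_def)
  have yr: "y \<in> {1..<N}" and zr: "z \<in> {1..<N}" using open_nonzero[OF valid] y z by auto
  have ne2: "z \<noteq> (- y) mod N" "(- y) mod N \<noteq> (- z) mod N"
  proof -
    show "z \<noteq> (- y) mod N"
    proof
      assume "z = (- y) mod N"
      then have "(- z) mod N = y" using yr by (simp add: mod_simps)
      then show False using ne by simp
    qed
    show "(- y) mod N \<noteq> (- z) mod N"
    proof
      assume "(- y) mod N = (- z) mod N"
      then have "(- ((- y) mod N)) mod N = (- ((- z) mod N)) mod N" by simp
      then show False using yr zr ne by (simp add: mod_simps)
    qed
  qed
  let ?P = "closers N y \<times> closers N z"
  have "cl y \<inter> cl z \<subseteq> (near N y \<union> near N z) \<union> (\<Union>(g, h)\<in>?P. act N g ` S \<inter> act N h ` S)"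
    unfolding closed_by_eq[OF y] closed_by_eq[OF z] by blast
  then have "card (cl y \<inter> cl z) \<le> card ((near N y \<union> near N z) \<union> (\<Union>(g, h)\<in>?P. act N g ` S \<inter> act N h ` S))"
    using vD fin by (intro card_mono) (auto simp: finite_near)
  also have "\<dots> \<le> card (near N y \<union> near N z) + card (\<Union>(g, h)\<in>?P. act N g ` S \<inter> act N h ` S)"
    by (rule card_Un_le)
  also have "\<dots> \<le> 8 + (\<Sum>(g, h)\<in>?P. card (act N g ` S \<inter> act N h ` S))"
  proof (intro add_mono)
    show "card (near N y \<union> near N z) \<le> 8"
      using card_near[OF N, of y] card_near[OF N, of z] card_Un_le[of "near N y" "near N z"] by linarith
    show "card (\<Union>(g, h)\<in>?P. act N g ` S \<inter> act N h ` S) \<le> (\<Sum>(g, h)\<in>?P. card (act N g ` S \<inter> act N h ` S))"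
      using card_UN_le[of ?P "\<lambda>(g, h). act N g ` S \<inter> act N h ` S"] fin by (simp add: split_def)
  qed
  finally have "card (cl y \<inter> cl z) \<le> 8 + (\<Sum>(g, h)\<in>?P. overlap N g h S)"
    by (simp add: overlap_def)
  then have "real (card (cl y \<inter> cl z)) \<le> real (8 + (\<Sum>(g, h)\<in>?P. overlap N g h S))" by (rule of_nat_mono)
  also have "\<dots> = 8 + (\<Sum>gh\<in>?P. real (overlap N (fst gh) (snd gh) S))" by (simp add: split_def)
  also have "(\<Sum>gh\<in>?P. real (overlap N (fst gh) (snd gh) S)) \<le> real (card ?P) * kap"
  proof (intro sum_bounded_above kap)
    fix gh assume p: "gh \<in> ?P"
    then show "snd (fst gh) \<in> {0..<N}" "snd (snd gh) \<in> {0..<N}"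
      using closers_range[OF yr, of "fst gh"] closers_range[OF zr, of "snd gh"] by auto
    show "fst gh \<noteq> snd gh" using p ne ne2 by (auto simp: closers_def)
  qed
  also have "\<dots> \<le> 9 * kap"
  proof -
    have "card (closers N y) * card (closers N z) \<le> 3 * 3" by (intro mult_mono card_closers) auto
    then have "card ?P \<le> 9" by (simp add: card_cartesian_product)
    then have "real (card ?P) \<le> 9" by linarith
    then show ?thesis using kap0 by (intro mult_right_mono) auto
  qed
  finally show ?thesis by simp
qed

text \<open>Double counting by symmetry: s closes g(a) exactly if g(a) closes s. The mean loss
  thereby becomes a sum of sizes of closed sets.\<close>

lemma sum_card_act_cl:
  "(\<Sum>s\<in>Q. card {a \<in> S. act N g a \<in> cl s}) = (\<Sum>a\<in>{a \<in> S. act N g a \<in> Q}. card (cl (act N g a)))"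
proof -
  have "(\<Sum>s\<in>Q. card {a \<in> S. act N g a \<in> cl s}) = (\<Sum>s\<in>Q. card {a \<in> {a \<in> S. act N g a \<in> Q}. act N g a \<in> cl s})"
    by (intro sum.cong refl arg_cong[where f = card]) (auto simp: closed_by_def)
  also have "\<dots> = (\<Sum>a\<in>{a \<in> S. act N g a \<in> Q}. card {s \<in> Q. act N g a \<in> cl s})"
    using vD by (intro sum_card_swap) auto
  also have "\<dots> = (\<Sum>a\<in>{a \<in> S. act N g a \<in> Q}. card (cl (act N g a)))"
    by (intro sum.cong refl arg_cong[where f = card]) (auto simp: closed_by_def clash_sym)
  finally show ?thesis .
qed

lemma sum_card_act_cl_le:
  "(\<Sum>s\<in>Q. real (card {a \<in> S. act N g a \<in> cl s})) \<le> cnt N g S Q * hM"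
proof -
  have "(\<Sum>s\<in>Q. real (card {a \<in> S. act N g a \<in> cl s}))
      = (\<Sum>a\<in>{a \<in> S. act N g a \<in> Q}. real (card (cl (act N g a))))"
    using arg_cong[OF sum_card_act_cl, of real] by simp
  also have "\<dots> \<le> cnt N g S Q * hM"
    unfolding cnt_def by (intro sum_bounded_above card_cl_le) auto
  finally show ?thesis .
qed

lemma card_double: "card {x \<in> {0..<N}. N dvd 2 * x - d} \<le> 2"
  using card_linear_residues[OF N, of 2 d] by simp

text \<open>Only exceptional images g(a) close too few elements. Such an image lies in - S, which is
  an overlap of g(S) with the reflection of shift 0, or is its own negative, which has at most two
  solutions; hence kap + 2.\<close>

lemma sum_card_act_cl_ge:
  assumes g: "snd g \<in> {1..<N}"
  shows "(\<Sum>s\<in>Q. real (card {a \<in> S. act N g a \<in> cl s})) \<ge> cnt N g S Q * hm - (kap + 2) * (3 * c)"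
proof -
  let ?X = "{a \<in> S. act N g a \<in> Q}"
  let ?E = "{a \<in> ?X. exceptional N S (act N g a)}"
  have fX: "finite ?X" using vD by auto
  have "?E \<subseteq> {a \<in> S. act N g a \<in> act N (False, 0) ` S} \<union> {a \<in> S. act N g a \<in> {x \<in> {0..<N}. N dvd 2 * x - 0}}"
  proof
    fix a assume a: "a \<in> ?E"
    let ?z = "act N g a"
    have zr: "?z \<in> {0..<N}" by (rule act_range[OF N])
    consider "(- ?z) mod N \<in> S" | "(- ?z) mod N = ?z" using a by (auto simp: exceptional_def)
    then show "a \<in> {a \<in> S. act N g a \<in> act N (False, 0) ` S} \<union> {a \<in> S. act N g a \<in> {x \<in> {0..<N}. N dvd 2 * x - 0}}"
    proof cases
      case 1
      have "?z = act N (False, 0) ((- ?z) mod N)" using zr by (simp add: act_def mod_simps add.commute)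
      then show ?thesis using 1 a by blast
    next
      case 2
      then have "(- ?z) mod N = ?z mod N" using zr by simp
      then have "N dvd 2 * ?z" unfolding mod_eq_dvd_iff by simp
      then show ?thesis using a zr by simp
    qed
  qed
  then have "card ?E \<le> card ({a \<in> S. act N g a \<in> act N (False, 0) ` S} \<union> {a \<in> S. act N g a \<in> {x \<in> {0..<N}. N dvd 2 * x - 0}})"
    using vD by (intro card_mono) auto
  also have "\<dots> \<le> overlap N g (False, 0) S + 2"
  proof -
    have "card {a \<in> S. act N g a \<in> {x \<in> {0..<N}. N dvd 2 * x - 0}} \<le> card {x \<in> {0..<N}. N dvd 2 * x - 0}"
    proof (rule card_inj_on_le[of "act N g"])
      show "inj_on (act N g) {a \<in> S. act N g a \<in> {x \<in> {0..<N}. N dvd 2 * x - 0}}"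
        using act_inj[of N g] vD(1) by (auto intro: inj_on_subset)
      show "finite {x \<in> {0..<N}. N dvd 2 * x - 0}" by (rule finite_subset[of _ "{0..<N}"]) auto
    qed auto
    then have "card {a \<in> S. act N g a \<in> {x \<in> {0..<N}. N dvd 2 * x - 0}} \<le> 2"
      using card_double[of 0] by linarith
    moreover have "card {a \<in> S. act N g a \<in> act N (False, 0) ` S} = overlap N g (False, 0) S"
      using cnt_eq_card_image[OF vD(1), of g "act N (False, 0) ` S"] by (simp add: cnt_def overlap_def)
    ultimately show ?thesis using card_Un_le[of "{a \<in> S. act N g a \<in> act N (False, 0) ` S}"
        "{a \<in> S. act N g a \<in> {x \<in> {0..<N}. N dvd 2 * x - 0}}"] by linarith
  qed
  finally have E: "real (card ?E) \<le> kap + 2"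
    using kap[of g "(False, 0)"] g N by (cases g) auto
  have "real (cnt N g S Q) * hm - (kap + 2) * (3 * c) \<le> real (card (?X - ?E)) * hm"
  proof -
    have "real (card (?X - ?E)) = real (cnt N g S Q) - real (card ?E)"
      unfolding cnt_def using fX by (intro real_card_Diff) auto
    moreover have "real (card ?E) * hm \<le> (kap + 2) * (3 * c)"
    proof -
      \<comment> \<open>Each exceptional image is charged 3 c, an upper bound for \<open>hm\<close>
        because lo \<le> c.\<close>
      have "real (card ?E) * hm \<le> real (card ?E) * (3 * c)" using c kap0 by (intro mult_left_mono) auto
      also have "\<dots> \<le> (kap + 2) * (3 * c)" using E c by (intro mult_right_mono) auto
      finally show ?thesis .
    qed
    ultimately show ?thesis by (simp add: left_diff_distrib)
  qed
  also have "\<dots> \<le> (\<Sum>a\<in>?X - ?E. real (card (cl (act N g a))))"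
    by (intro sum_bounded_below card_cl_ge) auto
  also have "\<dots> \<le> (\<Sum>a\<in>?X. real (card (cl (act N g a))))"
    using fX by (intro sum_mono2) auto
  also have "\<dots> = (\<Sum>s\<in>Q. real (card {a \<in> S. act N g a \<in> cl s}))"
    using arg_cong[OF sum_card_act_cl, of real] by simp
  finally show ?thesis .
qed

lemma cnt_S_step:
  assumes s: "s \<in> Q"
  shows "real (cnt N g (insert s S) (Q - cl s))
    = real (cnt N g S Q) - real (card {a \<in> S. act N g a \<in> cl s}) + of_bool (act N g s \<in> Q - cl s)"
proof -
  let ?A = "{a \<in> S. act N g a \<in> Q}" and ?B = "{a \<in> S. act N g a \<in> cl s}"
  have sS: "s \<notin> S" using vD s by auto
  have BA: "?B \<subseteq> ?A" by (auto simp: closed_by_def)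
  have fin: "finite ?A" "finite ?B" using vD by auto
  have "{a \<in> insert s S. act N g a \<in> Q - cl s} = (?A - ?B) \<union> (if act N g s \<in> Q - cl s then {s} else {})"
    by auto
  then have "cnt N g (insert s S) (Q - cl s) = card (?A - ?B) + of_bool (act N g s \<in> Q - cl s)"
    using fin sS by (simp add: cnt_def)
  moreover have "real (card (?A - ?B)) = real (card ?A) - real (card ?B)"
    by (rule real_card_Diff[OF fin(1) BA])
  ultimately show ?thesis by (simp add: cnt_def)
qed

text \<open>The chosen s may close its own image, and then the gain of the count is lost. Each clash
  between s and g(s) is either a congruence k s = d with k at most 3, or s cancels from it; in the
  latter case it says v = 0, v in S or - v in S, which activity of g forbids.\<close>

lemma card_self_closed:
  assumes g: "active N S g"
  shows "card {s \<in> Q. act N g s \<in> cl s} \<le> 4 * card S + 8"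
proof -
  have QN: "Q \<subseteq> {0..<N}" by (rule vD)
  let ?L = "\<lambda>k d. {x \<in> {0..<N}. N dvd int k * x - d}"
  have finL: "finite (?L k d)" for k d by (rule finite_subset[of _ "{0..<N}"]) auto
  have cU: "card (\<Union>a\<in>S. ?L 2 (f a)) \<le> 2 * card S" for f
  proof -
    have "card (\<Union>a\<in>S. ?L 2 (f a)) \<le> (\<Sum>a\<in>S. card (?L 2 (f a)))" using vD by (intro card_UN_le) auto
    also have "\<dots> \<le> card S * 2" using card_linear_residues[OF N, of 2]
      by (intro order_trans[OF sum_bounded_above[of _ _ 2]]) auto
    finally show ?thesis by simp
  qed
  have fU: "finite (\<Union>a\<in>S. ?L 2 (f a))" for f by (intro finite_UN_I vD(4) finL)
  have memS: "\<exists>a\<in>S. N dvd z - a" if "z mod N \<in> S" for z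
    using that by (intro bexI[of _ "z mod N"]) (auto simp: minus_mod_eq_mult_div)
  obtain b v where gb: "g = (b, v)" by (cases g)
  have v: "v \<in> {1..<N}" "v \<notin> S" "b \<Longrightarrow> (- v) mod N \<notin> S" using g by (auto simp: active_def gb)
  have vm: "v mod N = v" using v by simp
  have nd: "\<not> N dvd v" using v zdvd_imp_le by fastforce
  show ?thesis
  proof (cases b)
    case True
    have "{s \<in> Q. act N g s \<in> cl s} \<subseteq> ?L 1 v \<union> ?L 1 (- 2 * v) \<union> (\<Union>a\<in>S. ?L 2 (a - v))"
    proof
      fix s assume s: "s \<in> {s \<in> Q. act N g s \<in> cl s}"
      then have sr: "s \<in> {0..<N}" "s mod N = s" using QN by auto
      have "clash N S s ((s + v) mod N)" using s by (auto simp: closed_by_def act_def gb True)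
      then consider "(s + v) mod N = s mod N" | "(s + v) mod N = (2 * s) mod N"
        | "s mod N = (2 * (s + v)) mod N" | "v mod N \<in> S" | "(- v) mod N \<in> S" | "(2 * s + v) mod N \<in> S"
        unfolding clash_def using sr(2) by (simp add: mod_simps algebra_simps) blast
      then show "s \<in> ?L 1 v \<union> ?L 1 (- 2 * v) \<union> (\<Union>a\<in>S. ?L 2 (a - v))"
      proof cases
        case 1 then show ?thesis using nd by (simp add: mod_eq_dvd_iff)
      next
        case 2 then have "N dvd s - v" unfolding mod_eq_dvd_iff by (simp add: dvd_diff_commute)
        then show ?thesis using sr by simp
      next
        case 3 then have "N dvd s - 2 * (s + v)" unfolding mod_eq_dvd_iff .
        then have "N dvd - (s - 2 * (s + v))" by (simp only: dvd_minus_iff)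
        then have "N dvd s + 2 * v" by (simp add: algebra_simps)
        then show ?thesis using sr by (simp add: algebra_simps)
      next
        case 4 then show ?thesis using v vm by simp
      next
        case 5 then show ?thesis using v True by simp
      next
        case 6 then obtain a where "a \<in> S" "N dvd 2 * s + v - a" using memS by blast
        then have "s \<in> (\<Union>a\<in>S. ?L 2 (a - v))" using sr by (intro UN_I[of a]) (auto simp: algebra_simps)
        then show ?thesis by blast
      qed
    qed
    then have "card {s \<in> Q. act N g s \<in> cl s} \<le> card (?L 1 v \<union> ?L 1 (- 2 * v) \<union> (\<Union>a\<in>S. ?L 2 (a - v)))"
      by (intro card_mono finite_UnI finL fU)
    also have "\<dots> \<le> card (?L 1 v) + card (?L 1 (- 2 * v)) + card (\<Union>a\<in>S. ?L 2 (a - v))"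
      by (meson card_Un_le add_right_mono order_trans)
    also have "\<dots> \<le> 1 + 1 + 2 * card S"
      by (intro add_mono cU card_linear_residues N) auto
    finally show ?thesis by simp
  next
    case False
    have "{s \<in> Q. act N g s \<in> cl s} \<subseteq> ?L 2 v \<union> ?L 3 v \<union> ?L 3 (2 * v)
        \<union> ((\<Union>a\<in>S. ?L 2 (v - a)) \<union> (\<Union>a\<in>S. ?L 2 (v + a)))"
    proof
      fix s assume s: "s \<in> {s \<in> Q. act N g s \<in> cl s}"
      then have sr: "s \<in> {0..<N}" "s mod N = s" using QN by auto
      have "clash N S s ((- s + v) mod N)" using s by (auto simp: closed_by_def act_def gb False)
      then consider "(- s + v) mod N = s mod N" | "(- s + v) mod N = (2 * s) mod N"
        | "s mod N = (2 * (- s + v)) mod N" | "(v - 2 * s) mod N \<in> S" | "(2 * s - v) mod N \<in> S" | "v mod N \<in> S"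
        unfolding clash_def using sr(2) by (simp add: mod_simps algebra_simps) blast
      then show "s \<in> ?L 2 v \<union> ?L 3 v \<union> ?L 3 (2 * v)
        \<union> ((\<Union>a\<in>S. ?L 2 (v - a)) \<union> (\<Union>a\<in>S. ?L 2 (v + a)))"
      proof cases
        case 1 then have "N dvd v - 2 * s" unfolding mod_eq_dvd_iff by (simp add: algebra_simps)
        then show ?thesis using sr by (simp add: dvd_diff_commute)
      next
        case 2 then have "N dvd v - 3 * s" unfolding mod_eq_dvd_iff by (simp add: algebra_simps)
        then show ?thesis using sr by (simp add: dvd_diff_commute)
      next
        case 3 then have "N dvd 3 * s - 2 * v" unfolding mod_eq_dvd_iff by (simp add: algebra_simps)
        then show ?thesis using sr by simp
      next
        case 4 then obtain a where "a \<in> S" "N dvd v - 2 * s - a" using memS by blast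
        then have "N dvd (v - a) - 2 * s" by (simp add: algebra_simps)
        then have "N dvd 2 * s - (v - a)" by (subst dvd_diff_commute)
        then have "s \<in> (\<Union>a\<in>S. ?L 2 (v - a))" using sr \<open>a \<in> S\<close> by (intro UN_I[of a]) auto
        then show ?thesis by blast
      next
        case 5 then obtain a where "a \<in> S" "N dvd 2 * s - v - a" using memS by blast
        then have "s \<in> (\<Union>a\<in>S. ?L 2 (v + a))" using sr by (intro UN_I[of a]) (auto simp: algebra_simps)
        then show ?thesis by blast
      next
        case 6 then show ?thesis using v vm by simp
      qed
    qed
    then have "card {s \<in> Q. act N g s \<in> cl s} \<le> card (?L 2 v \<union> ?L 3 v \<union> ?L 3 (2 * v)
        \<union> ((\<Union>a\<in>S. ?L 2 (v - a)) \<union> (\<Union>a\<in>S. ?L 2 (v + a))))"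
      by (intro card_mono finite_UnI finL fU)
    also have "\<dots> \<le> card (?L 2 v) + card (?L 3 v) + card (?L 3 (2 * v))
        + (card (\<Union>a\<in>S. ?L 2 (v - a)) + card (\<Union>a\<in>S. ?L 2 (v + a)))"
      by (meson card_Un_le add_mono order_trans order_refl)
    also have "\<dots> \<le> 2 + 3 + 3 + (2 * card S + 2 * card S)"
      by (intro add_mono cU card_linear_residues N) auto
    finally show ?thesis by simp
  qed
qed

end

section \<open>Lost pairs of open elements, and the one-step change of the differences\<close>

context good_state
begin

abbreviation "loss g s \<equiv> card {y \<in> Q. act N g y \<in> Q \<and> (y \<in> cl s \<or> act N g y \<in> cl s)}"

lemma cnt_Q_step: "real (cnt N g (Q - cl s) (Q - cl s)) = real (cnt N g Q Q) - real (loss g s)"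
proof -
  have "{x \<in> Q - cl s. act N g x \<in> Q - cl s}
      = {x \<in> Q. act N g x \<in> Q} - {y \<in> Q. act N g y \<in> Q \<and> (y \<in> cl s \<or> act N g y \<in> cl s)}" by auto
  then show ?thesis unfolding cnt_def using vD by (simp only:) (intro real_card_Diff, auto)
qed

lemma loss_le:
  assumes s: "s \<in> Q" shows "real (loss g s) \<le> 2 * hM"
proof -
  have "loss g s \<le> card (cl s \<union> {y \<in> Q. act N g y \<in> cl s})"
    using vD finite_cl by (intro card_mono) auto
  also have "\<dots> \<le> card (cl s) + card {y \<in> Q. act N g y \<in> cl s}" by (rule card_Un_le)
  also have "card {y \<in> Q. act N g y \<in> cl s} \<le> card (cl s)"
    using act_inj[of N g] vD(2) finite_cl by (intro card_inj_on_le[of "act N g"]) (auto intro: inj_on_subset)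
  finally have "loss g s \<le> 2 * card (cl s)" by simp
  then have "real (loss g s) \<le> real (2 * card (cl s))" by (rule of_nat_mono)
  then show ?thesis using card_cl_le[OF s] by simp
qed

text \<open>The double count for pairs: the choices that destroy the pair y, g(y) are those closed
  by one of its members.\<close>

lemma sum_loss:
  "(\<Sum>s\<in>Q. loss g s) = (\<Sum>y\<in>{y \<in> Q. act N g y \<in> Q}. card (cl y \<union> cl (act N g y)))"
proof -
  have "(\<Sum>s\<in>Q. loss g s) = (\<Sum>s\<in>Q. card {y \<in> {y \<in> Q. act N g y \<in> Q}. y \<in> cl s \<or> act N g y \<in> cl s})"
    by (intro sum.cong refl arg_cong[where f = card]) auto
  also have "\<dots> = (\<Sum>y\<in>{y \<in> Q. act N g y \<in> Q}. card {s \<in> Q. y \<in> cl s \<or> act N g y \<in> cl s})"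
    using vD by (intro sum_card_swap) auto
  also have "\<dots> = (\<Sum>y\<in>{y \<in> Q. act N g y \<in> Q}. card (cl y \<union> cl (act N g y)))"
    by (intro sum.cong refl arg_cong[where f = card]) (auto simp: closed_by_def clash_sym)
  finally show ?thesis .
qed

lemma sum_loss_le: "(\<Sum>s\<in>Q. real (loss g s)) \<le> cnt N g Q Q * (2 * hM)"
proof -
  have "(\<Sum>s\<in>Q. real (loss g s)) = (\<Sum>y\<in>{y \<in> Q. act N g y \<in> Q}. real (card (cl y \<union> cl (act N g y))))"
    using arg_cong[OF sum_loss, of real] by simp
  also have "\<dots> \<le> cnt N g Q Q * (2 * hM)"
    unfolding cnt_def
  proof (rule sum_bounded_above)
    fix y assume "y \<in> {y \<in> Q. act N g y \<in> Q}"
    then have "real (card (cl y)) \<le> hM" "real (card (cl (act N g y))) \<le> hM" using card_cl_le by auto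
    moreover have "real (card (cl y \<union> cl (act N g y))) \<le> real (card (cl y)) + real (card (cl (act N g y)))"
      using card_Un_le[of "cl y" "cl (act N g y)"] by (simp flip: of_nat_add)
    moreover have "a \<le> h \<Longrightarrow> b \<le> h \<Longrightarrow> u \<le> a + b \<Longrightarrow> u \<le> 2 * h" for a b u h :: real by linarith
    ultimately show "real (card (cl y \<union> cl (act N g y))) \<le> 2 * hM" by blast
  qed
  finally show ?thesis .
qed

text \<open>Each y in X is encoded by an a in S whose image under h is open, so one count on S
  bounds X, whether h is active or not.\<close>

lemma card_pullback_le:
  assumes h: "snd h \<in> {1..<N}" and X: "X \<subseteq> Q"
    and f: "\<And>y. y \<in> X \<Longrightarrow> f y \<in> S \<and> act N h (f y) = k y \<and> k y \<in> Q" and inj: "inj_on k X"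
  shows "real (card X) \<le> hi"
proof -
  have "card X \<le> card {a \<in> S. act N h a \<in> Q}"
  proof (rule card_inj_on_le[of f])
    show "inj_on f X"
    proof (rule inj_onI)
      fix x y assume "x \<in> X" "y \<in> X" "f x = f y"
      then have "k x = k y" using f by metis
      then show "x = y" using inj \<open>x \<in> X\<close> \<open>y \<in> X\<close> by (simp add: inj_on_def)
    qed
    show "f ` X \<subseteq> {a \<in> S. act N h a \<in> Q}" using f by fastforce
    show "finite {a \<in> S. act N h a \<in> Q}" using vD by auto
  qed
  then show ?thesis using cnt_le_hi[OF h] unfolding cnt_def by linarith
qed

text \<open>These are the pairs for which a member may close too little or the two members share
  closing maps. Cases involving an element of S are pulled back to a count, at most
  \<open>hi\<close> each; the others are congruences for 2 y with at most two solutions.\<close>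

lemma card_bad_pairs:
  assumes g: "snd g \<in> {1..<N}"
  defines "E \<equiv> {y \<in> Q. act N g y \<in> Q \<and> (exceptional N S y \<or> exceptional N S (act N g y)
      \<or> y = act N g y \<or> y = (- act N g y) mod N)}"
  shows "real (card E) \<le> 2 * hi + 8"
proof -
  obtain b v where gb: "g = (b, v)" by (cases g)
  have v: "v \<in> {1..<N}" using g gb by simp
  have nd: "\<not> N dvd v" using v zdvd_imp_le by fastforce
  let ?D = "\<lambda>d. {x \<in> {0..<N}. N dvd 2 * x - d}"
  have finD: "finite (?D d)" for d by (rule finite_subset[of _ "{0..<N}"]) auto
  let ?E1 = "{y \<in> Q. act N g y \<in> Q \<and> (- y) mod N \<in> S}"
  let ?E2 = "{y \<in> Q. act N g y \<in> Q \<and> (- act N g y) mod N \<in> S}"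
  \<comment> \<open>Of the equations g(y) = y and g(y) = - y, one does not depend on y and fails as
    v is nonzero; the other reads 2 y = e.\<close>
  define e where "e = (if b then - v else v)"
  have E: "E \<subseteq> (?E1 \<union> ?E2) \<union> (?D 0 \<union> ?D (2 * e) \<union> ?D e)"
  proof
    fix y assume y: "y \<in> E"
    then have yr: "y \<in> {0..<N}" "y mod N = y" using vD by (auto simp: E_def)
    from y consider "(- y) mod N \<in> S" | "(- y) mod N = y" | "(- act N g y) mod N \<in> S"
      | "(- act N g y) mod N = act N g y" | "act N g y = y" | "(- act N g y) mod N = y"
      unfolding E_def exceptional_def by auto
    then show "y \<in> (?E1 \<union> ?E2) \<union> (?D 0 \<union> ?D (2 * e) \<union> ?D e)"
    proof cases
      case 1 then show ?thesis using y by (auto simp: E_def)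
    next
      case 2 then have "(- y) mod N = y mod N" using yr by simp
      then show ?thesis using yr unfolding mod_eq_dvd_iff by simp
    next
      case 3 then show ?thesis using y by (auto simp: E_def)
    next
      case 4
      show ?thesis
      proof (cases b)
        case True
        have "(- (y + v)) mod N = (y + v) mod N" using 4 by (simp add: act_def gb True mod_simps)
        then have "N dvd 2 * y - 2 * (- v)" unfolding mod_eq_dvd_iff
          by (subst dvd_minus_iff[symmetric]) (simp add: algebra_simps)
        then show ?thesis using yr True by (simp add: e_def)
      next
        case False
        have "(y - v) mod N = (- y + v) mod N" using 4 by (simp add: act_def gb False mod_simps)
        then have "N dvd 2 * y - 2 * v" unfolding mod_eq_dvd_iff by (simp add: algebra_simps)
        then show ?thesis using yr False by (simp add: e_def)
      qed
    next
      case 5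
      show ?thesis
      proof (cases b)
        case True
        have "(y + v) mod N = y mod N" using 5 yr by (simp add: act_def gb True)
        then show ?thesis using nd unfolding mod_eq_dvd_iff by simp
      next
        case False
        have "y mod N = (- y + v) mod N" using 5 yr by (simp add: act_def gb False)
        then have "N dvd 2 * y - v" unfolding mod_eq_dvd_iff by (simp add: algebra_simps)
        then show ?thesis using yr False by (simp add: e_def)
      qed
    next
      case 6
      show ?thesis
      proof (cases b)
        case True
        have "y mod N = (- (y + v)) mod N" using 6 yr by (simp add: act_def gb True mod_simps)
        then have "N dvd 2 * y - (- v)" unfolding mod_eq_dvd_iff by (simp add: algebra_simps)
        then show ?thesis using yr True by (simp add: e_def)
      next
        case False
        have "y mod N = (- (- y + v)) mod N" using 6 yr by (simp add: act_def gb False mod_simps)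
        then show ?thesis using nd unfolding mod_eq_dvd_iff by simp
      qed
    qed
  qed
  have "card E \<le> card ((?E1 \<union> ?E2) \<union> (?D 0 \<union> ?D (2 * e) \<union> ?D e))"
    using vD by (intro card_mono[OF _ E] finite_UnI finD) auto
  also have "\<dots> \<le> (card ?E1 + card ?E2) + (card (?D 0) + card (?D (2 * e)) + card (?D e))"
    by (meson card_Un_le add_mono order_trans order_refl)
  also have "\<dots> \<le> (card ?E1 + card ?E2) + (2 + 2 + 2)"
    by (intro add_mono card_double order_refl)
  finally have cE: "real (card E) \<le> real (card ?E1) + real (card ?E2) + 6" by linarith
  \<comment> \<open>With a = - y in S, the map of opposite sign and the same shift sends a to g(y),
    which is open.\<close>
  have E1: "real (card ?E1) \<le> hi"
  proof (rule card_pullback_le[where h = "(\<not> b, v)" and f = "\<lambda>y. (- y) mod N" and k = "act N g"])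
    show "inj_on (act N g) ?E1" using act_inj[of N g] vD(2) by (auto intro: inj_on_subset)
  qed (use v in \<open>auto simp: act_def gb mod_simps add.commute\<close>)
  \<comment> \<open>With a = - g(y) in S, the way back from a to the open element y has opposite
    sign and shift e.\<close>
  have E2: "real (card ?E2) \<le> hi"
  proof (rule card_pullback_le[where h = "(\<not> b, e mod N)" and f = "\<lambda>y. (- act N g y) mod N" and k = "\<lambda>y. y"])
    show "snd (\<not> b, e mod N) \<in> {1..<N}" using v by (auto simp: e_def zmod_zminus1_eq_if)
    fix y assume y: "y \<in> ?E2"
    have "act N (\<not> b, e mod N) ((- act N g y) mod N) = y mod N"
      by (cases b) (simp_all add: act_def gb e_def mod_simps)
    then show "(- act N g y) mod N \<in> S \<and> act N (\<not> b, e mod N) ((- act N g y) mod N) = y \<and> y \<in> Q"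
      using y vD(2) by auto
  qed auto
  show ?thesis using cE E1 E2 by linarith
qed

text \<open>Inclusion and exclusion on the remaining pairs: each member closes at least
  \<open>hm\<close>, and the common part is at most 9 kap + 8. Bad pairs are charged 6 c
  each.\<close>

lemma sum_loss_ge:
  assumes g: "snd g \<in> {1..<N}"
  shows "(\<Sum>s\<in>Q. real (loss g s)) \<ge> cnt N g Q Q * (2 * hm - 9 * kap - 8) - (2 * hi + 8) * (6 * c)"
proof -
  let ?X = "{y \<in> Q. act N g y \<in> Q}"
  let ?E = "{y \<in> Q. act N g y \<in> Q \<and> (exceptional N S y \<or> exceptional N S (act N g y)
      \<or> y = act N g y \<or> y = (- act N g y) mod N)}"
  let ?h = "2 * hm - 9 * kap - 8"
  have fX: "finite ?X" using vD by auto
  have E: "real (card ?E) \<le> 2 * hi + 8" by (rule card_bad_pairs[OF g])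
  have "real (cnt N g Q Q) * ?h - (2 * hi + 8) * (6 * c) \<le> real (card (?X - ?E)) * ?h"
  proof -
    have "real (card (?X - ?E)) = real (cnt N g Q Q) - real (card ?E)"
      unfolding cnt_def using fX by (intro real_card_Diff) auto
    moreover have "real (card ?E) * ?h \<le> (2 * hi + 8) * (6 * c)"
    proof -
      have "real (card ?E) * ?h \<le> real (card ?E) * (6 * c)" using c kap0 by (intro mult_left_mono) auto
      also have "\<dots> \<le> (2 * hi + 8) * (6 * c)" using E c by (intro mult_right_mono) auto
      finally show ?thesis .
    qed
    ultimately show ?thesis by (simp add: left_diff_distrib)
  qed
  also have "\<dots> \<le> (\<Sum>y\<in>?X - ?E. real (card (cl y \<union> cl (act N g y))))"
  proof (rule sum_bounded_below)
    fix y assume "y \<in> ?X - ?E"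
    then have y: "y \<in> Q" "act N g y \<in> Q" "\<not> exceptional N S y" "\<not> exceptional N S (act N g y)"
      "y \<noteq> act N g y" "y \<noteq> (- act N g y) mod N" by auto
    have "real (card (cl y)) + real (card (cl (act N g y)))
        = real (card (cl y \<union> cl (act N g y))) + real (card (cl y \<inter> cl (act N g y)))"
      using card_Un_Int[OF finite_cl finite_cl] by (simp flip: of_nat_add)
    moreover have "a + b = u + v \<Longrightarrow> h \<le> a \<Longrightarrow> h \<le> b \<Longrightarrow> v \<le> k + 8 \<Longrightarrow> 2 * h - k - 8 \<le> u"
      for a b u v h k :: real by linarith
    ultimately show "?h \<le> real (card (cl y \<union> cl (act N g y)))"
      using card_cl_ge[OF y(1,3)] card_cl_ge[OF y(2,4)] card_cl_Int_le[OF y(1,2,5,6)] by blast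
  qed
  also have "\<dots> \<le> (\<Sum>y\<in>?X. real (card (cl y \<union> cl (act N g y))))"
    using fX by (intro sum_mono2) auto
  also have "\<dots> = (\<Sum>s\<in>Q. real (loss g s))"
    using arg_cong[OF sum_loss, of real] by simp
  finally show ?thesis .
qed

definition dW :: "bool \<times> int \<Rightarrow> bool \<times> int \<Rightarrow> int \<Rightarrow> real" where
  "dW g g' s = (real (cnt N g (Q - cl s) (Q - cl s)) - cnt N g' (Q - cl s) (Q - cl s))
     - (real (cnt N g Q Q) - cnt N g' Q Q)"

lemma dW_eq: "dW g g' s = real (loss g' s) - real (loss g s)"
  unfolding dW_def cnt_Q_step by simp

lemma dW_bound: "s \<in> Q \<Longrightarrow> \<bar>dW g g' s\<bar> \<le> 2 * hM"
  unfolding dW_eq using loss_le[of s g] loss_le[of s g'] by (simp add: abs_le_iff)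

lemma sum_abs_dW:
  assumes "real (cnt N g Q Q) \<le> WM" "real (cnt N g' Q Q) \<le> WM"
  shows "(\<Sum>s\<in>Q. \<bar>dW g g' s\<bar>) \<le> 4 * hM * WM"
proof -
  have "(\<Sum>s\<in>Q. \<bar>dW g g' s\<bar>) \<le> (\<Sum>s\<in>Q. real (loss g' s) + real (loss g s))"
    by (intro sum_mono) (simp add: dW_eq abs_le_iff)
  also have "\<dots> \<le> cnt N g' Q Q * (2 * hM) + cnt N g Q Q * (2 * hM)"
    unfolding sum.distrib by (intro add_mono sum_loss_le)
  also have "\<dots> \<le> WM * (2 * hM) + WM * (2 * hM)"
    using assms hi0 by (intro add_mono mult_right_mono) auto
  finally show ?thesis by (simp add: algebra_simps)
qed

text \<open>The upper and lower bounds for the mean loss share the main term 6 c times the count.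
  Combining them leaves the self-correction - 6 c times the difference and an error proportional to
  the oscillation \<open>hi - lo\<close>.\<close>

lemma sum_dW:
  assumes g: "snd g \<in> {1..<N}" and WM: "real (cnt N g Q Q) \<le> WM" "real (cnt N g' Q Q) \<le> WM"
  shows "(\<Sum>s\<in>Q. dW g g' s) \<le> - 6 * c * (real (cnt N g Q Q) - cnt N g' Q Q)
      + WM * (6 * (hi - lo) + 15 * kap + 16) + (2 * hi + 8) * (6 * c)"
proof -
  let ?W = "real (cnt N g Q Q)" and ?W' = "real (cnt N g' Q Q)"
  have "(\<Sum>s\<in>Q. dW g g' s) \<le> ?W' * (2 * hM) - (?W * (2 * hm - 9 * kap - 8) - (2 * hi + 8) * (6 * c))"
    unfolding dW_eq sum_subtractf using sum_loss_le[of g'] sum_loss_ge[OF g] by linarith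
  also have "\<dots> = - 6 * c * (?W - ?W') + ?W' * (2 * hM - 6 * c) + ?W * (6 * c - (2 * hm - 9 * kap - 8))
      + (2 * hi + 8) * (6 * c)" by (simp add: algebra_simps)
  also have "\<dots> \<le> - 6 * c * (?W - ?W') + WM * (2 * hM - 6 * c) + WM * (6 * c - (2 * hm - 9 * kap - 8))
      + (2 * hi + 8) * (6 * c)"
    using c kap0 WM by (intro add_mono mult_right_mono order_refl) auto
  also have "\<dots> = - 6 * c * (?W - ?W') + WM * (6 * (hi - lo) + 15 * kap + 16) + (2 * hi + 8) * (6 * c)"
    by (simp add: algebra_simps)
  finally show ?thesis .
qed

text \<open>The increment is set to 0 when s deactivates one of the two maps. The potential of the
  pair is 0 from then on, so an estimate with increment 0 stays valid, whereas the true difference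
  could jump by far more than \<open>dU_bound\<close> allows.\<close>

definition dU :: "bool \<times> int \<Rightarrow> bool \<times> int \<Rightarrow> int \<Rightarrow> real" where
  "dU g g' s = (if active N (insert s S) g \<and> active N (insert s S) g'
     then (real (cnt N g (insert s S) (Q - cl s)) - cnt N g' (insert s S) (Q - cl s))
       - (real (cnt N g S Q) - cnt N g' S Q) else 0)"

abbreviation "lossU g s \<equiv> card {a \<in> S. act N g a \<in> cl s}"

lemma dU_eq:
  assumes "s \<in> Q" "active N (insert s S) g" "active N (insert s S) g'"
  shows "dU g g' s = of_bool (act N g s \<in> Q - cl s) - of_bool (act N g' s \<in> Q - cl s)
     + real (lossU g' s) - real (lossU g s)"
  unfolding dU_def cnt_S_step[OF assms(1)] using assms(2,3) by simp

text \<open>Every closing map of s is deactivated by s, so a map that survives the step loses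
  overlaps only.\<close>

lemma lossU_le:
  assumes "s \<in> Q" "active N (insert s S) g" shows "real (lossU g s) \<le> 3 * kap + 4"
proof (rule card_act_cl_le[OF assms(1)])
  show "snd g \<in> {0..<N}" using assms(2) by (auto simp: active_def)
  show "g \<notin> closers N s"
  proof
    assume "g \<in> closers N s"
    moreover have "(- ((- s) mod N)) mod N = s" using vD(2) assms(1) by (auto simp: mod_simps)
    ultimately show False using assms(2) by (auto simp: closers_def active_def)
  qed
qed

lemma dU_bound:
  assumes "s \<in> Q" shows "\<bar>dU g g' s\<bar> \<le> 3 * kap + 5"
proof (cases "active N (insert s S) g \<and> active N (insert s S) g'")
  case True
  then have "real (lossU g s) \<le> 3 * kap + 4" "real (lossU g' s) \<le> 3 * kap + 4"
    using lossU_le[OF assms] by blast+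
  then show ?thesis using True dU_eq[OF assms, of g g']
    by (auto simp: abs_le_iff of_bool_def split: if_splits)
next
  case False then show ?thesis using kap0 by (auto simp: dU_def)
qed

lemma sum_hit: "(\<Sum>s\<in>Q. of_bool (act N g s \<in> Q)) = real (cnt N g Q Q)"
  using vD by (simp add: cnt_def Int_def)

text \<open>The second moment of the increment is later bounded by its maximum times this mean
  absolute value.\<close>

lemma sum_abs_dU:
  assumes g: "active N S g" "active N S g'"
    and WM: "real (cnt N g Q Q) \<le> WM" "real (cnt N g' Q Q) \<le> WM"
  shows "(\<Sum>s\<in>Q. \<bar>dU g g' s\<bar>) \<le> 2 * WM + 2 * (hi * hM)"
proof -
  have "\<bar>dU g g' s\<bar> \<le> (of_bool (act N g s \<in> Q) + of_bool (act N g' s \<in> Q)) + (real (lossU g s) + real (lossU g' s))"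
    if "s \<in> Q" for s
  proof (cases "active N (insert s S) g \<and> active N (insert s S) g'")
    case True
    then show ?thesis using dU_eq[OF that, of g g'] by (auto simp: abs_le_iff of_bool_def split: if_splits)
  qed (auto simp: dU_def)
  then have "(\<Sum>s\<in>Q. \<bar>dU g g' s\<bar>) \<le> (\<Sum>s\<in>Q. (of_bool (act N g s \<in> Q) + of_bool (act N g' s \<in> Q)) + (real (lossU g s) + real (lossU g' s)))"
    by (rule sum_mono)
  also have "\<dots> = (real (cnt N g Q Q) + cnt N g' Q Q) + ((\<Sum>s\<in>Q. real (lossU g s)) + (\<Sum>s\<in>Q. real (lossU g' s)))"
    unfolding sum.distrib sum_hit ..
  also have "\<dots> \<le> (WM + WM) + (hi * hM + hi * hM)"
  proof (intro add_mono WM)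
    have "(\<Sum>s\<in>Q. real (lossU h s)) \<le> hi * hM" if "active N S h" for h
    proof -
      have "(\<Sum>s\<in>Q. real (lossU h s)) \<le> cnt N h S Q * hM" by (rule sum_card_act_cl_le)
      also have "\<dots> \<le> hi * hM" using act_bounds[OF that] hi0 by (intro mult_right_mono) auto
      finally show ?thesis .
    qed
    then show "(\<Sum>s\<in>Q. real (lossU g s)) \<le> hi * hM" "(\<Sum>s\<in>Q. real (lossU g' s)) \<le> hi * hM" using g by blast+
  qed
  finally show ?thesis by simp
qed

lemma card_deactivate:
  assumes "active N S g"
  shows "card {s \<in> Q. \<not> active N (insert s S) g} \<le> 2"
proof -
  have "{s \<in> Q. \<not> active N (insert s S) g} \<subseteq> {snd g, (- snd g) mod N}"
    using assms by (auto simp: active_def)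
  then have "card {s \<in> Q. \<not> active N (insert s S) g} \<le> card {snd g, (- snd g) mod N}" by (intro card_mono) auto
  then show ?thesis by (auto simp: card_insert_if split: if_splits)
qed

text \<open>The gain from s itself has mean proportional to the number of open pairs, and this is
  how the second difference enters as a source. The losses give the self-correction - 3 c times the
  difference. The last three terms collect the choices that close their own image and the at most
  four choices that deactivate a map.\<close>

lemma sum_dU:
  assumes g: "active N S g" "active N S g'"
  shows "(\<Sum>s\<in>Q. dU g g' s) \<le> - 3 * c * (real (cnt N g S Q) - cnt N g' S Q)
      + (real (cnt N g Q Q) - cnt N g' Q Q)
      + hi * (3 * (hi - lo) + 3 * kap + 4) + (kap + 2) * (3 * c) + 4 * real (card S) + 12 + 4 * hi"
proof -
  let ?U = "real (cnt N g S Q)" and ?U' = "real (cnt N g' S Q)"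
  have gr: "snd g \<in> {1..<N}" using g by (auto simp: active_def)
  define B where "B = {s \<in> Q. \<not> active N (insert s S) g \<or> \<not> active N (insert s S) g'}"
  have cB: "real (card B) \<le> 4"
  proof -
    have "B = {s \<in> Q. \<not> active N (insert s S) g} \<union> {s \<in> Q. \<not> active N (insert s S) g'}"
      by (auto simp: B_def)
    then have "card B \<le> 2 + 2"
      using card_deactivate[OF g(1)] card_deactivate[OF g(2)]
        card_Un_le[of "{s \<in> Q. \<not> active N (insert s S) g}" "{s \<in> Q. \<not> active N (insert s S) g'}"] by simp
    then show ?thesis by simp
  qed
  \<comment> \<open>For a deactivating s the left side is 0 while the main expression can fall to -
    1 - hi; the last term makes up for it.\<close>
  have pt: "dU g g' s \<le> of_bool (act N g s \<in> Q) - of_bool (act N g' s \<in> Q) + of_bool (act N g' s \<in> cl s)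
      + real (lossU g' s) - real (lossU g s) + of_bool (s \<in> B) * (1 + hi)" if s: "s \<in> Q" for s
  proof (cases "s \<in> B")
    case False
    then show ?thesis using dU_eq[OF s, of g g'] s by (auto simp: B_def of_bool_def)
  next
    case True
    have "lossU g s \<le> cnt N g S Q" unfolding cnt_def using vD
      by (intro card_mono) (auto simp: closed_by_def)
    then have "real (lossU g s) \<le> hi" using act_bounds[OF g(1)] by linarith
    moreover have "dU g g' s = 0" using True by (auto simp: B_def dU_def)
    ultimately show ?thesis using True by (auto simp: of_bool_def)
  qed
  have selfc: "(\<Sum>s\<in>Q. of_bool (act N g' s \<in> cl s)) \<le> 4 * real (card S) + 8"
    using card_self_closed[OF g(2)] vD by (simp add: Int_def)
  have sB: "(\<Sum>s\<in>Q. of_bool (s \<in> B) * (1 + hi)) \<le> 4 * (1 + hi)"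
  proof -
    have "(\<Sum>s\<in>Q. of_bool (s \<in> B) * (1 + hi)) = real (card (Q \<inter> B)) * (1 + hi)"
      using vD by (simp flip: sum_distrib_right)
    moreover have "Q \<inter> B = B" by (auto simp: B_def)
    ultimately show ?thesis using mult_right_mono[OF cB, of "1 + hi"] hi0 by simp
  qed
  have "(\<Sum>s\<in>Q. dU g g' s) \<le> (\<Sum>s\<in>Q. of_bool (act N g s \<in> Q) - of_bool (act N g' s \<in> Q) + of_bool (act N g' s \<in> cl s)
      + real (lossU g' s) - real (lossU g s) + of_bool (s \<in> B) * (1 + hi))"
    by (intro sum_mono pt)
  also have "\<dots> = real (cnt N g Q Q) - cnt N g' Q Q + (\<Sum>s\<in>Q. of_bool (act N g' s \<in> cl s))
      + (\<Sum>s\<in>Q. real (lossU g' s)) - (\<Sum>s\<in>Q. real (lossU g s)) + (\<Sum>s\<in>Q. of_bool (s \<in> B) * (1 + hi))"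
    unfolding sum.distrib sum_subtractf sum_hit ..
  also have "\<dots> \<le> real (cnt N g Q Q) - cnt N g' Q Q + (4 * real (card S) + 8)
      + ?U' * hM - (?U * hm - (kap + 2) * (3 * c)) + 4 * (1 + hi)"
    using selfc sB sum_card_act_cl_le[of g'] sum_card_act_cl_ge[OF gr] by linarith
  finally have 1: "(\<Sum>s\<in>Q. dU g g' s) \<le> real (cnt N g Q Q) - cnt N g' Q Q + (4 * real (card S) + 8)
      + ?U' * hM - (?U * hm - (kap + 2) * (3 * c)) + 4 * (1 + hi)" .
  have "?U' * hM - ?U * hm = - 3 * c * (?U - ?U') + ?U' * (hM - 3 * c) + ?U * (3 * c - hm)"
    by (simp add: algebra_simps)
  also have "\<dots> \<le> - 3 * c * (?U - ?U') + hi * (hM - 3 * c) + hi * (3 * c - hm)"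
    using act_bounds[OF g(1)] act_bounds[OF g(2)] c kap0
    by (intro add_mono mult_right_mono order_refl) auto
  also have "\<dots> = - 3 * c * (?U - ?U') + hi * (3 * (hi - lo) + 3 * kap + 4)"
    by (simp add: algebra_simps)
  finally have 2: "?U' * hM - ?U * hm \<le> - 3 * c * (?U - ?U') + hi * (3 * (hi - lo) + 3 * kap + 4)" .
  have "A - B \<le> C \<Longrightarrow> D \<le> W + E + A - (B - F) + G \<Longrightarrow> D \<le> C + W + F + E + G"
    for A B C D E F G W :: real by linarith
  from this[OF 2 1] show ?thesis by (simp add: algebra_simps)
qed

end

section \<open>Growth of overlaps when an element joins S\<close>

lemma overlap_insert:
  assumes N: "N > 0" and S: "S \<subseteq> {0..<N}" and s: "s \<in> {0..<N}"
  shows "overlap N g h (insert s S) \<le> overlap N g h S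
      + (of_bool (act N g s \<in> act N h ` S) + of_bool (act N h s \<in> act N g ` S) + of_bool (act N g s = act N h s))"
proof -
  have fin: "finite S" using S by (rule finite_subset) simp
  let ?X = "(if act N g s \<in> act N h ` S then {act N g s} else {})"
    and ?Y = "(if act N h s \<in> act N g ` S then {act N h s} else {})"
    and ?Z = "(if act N g s = act N h s then {act N g s} else {})"
  have "act N g ` insert s S \<inter> act N h ` insert s S \<subseteq> (act N g ` S \<inter> act N h ` S) \<union> (?X \<union> ?Y \<union> ?Z)"
    by (auto split: if_splits)
  then have "overlap N g h (insert s S) \<le> card ((act N g ` S \<inter> act N h ` S) \<union> (?X \<union> ?Y \<union> ?Z))"
    unfolding overlap_def using fin by (intro card_mono) auto
  also have "\<dots> \<le> overlap N g h S + (card ?X + card ?Y + card ?Z)"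
    unfolding overlap_def by (meson card_Un_le add_mono order_trans order_refl)
  also have "card ?X + card ?Y + card ?Z
     = of_bool (act N g s \<in> act N h ` S) + of_bool (act N h s \<in> act N g ` S) + of_bool (act N g s = act N h s)"
    by simp
  finally show ?thesis by simp
qed

text \<open>An image of s meets the other image of S for at most |S| choices on either side, and
  g(s) = h(s) has no solution for equal signs and at most two for opposite signs.\<close>

lemma card_overlap_increase:
  assumes N: "N > 0" and S: "S \<subseteq> {0..<N}" and Q: "Q \<subseteq> {0..<N}"
    and gh: "g \<noteq> h" "snd g \<in> {0..<N}" "snd h \<in> {0..<N}"
  shows "card {s \<in> Q. act N g s \<in> act N h ` S \<or> act N h s \<in> act N g ` S \<or> act N g s = act N h s}
     \<le> 2 * card S + 2"
proof -
  have fS: "finite S" and fQ: "finite Q" using S Q finite_subset by blast+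
  have 1: "card {s \<in> Q. act N g s \<in> act N h ` S} \<le> card S" for g h
  proof -
    have "card {s \<in> Q. act N g s \<in> act N h ` S} \<le> card (act N h ` S)"
      using act_inj[of N g] Q fS by (intro card_inj_on_le[of "act N g"]) (auto intro: inj_on_subset)
    also have "\<dots> = card S" by (rule card_act_image[OF S])
    finally show ?thesis .
  qed
  have 2: "card {s \<in> Q. act N g s = act N h s} \<le> 2"
  proof -
    let ?d = "if fst g then snd h - snd g else snd g - snd h"
    have "{s \<in> Q. act N g s = act N h s} \<subseteq> {x \<in> {0..<N}. N dvd 2 * x - ?d}"
    proof
      fix s assume s: "s \<in> {s \<in> Q. act N g s = act N h s}"
      then have d: "N dvd ((if fst g then s else - s) + snd g) - ((if fst h then s else - s) + snd h)"
        by (simp only: act_eq_iff mem_Collect_eq)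
      have "fst g \<noteq> fst h"
      proof
        assume e: "fst g = fst h"
        then have "N dvd snd g - snd h" using d by (simp split: if_splits)
        then have "snd g = snd h" using gh by (intro residue_eqI)
        then show False using e gh(1) by (simp add: prod_eq_iff)
      qed
      then have "N dvd 2 * s - ?d"
      proof (cases "fst g")
        case True
        then show ?thesis using d \<open>fst g \<noteq> fst h\<close> by (simp add: algebra_simps)
      next
        case False
        then have "N dvd (- s + snd g) - (s + snd h)" using d \<open>fst g \<noteq> fst h\<close> by simp
        then have "N dvd - ((- s + snd g) - (s + snd h))" by (simp only: dvd_minus_iff)
        then show ?thesis using False by (simp add: algebra_simps)
      qed
      then show "s \<in> {x \<in> {0..<N}. N dvd 2 * x - ?d}" using s Q by auto
    qed
    moreover have "finite {x \<in> {0..<N}. N dvd 2 * x - ?d}" by (rule finite_subset[of _ "{0..<N}"]) auto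
    ultimately have "card {s \<in> Q. act N g s = act N h s} \<le> card {x \<in> {0..<N}. N dvd 2 * x - ?d}"
      by (intro card_mono)
    also have "\<dots> \<le> 2" using card_linear_residues[OF N, of 2 ?d] by simp
    finally show ?thesis .
  qed
  have "{s \<in> Q. act N g s \<in> act N h ` S \<or> act N h s \<in> act N g ` S \<or> act N g s = act N h s}
     = {s \<in> Q. act N g s \<in> act N h ` S} \<union> {s \<in> Q. act N h s \<in> act N g ` S} \<union> {s \<in> Q. act N g s = act N h s}"
    by auto
  also have "card \<dots> \<le> card S + card S + 2"
    using 1[of g h] 1[of h g] 2 by (meson card_Un_le add_mono order_trans)
  finally show ?thesis by simp
qed

subsection \<open>Averages over all reflections\<close>

text \<open>For each x and y exactly one reflection carries x to y, so the total is exact for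
  arbitrary sets. Activity of a reflection with nonzero shift v only asks that v is not in S, which
  makes reflections convenient for averaging.\<close>

lemma sum_cnt_reflections:
  assumes N: "N > 0" and X: "X \<subseteq> {0..<N}" and Y: "Y \<subseteq> {0..<N}"
  shows "(\<Sum>v\<in>{0..<N}. cnt N (False, v) X Y) = card X * card Y"
proof -
  have fX: "finite X" using X by (rule finite_subset) simp
  have "(\<Sum>v\<in>{0..<N}. cnt N (False, v) X Y) = (\<Sum>x\<in>X. card {v \<in> {0..<N}. act N (False, v) x \<in> Y})"
    unfolding cnt_def using fX by (intro sum_card_swap) auto
  also have "\<dots> = (\<Sum>x\<in>X. card Y)"
  proof (rule sum.cong[OF refl])
    fix x assume "x \<in> X"
    have "{v \<in> {0..<N}. act N (False, v) x \<in> Y} = {v \<in> {0..<N}. act N (True, - x) v \<in> Y}"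
      by (auto simp: act_def algebra_simps)
    then have "card {v \<in> {0..<N}. act N (False, v) x \<in> Y} = cnt N (True, - x) {0..<N} Y" by (simp add: cnt_def)
    also have "\<dots> = card (act N (True, - x) ` {0..<N} \<inter> Y)" by (intro cnt_eq_card_image) auto
    also have "act N (True, - x) ` {0..<N} = {0..<N}"
      using act_inj[of N "(True, - x)"] act_range[OF N] by (intro endo_inj_surj) auto
    also have "{0..<N} \<inter> Y = Y" using Y by auto
    finally show "card {v \<in> {0..<N}. act N (False, v) x \<in> Y} = card Y" .
  qed
  finally show ?thesis by simp
qed

lemma cnt_le_card: "finite X \<Longrightarrow> cnt N g X Y \<le> card X"
  unfolding cnt_def by (intro card_mono) auto

lemma finite_active: "finite {g. active N S g}"
  by (rule finite_subset[of _ "UNIV \<times> {1..<N}"]) (auto simp: active_def)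

text \<open>If one count exceeded the bound, all reflections of nonzero shift would have at least
  q^2 / N + 2, and their total would pass q^2. The 2 makes up for the missing shift 0.\<close>

lemma cnt_upper_by_average:
  assumes N: "N > 2" and Q: "Q \<subseteq> {0..<N}"
    and osc: "\<And>g h. snd g \<in> {1..<N} \<Longrightarrow> snd h \<in> {1..<N} \<Longrightarrow> real (cnt N g Q Q) - cnt N h Q Q \<le> w"
    and g: "snd g \<in> {1..<N}"
  shows "real (cnt N g Q Q) \<le> (real (card Q))^2 / N + w + 2"
proof (rule ccontr)
  let ?q = "real (card Q)"
  assume "\<not> ?thesis"
  then have big: "?q^2 / N + 2 \<le> real (cnt N (False, v) Q Q)" if "v \<in> {1..<N}" for v
    using osc[OF g, of "(False, v)"] that by simp
  have qN: "?q \<le> N"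
  proof -
    have "card Q \<le> card {0..<N}" using Q by (intro card_mono) auto
    then show ?thesis using N by simp
  qed
  have "real (card {1..<N}) * (?q^2 / N + 2) \<le> (\<Sum>v\<in>{1..<N}. real (cnt N (False, v) Q Q))"
    by (rule sum_bounded_below[OF big])
  also have "\<dots> \<le> (\<Sum>v\<in>{0..<N}. real (cnt N (False, v) Q Q))" by (intro sum_mono2) auto
  also have "\<dots> = ?q * ?q" using arg_cong[OF sum_cnt_reflections[OF _ Q Q], of real] N by simp
  finally have "(real_of_int N - 1) * (?q^2 / N + 2) \<le> ?q^2" using N by (simp add: power2_eq_square)
  moreover have "(real_of_int N - 1) * (?q^2 / N + 2) = ?q^2 - ?q^2 / N + 2 * N - 2"
    using N by (simp add: field_simps)
  moreover have "?q^2 / N \<le> N"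
  proof -
    have "?q^2 \<le> (real_of_int N)^2" using qN by (intro power_mono) auto
    then show ?thesis using N by (simp add: divide_le_eq power2_eq_square)
  qed
  ultimately show False using N by linarith
qed

text \<open>A known average and an oscillation of at most u locate every count. In the total,
  inactive reflections contribute 0 except shift 0, which adds at most |S|; so some active count is
  at least c - 1. Dividing by N - 1 - |S| instead of N raises c by at most 2 (|S| + 1)^2 / N, so
  some active count is at most c + kap.\<close>

lemma cnt_bounds_by_average:
  assumes N: "N > 0" and v: "valid_state N S Q" and kap: "1 \<le> kap" "2 * (real (card S) + 1)^2 / N \<le> kap"
    and SN: "2 * (int (card S) + 1) \<le> N" and u: "u \<ge> 0"
    and osc: "\<And>g h. active N S g \<Longrightarrow> active N S h \<Longrightarrow> real (cnt N g S Q) - cnt N h S Q \<le> u"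
  defines "c \<equiv> real (card S) * real (card Q) / N"
  shows "\<exists>(lo::real) (hi::real). lo \<le> c \<and> c \<le> hi \<and> hi \<le> c + u + kap \<and> hi - lo \<le> u + kap
     \<and> (\<forall>g. active N S g \<longrightarrow> lo \<le> cnt N g S Q \<and> cnt N g S Q \<le> hi)"
proof -
  note vD = valid_stateD[OF v]
  let ?i = "real (card S)" and ?q = "real (card Q)"
  let ?A = "{v \<in> {1..<N}. v \<notin> S}"
  have act: "active N S (False, v)" if "v \<in> ?A" for v using that by (auto simp: active_def)
  have S0: "0 \<notin> S"
  proof
    assume "0 \<in> S"
    then have "(0 + 0) mod N \<notin> S" using v unfolding valid_state_def mod_sum_free_def by blast
    then show False using \<open>0 \<in> S\<close> by simp
  qed
  have SA: "S \<subseteq> {1..<N}"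
  proof
    fix x assume "x \<in> S"
    then have "x \<in> {0..<N}" "x \<noteq> 0" using vD(1) S0 by auto
    then show "x \<in> {1..<N}" by simp
  qed
  have "?A = {1..<N} - S" by auto
  then have cA: "real (card ?A) = real_of_int N - 1 - ?i" using real_card_Diff[OF _ SA] N by simp
  have qN: "?q \<le> N"
  proof -
    have "card Q \<le> card {0..<N}" using vD(2) by (intro card_mono) auto
    then show ?thesis using N by simp
  qed
  have SN': "2 * (?i + 1) \<le> N"
  proof -
    have "real_of_int (2 * (int (card S) + 1)) \<le> real_of_int N" using SN by (simp only: of_int_le_iff)
    then show ?thesis by simp
  qed
  have c0: "c \<ge> 0" using N by (simp add: c_def)
  have ci: "c \<le> ?i" using qN N mult_left_mono[OF qN, of ?i] by (simp add: c_def divide_le_eq)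
  have cN: "c * N = ?i * ?q" using N by (simp add: c_def)
  have tot: "(\<Sum>v\<in>{0..<N}. real (cnt N (False, v) S Q)) = ?i * ?q"
    using arg_cong[OF sum_cnt_reflections[OF N vD(1,2)], of real] by simp
  have fA: "finite ?A" by (rule finite_subset[of _ "{1..<N}"]) auto
  have Ane: "?A \<noteq> {}"
  proof
    assume "?A = {}"
    then have "real (card ?A) = 0" by (simp only: card.empty of_nat_0)
    then have "real_of_int N = ?i + 1" using cA by linarith
    moreover have "?i \<ge> 0" by simp
    ultimately show False using SN' by simp
  qed
  have ex1: "\<exists>g. active N S g \<and> c - 1 \<le> cnt N g S Q"
  proof (rule ccontr)
    assume "\<not> ?thesis"
    then have lt: "real (cnt N (False, v) S Q) < c - 1" if "v \<in> ?A" for v using act[OF that] by force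
    obtain v0 where "v0 \<in> ?A" using Ane by blast
    then have c1: "c - 1 > 0" using lt[of v0] by linarith
    have "?i * ?q = (\<Sum>v\<in>{0..<N} - ?A. real (cnt N (False, v) S Q)) + (\<Sum>v\<in>?A. real (cnt N (False, v) S Q))"
      unfolding tot[symmetric] by (intro sum.subset_diff) auto
    also have "{0..<N} - ?A = insert 0 S" using SA N by (auto simp: subset_eq)
    also have "(\<Sum>v\<in>insert 0 S. real (cnt N (False, v) S Q)) = real (cnt N (False, 0) S Q) + (\<Sum>v\<in>S. real (cnt N (False, v) S Q))"
      using S0 vD by simp
    also have "(\<Sum>v\<in>S. real (cnt N (False, v) S Q)) = 0"
      using cnt_inactive[OF v, of "(False, _)"] SA by (intro sum.neutral) (auto simp: active_def subset_eq)
    also have "real (cnt N (False, 0) S Q) \<le> ?i" using cnt_le_card[OF vD(4)] by simp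
    also have "(\<Sum>v\<in>?A. real (cnt N (False, v) S Q)) \<le> real (card ?A) * (c - 1)"
      by (intro sum_bounded_above less_imp_le lt)
    also have "\<dots> \<le> (real_of_int N - 1) * (c - 1)" using cA c1 by (intro mult_right_mono) auto
    finally show False using cN ci SN' c0 by (simp add: algebra_simps)
  qed
  have ex2: "\<exists>g. active N S g \<and> cnt N g S Q \<le> c + kap"
  proof (rule ccontr)
    assume "\<not> ?thesis"
    then have lt: "c + kap < real (cnt N (False, v) S Q)" if "v \<in> ?A" for v using act[OF that] by force
    have "real (card ?A) * (c + kap) < (\<Sum>v\<in>?A. real (cnt N (False, v) S Q))"
      using sum_strict_mono[OF fA Ane lt] by simp
    also have "\<dots> \<le> (\<Sum>v\<in>{0..<N}. real (cnt N (False, v) S Q))" by (intro sum_mono2) auto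
    finally have 1: "(real_of_int N - 1 - ?i) * (c + kap) < ?i * ?q" unfolding tot cA .
    have "(?i + 1) * c \<le> (?i + 1) * (?i + 1)" using ci by (intro mult_left_mono) auto
    also have "\<dots> \<le> N / 2 * kap" using kap(2) N by (simp add: divide_le_eq power2_eq_square mult_ac)
    also have "\<dots> \<le> (real_of_int N - 1 - ?i) * kap" using SN' kap by (intro mult_right_mono) auto
    finally show False using 1 cN by (simp add: algebra_simps)
  qed
  obtain g1 where g1: "active N S g1" "c - 1 \<le> cnt N g1 S Q" using ex1 by blast
  obtain g2 where g2: "active N S g2" "cnt N g2 S Q \<le> c + kap" using ex2 by blast
  \<comment> \<open>Inserting c places it between the minimum and the maximum.\<close>
  define X where "X = insert c ((\<lambda>g. real (cnt N g S Q)) ` {g. active N S g})"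
  have fX: "finite X" "X \<noteq> {}" using finite_active by (auto simp: X_def)
  have up: "real (cnt N g S Q) \<le> c + u + kap" if "active N S g" for g
    using osc[OF that g2(1)] g2(2) by linarith
  have dn: "c - (u + kap) \<le> real (cnt N g S Q)" if "active N S g" for g
    using osc[OF g1(1) that] g1(2) kap(1) by linarith
  have diff: "x - y \<le> u + kap" if "x \<in> X" "y \<in> X" for x y
  proof -
    note xy = that
    have mem: "z = c \<or> (\<exists>g. active N S g \<and> z = real (cnt N g S Q))" if "z \<in> X" for z
      using that by (auto simp: X_def)
    consider "x = c" "y = c" | g where "active N S g" "x = real (cnt N g S Q)" "y = c"
      | h where "x = c" "active N S h" "y = real (cnt N h S Q)"
      | g h where "active N S g" "x = real (cnt N g S Q)" "active N S h" "y = real (cnt N h S Q)"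
      using mem[OF xy(1)] mem[OF xy(2)] by blast
    then show ?thesis
    proof cases
      case 1 then show ?thesis using u kap(1) by simp
    next
      case 2 then show ?thesis using up[of g] by simp
    next
      case 3 then show ?thesis using dn[of h] by simp
    next
      case 4 then show ?thesis using osc[of g h] kap(1) by simp
    qed
  qed
  show ?thesis
  proof (rule exI[of _ "Min X"], rule exI[of _ "Max X"], intro conjI allI impI)
    show "Min X \<le> c" "c \<le> Max X" using fX by (auto simp: X_def)
    show "Max X \<le> c + u + kap" using fX up u kap(1) by (auto simp: X_def)
    show "Max X - Min X \<le> u + kap" using fX by (intro diff Max_in Min_in)
    fix g assume "active N S g"
    then have "real (cnt N g S Q) \<in> X" by (auto simp: X_def)
    then show "Min X \<le> real (cnt N g S Q)" "real (cnt N g S Q) \<le> Max X" using fX by auto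
  qed
qed

subsection \<open>The drift inequalities\<close>

text \<open>Here K is the square root of log n, T the square root of N, and p the density q / N predicted by the
  heuristic. The bounds are u for differences of counts of a in S with g(a) in Q, w for
  differences of counts of y in Q with g(y) in Q, and kap for the overlap of two images of S.
  With r = 1 / (T + i), u grows by the factor (1 + r)^8 in one step and w by (1 - th) (1 + r)^7.\<close>

locale drift_numerics =
  fixes K T p u kap i q c lo hi w :: real
  assumes K: "K \<ge> 10 ^ 8" and T: "T \<ge> K ^ 20" and p: "0 < p" "p \<le> 1"
    and i: "0 \<le> i" "T + i \<le> T * K"
    and u: "u > 0" "T * K ^ 12 \<le> u^2" "1000 * K^2 * kap \<le> u" "1000 * K^2 * u \<le> T * p" "1000 * K ^ 10 \<le> p * u"
    and kap: "10 * K^2 \<le> kap" "kap * p \<le> 20 * K^2"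
    and q: "2 / 3 * (T^2 * p) \<le> q" "q \<le> 3 / 2 * (T^2 * p)"
    and c: "c = i * q / T^2" "lo \<le> c" "c \<le> hi" "hi \<le> c + u + kap" "hi - lo \<le> u + kap"
    and w: "w = 4 * T^2 * p * u / (T + i)"
begin

text \<open>\<open>r\<close> is the step of log (T + i) and \<open>th\<close> the fraction 3 c / q
  of the open set closed in one step. Over the run \<open>r\<close> sums to about log K at most, but
  \<open>th\<close> to the order of K^2: an error may grow at a multiple of \<open>r\<close>, not of
  \<open>th\<close>.\<close>

definition "r = 1 / (T + i)"
definition "th = 3 * i / T^2"
abbreviation "WM \<equiv> q^2 / T^2 + w + 2"
abbreviation "hM \<equiv> 3 * hi + 4"

lemma K1: "K \<ge> 1" "K > 0" using K by auto

lemma T1: "T \<ge> 1" "T > 0" "K \<le> T"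
proof -
  have "K ^ 1 \<le> K ^ 20" using K1 by (intro power_increasing) auto
  then show "K \<le> T" using T by simp
  then show "T \<ge> 1" "T > 0" using K1 by auto
qed

lemma r: "r > 0" "r \<le> 1 / T" "1 / T \<le> K * r"
proof -
  show "r > 0" "r \<le> 1 / T" using i T1 by (auto simp: r_def intro!: divide_left_mono)
  show "1 / T \<le> K * r" using i T1 by (simp add: r_def field_simps)
qed

lemma K2: "K^2 \<ge> 10 ^ 16"
proof -
  have "(10 ^ 8)^2 \<le> K^2" using K by (intro power_mono) auto
  then show ?thesis by simp
qed

lemma pu: "1000 * K^2 \<le> p * u" "1600 * K ^ 8 \<le> p * u"
proof -
  have "K ^ 2 \<le> K ^ 10" using K1 by (intro power_increasing) auto
  then show "1000 * K^2 \<le> p * u" using u by linarith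
  have "1600 * K ^ 8 \<le> (1000 * K^2) * K ^ 8" using K2 K1 by (intro mult_right_mono) auto
  also have "\<dots> = 1000 * K ^ 10" by (simp flip: power_add)
  finally show "1600 * K ^ 8 \<le> p * u" using u by linarith
qed

lemma kap0: "kap \<ge> 10 ^ 17" using kap K2 by simp

lemma kap_u: "1000 * kap \<le> u"
proof -
  have "1000 * (1 * kap) \<le> 1000 * (K^2 * kap)" using K2 kap0 by (intro mult_left_mono mult_right_mono) auto
  then show ?thesis using u by simp
qed

lemma u1: "u \<ge> 10 ^ 20" using kap_u kap0 by simp

lemma u_big: "u \<ge> K ^ 16"
proof (rule power2_le_imp_le)
  have "(K ^ 16)^2 = K ^ 20 * K ^ 12" by (simp flip: power_add power_mult)
  also have "\<dots> \<le> T * K ^ 12" using T K1 by (intro mult_right_mono) auto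
  finally show "(K ^ 16)^2 \<le> u^2" using u by linarith
qed (use u in auto)

lemma q0: "q > 0" using q p T1 by (smt (verit) mult_pos_pos zero_less_power divide_pos_pos)

lemma div_q: "x \<ge> 0 \<Longrightarrow> x / q \<le> 3 / 2 * (x / (T^2 * p))"
proof -
  assume x: "x \<ge> 0"
  have "x / q \<le> x / (2 / 3 * (T^2 * p))" using q q0 p T1 x by (intro divide_left_mono) auto
  then show ?thesis by (simp add: field_simps)
qed

lemma th: "th \<ge> 0" "th \<le> 3 * K^2 * r" "3 * c = th * q"
proof -
  show "th \<ge> 0" using i by (simp add: th_def)
  show "3 * c = th * q" using T1 by (simp add: c th_def)
  have "i * (T + i) \<le> (T * K) * (T * K)" using i T1 by (intro mult_mono) auto
  then have "3 * i / T^2 \<le> 3 * K^2 / (T + i)" using i T1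
    by (simp add: divide_le_eq le_divide_eq power2_eq_square algebra_simps)
  then show "th \<le> 3 * K^2 * r" by (simp add: th_def r_def)
qed

lemma c0: "c \<ge> 0" using i q0 T1 by (simp add: c)

lemma c_le: "c \<le> 3 / 2 * i * p"
proof -
  have "i * q / T^2 \<le> i * (3 / 2 * (T^2 * p)) / T^2" using i q by (intro divide_right_mono mult_left_mono) auto
  then show ?thesis using T1 by (simp add: c)
qed

lemma i_le: "i \<le> T * K" using i T1 by linarith

lemma c_le2: "c \<le> 3 / 2 * (T * K * p)"
proof -
  have "i * p \<le> T * K * p" using i_le p by (intro mult_right_mono) auto
  then show ?thesis using c_le by simp
qed

lemma w_eq: "w = 4 * T^2 * p * u * r" by (simp add: w r_def)

lemma w0: "w > 0" using T1 p u r by (simp add: w_eq)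

lemma w_ge: "4 * T * p * u \<le> w * K"
proof -
  have "4 * T^2 * p * u * (1 / T) \<le> 4 * T^2 * p * u * (K * r)" using r T1 p u by (intro mult_left_mono) auto
  then show ?thesis using T1 by (simp add: w_eq power2_eq_square mult_ac)
qed

lemma w_div_q: "w / q \<le> 6 * r * u"
  using div_q[of w] w0 T1 p by (simp add: w_eq mult_ac)

lemma u_div_Tp: "u / (T * p) \<le> 1 / (1000 * K^2)"
  using u p T1 K1 by (simp add: divide_simps mult_ac)

lemma u_div_q: "u / q \<le> 2 / 1000 * r / K" "u / q \<le> 2 / 1000 * r"
proof -
  have "u / q \<le> 3 / 2 * (u / (T^2 * p))" using u by (intro div_q) auto
  also have "u / (T^2 * p) = u / (T * p) * (1 / T)" by (simp add: power2_eq_square)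
  also have "3 / 2 * \<dots> \<le> 3 / 2 * (1 / (1000 * K^2) * (K * r))"
    using u_div_Tp r T1 by (intro mult_left_mono mult_mono) auto
  also have "\<dots> = 3 / 2000 * r / K" using K1 by (simp add: power2_eq_square)
  also have "\<dots> \<le> 2 / 1000 * r / K" using r K1 by (intro divide_right_mono mult_right_mono) auto
  finally show "u / q \<le> 2 / 1000 * r / K" .
  also have "\<dots> \<le> 2 / 1000 * r" using r K1 by (simp add: divide_le_eq)
  finally show "u / q \<le> 2 / 1000 * r" .
qed

lemma th_kap: "th * kap \<le> 3 / 1000 * (r * u)"
proof -
  have "th * kap \<le> 3 * K^2 * r * kap" using th kap0 by (intro mult_right_mono) auto
  also have "\<dots> = 3 / 1000 * r * (1000 * K^2 * kap)" by simp
  also have "\<dots> \<le> 3 / 1000 * r * u" using u r by (intro mult_left_mono) auto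
  finally show ?thesis by simp
qed

text \<open>The source satisfies w / q \<le> 6 r u and the remaining errors together stay below r u
  / 4, so 25/4 falls short of the growth 8 r of the bound by 7/4.\<close>

lemma u_drift:
  "(w + hi * (3 * (hi - lo) + 3 * kap + 4) + (kap + 2) * (3 * c) + 4 * i + 12 + 4 * hi) / q
    \<le> (th + 25 / 4 * r) * u"
proof -
  have hi0: "hi \<ge> 0" using c0 c by linarith
  have "hi * (3 * (hi - lo) + 3 * kap + 4) + 4 * hi = hi * (3 * (hi - lo) + 3 * kap + 8)" by (simp add: algebra_simps)
  also have "\<dots> \<le> (c + u + kap) * (3 * u + 7 * kap)"
    using c hi0 kap0 u by (intro mult_mono) auto
  also have "\<dots> = c * (3 * u) + c * (7 * kap) + (u + kap) * (3 * u + 7 * kap)" by (simp add: algebra_simps)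
  also have "(u + kap) * (3 * u + 7 * kap) \<le> (2 * u) * (4 * u)"
    using kap_u kap0 u by (intro mult_mono) auto
  finally have n: "w + hi * (3 * (hi - lo) + 3 * kap + 4) + (kap + 2) * (3 * c) + 4 * i + 12 + 4 * hi
     \<le> w + c * (3 * u) + c * (7 * kap) + 8 * (u * u) + (kap + 2) * (3 * c) + 4 * i + 12" by simp
  have "(w + hi * (3 * (hi - lo) + 3 * kap + 4) + (kap + 2) * (3 * c) + 4 * i + 12 + 4 * hi) / q
     \<le> (w + c * (3 * u) + c * (7 * kap) + 8 * (u * u) + (kap + 2) * (3 * c) + 4 * i + 12) / q"
    using n q0 by (intro divide_right_mono) auto
  also have "\<dots> = w / q + (3 * c) / q * u + (3 * c) / q * (7 / 3 * kap) + 8 * u * (u / q) + (3 * c) / q * (kap + 2) + 4 * (i / q) + 12 / q"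
    by (simp add: add_divide_distrib mult_ac)
  also have "(3 * c) / q = th" using th q0 by simp
  finally have 1: "(w + hi * (3 * (hi - lo) + 3 * kap + 4) + (kap + 2) * (3 * c) + 4 * i + 12 + 4 * hi) / q
     \<le> w / q + th * u + th * (7 / 3 * kap) + 8 * u * (u / q) + th * (kap + 2) + 4 * (i / q) + 12 / q" .
  have 2: "8 * u * (u / q) \<le> 16 / 1000 * (r * u)"
    using mult_left_mono[OF u_div_q(2), of "8 * u"] u by (simp add: mult_ac)
  have 3: "th * (kap + 2) \<le> 2 * (th * kap)" using th kap0 mult_left_mono[of 2 kap th] by (simp add: algebra_simps)
  have 4: "i / q \<le> 2 / 1000 * (r * u)"
  proof -
    have "i / q \<le> 3 / 2 * (i / (T^2 * p))" using i by (intro div_q) auto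
    also have "\<dots> = th / 2 * (1 / p)" by (simp add: th_def)
    also have "\<dots> \<le> (3 * K^2 * r) / 2 * (u / (1000 * K^2))"
      using th u p K1 pu by (intro mult_mono divide_right_mono) (auto simp: divide_simps mult_ac)
    also have "\<dots> = 3 / 2000 * (r * u)" using K1 by simp
    also have "\<dots> \<le> 2 / 1000 * (r * u)" using r u by (intro mult_right_mono) auto
    finally show ?thesis .
  qed
  have 5: "12 / q \<le> 24 / 1000 * (r * u)"
  proof -
    have "12 / q \<le> 12 * (u / q)" using u1 q0 by (simp add: divide_right_mono)
    also have "\<dots> \<le> 24 / 1000 * r * 1" using u_div_q(2) by linarith
    also have "\<dots> \<le> 24 / 1000 * r * u" using u1 r by (intro mult_left_mono) auto
    finally show ?thesis by simp
  qed
  have "w / q + th * u + th * (7 / 3 * kap) + 8 * u * (u / q) + th * (kap + 2) + 4 * (i / q) + 12 / q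
     \<le> th * u + 6 * (r * u) + 1 / 4 * (r * u)"
    using w_div_q 2 3 4 5 th_kap r u mult_pos_pos[OF r(1) u(1)] by (simp only: mult.assoc)
  also have "\<dots> = (th + 25 / 4 * r) * u" by (simp add: algebra_simps)
  finally show ?thesis using 1 by linarith
qed

lemma ru_le: "r * u \<le> p / (1000 * K^2)" "r * u \<le> p / 10 ^ 19"
proof -
  have "r * u \<le> 1 / T * u" using r u by (intro mult_right_mono) auto
  also have "\<dots> = u / (T * p) * p" using p by simp
  also have "\<dots> \<le> 1 / (1000 * K^2) * p" using u_div_Tp p by (intro mult_right_mono) auto
  finally show 1: "r * u \<le> p / (1000 * K^2)" by simp
  have "p / (1000 * K^2) \<le> p / 10 ^ 19" using K2 p by (intro divide_left_mono) auto
  then show "r * u \<le> p / 10 ^ 19" using 1 by linarith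
qed

lemma WM_div_q: "WM / q \<le> 151 / 100 * p"
proof -
  have "q / T^2 \<le> 3 / 2 * p" using q T1 by (simp add: divide_le_eq mult_ac)
  moreover have "WM / q = q / T^2 + w / q + 2 / q"
    using q0 by (simp add: add_divide_distrib power2_eq_square)
  moreover have "2 / q \<le> 4 / 1000 * (r * u)"
  proof -
    have "2 / q \<le> 2 * (u / q)" using u1 q0 by (simp add: divide_right_mono)
    also have "\<dots> \<le> 4 / 1000 * r * 1" using u_div_q(2) by linarith
    also have "\<dots> \<le> 4 / 1000 * r * u" using u1 r by (intro mult_left_mono) auto
    finally show ?thesis by simp
  qed
  ultimately show ?thesis using w_div_q ru_le(2) p by simp
qed

lemma hM_le: "hM \<le> 3 * c + 7 * u" "hi \<le> c + 2 * u" "hi \<ge> 0"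
  using c c0 kap_u u1 by auto

lemma c2_div_q: "c^2 / q \<le> 3 / 2 * p * K^2"
proof -
  have "c^2 / q = (i / T)^2 * (q / T^2)" using q0 by (simp add: c power2_eq_square)
  also have "\<dots> \<le> K^2 * (3 / 2 * p)"
    using i_le i T1 q q0 by (intro mult_mono power_mono) (auto simp: divide_le_eq mult_ac)
  finally show ?thesis by (simp add: mult_ac)
qed

lemma u_abs: "(2 * WM + 2 * (hi * hM)) / q \<le> 40 * p * K^2"
proof -
  have "hi * hM \<le> (c + 2 * u) * (3 * c + 7 * u)"
    using hM_le c0 u by (intro mult_mono) auto
  also have "\<dots> = 3 * c^2 + 13 * (c * u) + 14 * u^2" by (simp add: algebra_simps power2_eq_square)
  also have "\<dots> \<le> 10 * c^2 + 21 * u^2"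
  proof -
    have "2 * (c * u) \<le> c^2 + u^2" using sum_squares_bound[of c u] by (simp only: mult.assoc)
    then show ?thesis using zero_le_power2[of c] zero_le_power2[of u] by linarith
  qed
  finally have "(2 * WM + 2 * (hi * hM)) / q \<le> (2 * WM + 2 * (10 * c^2 + 21 * u^2)) / q"
    using q0 by (intro divide_right_mono) auto
  also have "\<dots> = 2 * (WM / q) + 20 * (c^2 / q) + 42 * (u^2 / q)"
    by (simp add: add_divide_distrib)
  also have "\<dots> \<le> 2 * (151 / 100 * p) + 20 * (3 / 2 * p * K^2) + 42 * p"
  proof -
    have "u^2 / q = u * (u / q)" by (simp add: power2_eq_square)
    also have "\<dots> \<le> u * (2 / 1000 * r)" using u_div_q(2) u by (intro mult_left_mono) auto
    also have "\<dots> \<le> p" using ru_le(2) p by (simp add: mult_ac)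
    finally show ?thesis using WM_div_q c2_div_q by linarith
  qed
  also have "\<dots> \<le> 40 * p * K^2"
  proof -
    have "46 * p \<le> 10 * p * K^2" using K2 p by simp
    then show ?thesis using p by linarith
  qed
  finally show ?thesis .
qed

text \<open>Jumps of order kap and a mean absolute jump of order p K^2 give a variance of order K^4,
  because kap p \<le> 20 K^2. The condition u^2 \<ge> T K^12 originates here: with the factor 10 K^6
  and 1 / T \<le> K r it leaves one factor K for the constants.\<close>

lemma u_var: "(10 * K ^ 6) * (2 * ((3 * kap + 5) * ((2 * WM + 2 * (hi * hM)) / q)) / u^2) \<le> r / 8"
proof -
  have hM0: "(2 * WM + 2 * (hi * hM)) / q \<ge> 0" using w0 hM_le q0 T1 by (intro divide_nonneg_pos add_nonneg_nonneg mult_nonneg_nonneg) auto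
  have "(3 * kap + 5) * ((2 * WM + 2 * (hi * hM)) / q) \<le> (4 * kap) * (40 * p * K^2)"
    using u_abs kap0 hM0 by (intro mult_mono) auto
  also have "\<dots> = 160 * K^2 * (kap * p)" by simp
  also have "\<dots> \<le> 160 * K^2 * (20 * K^2)" using kap by (intro mult_left_mono) auto
  also have "\<dots> = 3200 * K ^ 4" by (simp add: power2_eq_square power4_eq_xxxx)
  finally have "(10 * K ^ 6) * (2 * ((3 * kap + 5) * ((2 * WM + 2 * (hi * hM)) / q)) / u^2) \<le> (10 * K ^ 6) * (2 * (3200 * K ^ 4) / u^2)"
    using K1 by (intro mult_left_mono divide_right_mono) auto
  also have "\<dots> = 64000 * K ^ 10 / u^2" by (simp flip: power_add)
  also have "\<dots> \<le> 64000 * K ^ 10 / (T * K ^ 12)" using u K1 T1 by (intro divide_left_mono) auto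
  also have "\<dots> = 64000 / K^2 * (1 / T)" using K1 by (simp add: divide_simps flip: power_add)
  also have "\<dots> \<le> 64000 / K^2 * (K * r)" using r by (intro mult_left_mono) auto
  also have "\<dots> = 64000 / K * r" using K1 by (simp add: power2_eq_square)
  also have "\<dots> \<le> 1 / 8 * r" using K r by (intro mult_right_mono) (auto simp: divide_le_eq)
  finally show ?thesis by simp
qed

text \<open>By the choice of \<open>w\<close>, p u is (T + i) / (4 T^2) times w, and 1.51 times 6.03
  is below 9.2 = 4 * 2.3. The bad pairs cost only th / 50.\<close>

lemma w_drift:
  "(WM * (6 * (hi - lo) + 15 * kap + 16) + (2 * hi + 8) * (6 * c)) / q
     \<le> (23 / 10 * (T + i) / T^2 + th / 50) * w"
proof -
  have "(WM * (6 * (hi - lo) + 15 * kap + 16)) / q = WM / q * (6 * (hi - lo) + 15 * kap + 16)" by simp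
  also have "\<dots> \<le> 151 / 100 * p * (603 / 100 * u)"
    using WM_div_q p kap_u kap0 c w0 q0 by (intro mult_mono) auto
  also have "\<dots> \<le> 92 / 10 * (p * u)" using mult_pos_pos[OF p(1) u(1)] by simp
  also have "\<dots> = 23 / 10 * (w * (T + i)) / T^2" using T1 i by (simp add: w)
  also have "\<dots> = 23 / 10 * (T + i) / T^2 * w" by simp
  finally have 1: "(WM * (6 * (hi - lo) + 15 * kap + 16)) / q \<le> 23 / 10 * (T + i) / T^2 * w" .
  have "((2 * hi + 8) * (6 * c)) / q = 2 * (2 * hi + 8) * (3 * c / q)" by simp
  also have "3 * c / q = th" using th q0 by simp
  also have "2 * (2 * hi + 8) * th \<le> w / 50 * th"
  proof (intro mult_right_mono th)
    have "2 * (2 * hi + 8) \<le> 4 * c + 10 * u" using hM_le c kap_u kap0 by auto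
    also have "\<dots> \<le> w / 50"
    proof -
      have "50 * (4 * c + 10 * u) * K \<le> 4 * T * p * u"
      proof -
        have "200 * c * K \<le> 200 * (3 / 2 * (T * K * p)) * K" using c_le2 K1 by (intro mult_right_mono mult_left_mono) auto
        also have "\<dots> = (T * p) * (300 * K^2)" by (simp add: power2_eq_square)
        also have "\<dots> \<le> (T * p) * (2 * u)"
        proof (intro mult_left_mono)
          have "1000 * K^2 \<le> p * u" by (rule pu)
          also have "\<dots> \<le> 1 * u" using p u by (intro mult_right_mono) auto
          finally show "300 * K^2 \<le> 2 * u" using zero_le_power2[of K] by linarith
        qed (use T1 p in auto)
        finally have a: "200 * c * K \<le> (T * p) * (2 * u)" .
        have "500 * K \<le> 2 * (T * p)"
        proof -
          have "K * 1 \<le> K * u" using u1 K1 by (intro mult_left_mono) auto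
          moreover have "1000 * K * u \<le> 1000 * K^2 * u" using K1 u by (intro mult_right_mono) (auto simp: power2_eq_square)
          ultimately show ?thesis using u(4) K1 by linarith
        qed
        then have "500 * K * u \<le> 2 * (T * p) * u" using u by (intro mult_right_mono) auto
        then show ?thesis using a by (simp add: algebra_simps)
      qed
      also have "\<dots> \<le> w * K" by (rule w_ge)
      finally have "50 * (4 * c + 10 * u) \<le> w" using K1 by simp
      then show ?thesis by simp
    qed
    finally show "2 * (2 * hi + 8) \<le> w / 50" .
  qed
  finally have 2: "((2 * hi + 8) * (6 * c)) / q \<le> th / 50 * w" by (simp add: mult_ac)
  show ?thesis using 1 2 by (simp only: add_divide_distrib distrib_right)
qed

lemma Tp: "6000 * K ^ 10 \<le> T * p"
  proof -
    have "6 * K ^ 10 \<le> K ^ 18"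
    proof -
      have "6 * K ^ 10 \<le> K ^ 1 * K ^ 10" using K by (intro mult_right_mono) auto
      also have "\<dots> = K ^ 11" by (simp only: power_add[symmetric]) simp
      also have "\<dots> \<le> K ^ 18" using K1 by (intro power_increasing) auto
      finally show ?thesis .
    qed
    moreover have "1000 * K ^ 18 \<le> 1000 * (K^2 * u)"
    proof -
      have "K^2 * K ^ 16 \<le> K^2 * u" using u_big by (intro mult_left_mono) auto
      then show ?thesis by (simp flip: power_add)
    qed
    ultimately show ?thesis using u(4) by (simp add: mult_ac)
  qed

text \<open>The factor 8 in place of 2 anticipates that the next bound is known only to be at least
  w / 2.\<close>

lemma w_var: "(10 * K ^ 6) * (8 * (2 * hM * (4 * hM * WM / q)) / w^2) \<le> 1 / 50 * (1 / T)"
proof -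
  have "hM^2 \<le> (3 * c + 7 * u)^2" using hM_le by (intro power_mono) auto
  also have "\<dots> \<le> 18 * c^2 + 98 * u^2"
    using zero_le_power2[of "3 * c - 7 * u"] by (simp add: power2_eq_square algebra_simps)
  finally have h: "hM^2 \<le> 18 * c^2 + 98 * u^2" .
  have "2 * h * (4 * h * W / q) = 8 * (h^2 * (W / q))" for h W :: real by (simp add: power2_eq_square)
  then have "2 * hM * (4 * hM * WM / q) = 8 * (hM^2 * (WM / q))" .
  also have "\<dots> \<le> 8 * ((18 * c^2 + 98 * u^2) * (151 / 100 * p))"
    using h WM_div_q w0 q0 by (intro mult_left_mono mult_mono) auto
  also have "\<dots> \<le> p * (220 * c^2 + 1200 * u^2)"
  proof -
    have "p * (8 * (151/100) * (18 * c^2 + 98 * u^2)) \<le> p * (220 * c^2 + 1200 * u^2)"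
      using p by (intro mult_left_mono) auto
    moreover have "8 * ((18 * c^2 + 98 * u^2) * (151 / 100 * p)) = p * (8 * (151/100) * (18 * c^2 + 98 * u^2))"
      by simp
    ultimately show ?thesis by (simp only:)
  qed
  finally have V: "2 * hM * (4 * hM * WM / q) \<le> p * (220 * c^2 + 1200 * u^2)" .
  have Tpu: "T * p * u > 0" using T1 p u by simp
  have w2: "16 * (T * p * u)^2 / K^2 \<le> w^2"
  proof -
    have "(4 * T * p * u / K)^2 \<le> w^2" using w_ge K1 Tpu by (intro power_mono) (auto simp: divide_le_eq)
    then show ?thesis by (simp add: power_divide power_mult_distrib mult_ac)
  qed
  have "(10 * K ^ 6) * (8 * (2 * hM * (4 * hM * WM / q)) / w^2)
      \<le> (10 * K ^ 6) * (8 * (p * (220 * c^2 + 1200 * u^2)) / (16 * (T * p * u)^2 / K^2))"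
  proof -
    have P: "0 < 16 * (T * p * u)^2 / K^2"
      using T1 p u K1 by (intro divide_pos_pos mult_pos_pos zero_less_power) auto
    show ?thesis using V w2 K1 p by (intro mult_left_mono frac_le P) auto
  qed
  also have "\<dots> = 5 * K ^ 8 * p * (220 * c^2 + 1200 * u^2) / (T * p * u)^2"
    using K1 by (simp add: divide_simps flip: power_add)
  also have "\<dots> = 1100 * K ^ 8 * p * c^2 / (T * p * u)^2 + 6000 * K ^ 8 * p * u^2 / (T * p * u)^2"
    by (simp add: algebra_simps add_divide_distrib)
  also have "1100 * K ^ 8 * p * c^2 / (T * p * u)^2 \<le> 1 / 100 * (1 / T)"
  proof -
    have "1100 * K ^ 8 * p * c^2 / (T * p * u)^2 \<le> 1100 * K ^ 8 * p * (3 / 2 * (T * K * p))^2 / (T * p * u)^2"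
      using c_le2 c0 K1 p by (intro divide_right_mono mult_left_mono power_mono) auto
    also have "\<dots> = 2475 * K ^ 10 * p / u^2" using T1 p u
      by (simp add: power_mult_distrib divide_simps flip: power_add)
    also have "\<dots> \<le> 2475 * K ^ 10 * 1 / (T * K ^ 12)" using u p K1 T1 by (intro frac_le mult_left_mono) auto
    also have "\<dots> = 2475 / K^2 * (1 / T)" using K1 by (simp add: divide_simps flip: power_add)
    also have "\<dots> \<le> 1 / 100 * (1 / T)" using K2 K1 T1 by (intro mult_right_mono) (auto simp: divide_le_eq)
    finally show ?thesis .
  qed
  also have "6000 * K ^ 8 * p * u^2 / (T * p * u)^2 \<le> 1 / 100 * (1 / T)"
  proof -
    have "6000 * K ^ 8 * p * u^2 / (T * p * u)^2 = 6000 * K ^ 8 / (T * p) * (1 / T)"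
      using T1 p u by (simp add: power2_eq_square divide_simps)
    also have "\<dots> \<le> 1 / 100 * (1 / T)"
    proof (intro mult_right_mono)
      have "100 * (6000 * K ^ 8) = 600000 * K ^ 8" by simp
      also have "\<dots> \<le> (6000 * K^2) * K ^ 8" using K2 K1 by (intro mult_right_mono) auto
      also have "\<dots> = 6000 * K ^ 10" by (simp flip: power_add)
      finally show "6000 * K ^ 8 / (T * p) \<le> 1 / 100" using Tp T1 p by (simp add: divide_le_eq)
    qed (use T1 in auto)
    finally show ?thesis .
  qed
  finally show ?thesis by simp
qed

lemma th_small: "th \<le> 1 / 1000"
proof -
  have "th \<le> 3 * K^2 * (1 / T)" using th(2) mult_left_mono[OF r(2), of "3 * K^2"] by simp
  also have "\<dots> \<le> 3 * K^2 / K ^ 20" using T K1 by (simp add: frac_le)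
  also have "\<dots> = 3 / K ^ 18" using K1 by (simp add: divide_simps flip: power_add)
  also have "\<dots> \<le> 3 / K ^ 1" using K1 by (intro divide_left_mono power_increasing) auto
  also have "\<dots> \<le> 1 / 1000" using K by (simp add: divide_le_eq)
  finally show ?thesis .
qed

lemma K6_T: "10 ^ 6 * K ^ 10 \<le> T"
proof -
  have "10 ^ 6 * K ^ 10 \<le> K ^ 1 * K ^ 10" using K by (intro mult_right_mono) auto
  also have "\<dots> = K ^ 11" by (simp only: power_add[symmetric]) simp
  also have "\<dots> \<le> K ^ 20" using K1 by (intro power_increasing) auto
  finally show ?thesis using T by linarith
qed

section \<open>The drift and jump conditions of the exponential potential\<close>

lemma inverse_power_bounds:
  fixes x :: real assumes "x \<ge> 0"
  shows "1 / (1 + x) ^ k \<le> 1 / (1 + real k * x)" "1 - real k * x \<le> 1 / (1 + x) ^ k" "1 / (1 + x) ^ k \<le> 1"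
proof -
  show "1 / (1 + x) ^ k \<le> 1 / (1 + real k * x)"
    using Bernoulli_inequality[of x k] assms
    by (intro divide_left_mono mult_pos_pos add_pos_nonneg) auto
  show "1 / (1 + x) ^ k \<le> 1" using assms by simp
  show "1 - real k * x \<le> 1 / (1 + x) ^ k"
  proof (cases "x \<le> 1")
    case True
    have "1 - real k * x \<le> (1 - x) ^ k" using Bernoulli_inequality[of "- x" k] True by simp
    also have "\<dots> \<le> (1 / (1 + x)) ^ k"
    proof (rule power_mono)
      have "(1 - x) * (1 + x) \<le> 1" using assms by (simp add: algebra_simps)
      then show "1 - x \<le> 1 / (1 + x)" using assms by (simp add: le_divide_eq)
    qed (use True in simp)
    finally show ?thesis by (simp add: power_divide)
  next
    case False
    show ?thesis
    proof (cases "k = 0")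
      case False
      then have "1 * 1 \<le> real k * x" using \<open>\<not> x \<le> 1\<close> by (intro mult_mono) auto
      then have "1 - real k * x \<le> 0" by simp
      also have "0 \<le> 1 / (1 + x) ^ k" using assms by simp
      finally show ?thesis .
    qed simp
  qed
qed

text \<open>This fixes the window width 1 / K^4: \<open>th\<close> may exceed \<open>r\<close> by a
  factor 3 K^2, and the loss at the lower end of the window must stay a small fraction of
  \<open>r\<close>.\<close>

lemma delta_absorb: "1 / K ^ 4 * (th + 8 * r) \<le> r / 4" "1 / K ^ 4 * (th + 7 * r) \<le> r / 4"
proof -
  have "1 / K ^ 4 * (th + 8 * r) \<le> 1 / K ^ 4 * (11 * (K^2 * r))"
  proof (intro mult_left_mono)
    have "1 * r \<le> K^2 * r" using K2 r by (intro mult_right_mono) auto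
    then show "th + 8 * r \<le> 11 * (K^2 * r)" using th(2) by (simp add: mult.assoc)
  qed (use K1 in auto)
  also have "\<dots> = 11 / K^2 * r" using K1 by (simp add: divide_simps flip: power_add)
  also have "\<dots> \<le> 1 / 4 * r" using K2 r by (intro mult_right_mono) (auto simp: divide_le_eq)
  finally show 1: "1 / K ^ 4 * (th + 8 * r) \<le> r / 4" by simp
  have "1 / K ^ 4 * (th + 7 * r) \<le> 1 / K ^ 4 * (th + 8 * r)" using K1 r by (intro mult_left_mono) auto
  then show "1 / K ^ 4 * (th + 7 * r) \<le> r / 4" using 1 by linarith
qed

text \<open>Inside the window the self-correction cancels th u up to the window width. What remains
  is 25/4 r of growth against 8 r of room, and the noise takes at most r / 4 of the
  difference.\<close>

lemma u_window:
  assumes D: "D \<ge> (1 - 1 / K ^ 4) * u" and u': "u' = u * (1 + r) ^ 8"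
    and mean: "\<mu> \<le> - th * D + (th + 25 / 4 * r) * u"
    and V: "V = (3 * kap + 5) * ((2 * WM + 2 * (hi * hM)) / q)"
  shows "\<mu> / u' - D / u * (1 - u / u') + 10 * K ^ 6 * (2 * V / u'^2 + 2 * (1 - u / u')^2) \<le> 0"
proof -
  define b where "b = u / u'"
  have u'0: "u' > 0" using u r by (simp add: u')
  have b_eq: "b = 1 / (1 + r) ^ 8" using u by (simp add: b_def u')
  have b: "b \<le> 1 / (1 + 8 * r)" "1 - 8 * r \<le> b" "b \<le> 1" "b > 0"
    using inverse_power_bounds[of r 8] r by (auto simp: b_eq)
  have r1: "r \<le> 1 / 16"
  proof -
    have "10 ^ 6 * 1 \<le> 10 ^ 6 * K ^ 10" using K1 by (intro mult_left_mono one_le_power) auto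
    then have "T \<ge> 16" using K6_T by simp
    then have "1 / T \<le> 1 / 16" by (intro divide_left_mono) auto
    then show ?thesis using r by linarith
  qed
  have noise: "10 * K ^ 6 * (2 * V / u'^2 + 2 * (1 - b)^2) \<le> r / 4"
  proof -
    have V0: "V \<ge> 0" unfolding V using kap0 w0 hM_le q0 T1
      by (intro mult_nonneg_nonneg divide_nonneg_pos add_nonneg_nonneg) auto
    have "u * 1 \<le> u'" unfolding u' using u r by (intro mult_left_mono) auto
    then have "2 * V / u'^2 \<le> 2 * V / u^2" using V0 u by (intro divide_left_mono power_mono) auto
    then have "10 * K ^ 6 * (2 * V / u'^2) \<le> 10 * K ^ 6 * (2 * V / u^2)" using K1 by (intro mult_left_mono) auto
    also have "\<dots> \<le> r / 8" unfolding V by (rule u_var)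
    finally have 1: "10 * K ^ 6 * (2 * V / u'^2) \<le> r / 8" .
    have "(1 - b)^2 \<le> (8 * r)^2" using b by (intro power_mono) auto
    then have "10 * K ^ 6 * (2 * (1 - b)^2) \<le> 10 * K ^ 6 * (2 * (8 * r)^2)" using K1 by (intro mult_left_mono) auto
    also have "\<dots> = 1280 * K ^ 6 * r * r" by (simp add: power2_eq_square)
    also have "\<dots> \<le> 1280 * K ^ 6 * (1 / T) * r" using r K1 by (intro mult_right_mono mult_left_mono) auto
    also have "\<dots> \<le> 1 / 8 * r"
    proof (intro mult_right_mono)
      have "1280 * K ^ 6 * 8 = 10240 * K ^ 6" by simp
      also have "\<dots> \<le> 10240 * K ^ 10" using K1 by (intro mult_left_mono power_increasing) auto
      also have "\<dots> \<le> 10 ^ 6 * K ^ 10" using K1 by (intro mult_right_mono) auto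
      finally have "1280 * K ^ 6 * 8 \<le> 10 ^ 6 * K ^ 10" .
      then show "1280 * K ^ 6 * (1 / T) \<le> 1 / 8" using K6_T T1 by (simp add: divide_le_eq)
    qed (use r in auto)
    finally show ?thesis using 1 by (simp add: distrib_left)
  qed
  have "\<mu> / u' - D / u * (1 - b) \<le> (- th * D + (th + 25 / 4 * r) * u) / u' - D / u * (1 - b)"
    using mean u'0 by (intro diff_right_mono divide_right_mono) auto
  also have "\<dots> = (D / u) * ((1 - th) * b - 1) + (th + 25 / 4 * r) * b"
    using u u'0 by (simp add: b_def field_simps)
  \<comment> \<open>The coefficient of D / u is nonpositive, so the lower end of the window is the
    worst case.\<close>
  also have "\<dots> \<le> (1 - 1 / K ^ 4) * ((1 - th) * b - 1) + (th + 25 / 4 * r) * b"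
  proof (intro add_right_mono mult_right_mono_neg)
    show "1 - 1 / K ^ 4 \<le> D / u" using D u by (simp add: le_divide_eq)
    have "(1 - th) * b \<le> 1 * 1" using th b by (intro mult_mono) auto
    then show "(1 - th) * b - 1 \<le> 0" using b by simp
  qed
  also have "\<dots> \<le> (1 - 1 / K ^ 4) * (- (th + 8 * r) / (1 + 8 * r)) + (th + 25 / 4 * r) / (1 + 8 * r)"
  proof (intro add_mono mult_left_mono)
    have "(1 - th) * b \<le> (1 - th) * (1 / (1 + 8 * r))" using th_small b by (intro mult_left_mono) auto
    also have "\<dots> - 1 = - (th + 8 * r) / (1 + 8 * r)" using r by (simp add: field_simps)
    finally show "(1 - th) * b - 1 \<le> - (th + 8 * r) / (1 + 8 * r)" by simp
    show "(th + 25 / 4 * r) * b \<le> (th + 25 / 4 * r) / (1 + 8 * r)"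
      using mult_left_mono[OF b(1), of "th + 25 / 4 * r"] th r by simp
    show "0 \<le> 1 - 1 / K ^ 4" using K1 by (simp add: divide_le_eq)
  qed
  also have "\<dots> = (1 / K ^ 4 * (th + 8 * r) - 7 / 4 * r) / (1 + 8 * r)"
    by (simp add: diff_divide_distrib[symmetric] add_divide_distrib[symmetric] algebra_simps)
  also have "\<dots> \<le> (- r) / (1 + 8 * r)"
  proof (rule divide_right_mono)
    show "1 / K ^ 4 * (th + 8 * r) - 7 / 4 * r \<le> - r" using delta_absorb(1) r by linarith
  qed (use r in simp)
  also have "\<dots> \<le> - r / 4"
    using r r1 by (simp add: divide_simps)
  finally show ?thesis using noise by (simp add: b_def)
qed

text \<open>Multiplication by p turns kap into at most 20 K^2, so the lower bound 1600 K^8 for p u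
  tames the jump.\<close>

lemma u_jump:
  assumes u': "u' = u * (1 + r) ^ 8"
  shows "10 * K ^ 6 * ((3 * kap + 5) / u' + \<bar>1 - u / u'\<bar>) \<le> 1"
proof -
  have "u * 1 \<le> u'" unfolding u' using u r by (intro mult_left_mono) auto
  have "u / u' = 1 / (1 + r) ^ 8" using u by (simp add: u')
  then have b: "\<bar>1 - u / u'\<bar> \<le> 8 * r"
    using inverse_power_bounds[of r 8] r by auto
  have "10 * K ^ 6 * (8 * r) \<le> 10 * K ^ 6 * (8 * (1 / T))" using r K1 by (intro mult_left_mono) auto
  also have "\<dots> \<le> 1 / 2"
  proof -
    have "K ^ 6 \<le> K ^ 10" using K1 by (intro power_increasing) auto
    then show ?thesis using K6_T T1 by (simp add: divide_le_eq)
  qed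
  finally have 1: "10 * K ^ 6 * (8 * r) \<le> 1 / 2" .
  have "(3 * kap + 5) / u' \<le> 4 * kap / u" using kap0 u \<open>u * 1 \<le> u'\<close> by (intro frac_le) auto
  also have "\<dots> \<le> 1 / (20 * K ^ 6)"
  proof -
    have "80 * kap * K ^ 6 \<le> u"
    proof -
      have "p * (80 * kap * K ^ 6) = 80 * K ^ 6 * (kap * p)" by simp
      also have "\<dots> \<le> 80 * K ^ 6 * (20 * K^2)" using kap K1 by (intro mult_left_mono) auto
      also have "\<dots> = 1600 * K ^ 8" by (simp flip: power_add)
      also have "\<dots> \<le> p * u" by (rule pu)
      finally show ?thesis using p by simp
    qed
    then show ?thesis using u K1 by (simp add: divide_le_eq le_divide_eq mult_ac)
  qed
  finally have "10 * K ^ 6 * ((3 * kap + 5) / u') \<le> 10 * K ^ 6 * (1 / (20 * K ^ 6))" using K1 by (intro mult_left_mono) auto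
  also have "\<dots> = 1 / 2" using K1 by simp
  finally have 2: "10 * K ^ 6 * ((3 * kap + 5) / u') \<le> 1 / 2" .
  have "10 * K ^ 6 * ((3 * kap + 5) / u' + \<bar>1 - u / u'\<bar>) \<le> 10 * K ^ 6 * ((3 * kap + 5) / u') + 10 * K ^ 6 * (8 * r)"
    using b K1 by (simp add: distrib_left)
  then show ?thesis using 1 2 by linarith
qed

lemma w'_facts:
  assumes w': "w' = w * ((1 - th) * (1 + r) ^ 7)"
  shows "w' \<ge> w / 2" "w / w' \<le> (1 + 2 * th) / (1 + 7 * r)" "(1 - 2 * th) * (w / w') \<le> (1 - th) / (1 + 7 * r)"
    "\<bar>1 - w / w'\<bar> \<le> 13 * K^2 * r"
proof -
  have pw: "(1 + r) ^ 7 \<ge> 1" "(1 + r) ^ 7 > 0" using r by auto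
  have t: "1 - th > 0" "1 / 2 \<le> 1 - th" using th_small by auto
  have "1 / 2 * 1 \<le> (1 - th) * (1 + r) ^ 7" using t pw by (intro mult_mono) auto
  then show "w' \<ge> w / 2" using w0 mult_left_mono[of "1/2" "(1 - th) * (1 + r) ^ 7" w] by (simp add: w')
  have e: "w / w' = 1 / (1 - th) * (1 / (1 + r) ^ 7)" using w0 by (simp add: w')
  have t2: "1 / (1 - th) \<le> 1 + 2 * th" "1 \<le> 1 / (1 - th)"
  proof -
    have "1 \<le> (1 + 2 * th) * (1 - th)" using th th_small mult_left_mono[of "2 * th" 1 th] by (simp add: algebra_simps)
    then show "1 / (1 - th) \<le> 1 + 2 * th" using t by (simp add: divide_le_eq)
    show "1 \<le> 1 / (1 - th)" using t th by (simp add: le_divide_eq)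
  qed
  have ip: "1 / (1 + r) ^ 7 \<le> 1 / (1 + 7 * r)" "1 - 7 * r \<le> 1 / (1 + r) ^ 7" "1 / (1 + r) ^ 7 \<le> 1"
    using inverse_power_bounds[of r 7] r by auto
  show "w / w' \<le> (1 + 2 * th) / (1 + 7 * r)"
    unfolding e using mult_mono[OF t2(1) ip(1)] th pw by simp
  \<comment> \<open>1 - 2 th \<le> (1 - th)^2 compares the double decay rate of open pairs with the
    single factor 1 - th in the bound.\<close>
  have "(1 - 2 * th) * (w / w') \<le> (1 - th)^2 * (w / w')"
    using w0 \<open>w' \<ge> w / 2\<close> by (intro mult_right_mono) (auto simp: power2_eq_square algebra_simps)
  also have "\<dots> = (1 - th) * (1 / (1 + r) ^ 7)" unfolding e using t by (simp add: power2_eq_square)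
  also have "\<dots> \<le> (1 - th) * (1 / (1 + 7 * r))" using t ip by (intro mult_left_mono) auto
  finally show "(1 - 2 * th) * (w / w') \<le> (1 - th) / (1 + 7 * r)" by simp
  have "1 * (1 - 7 * r) \<le> w / w'"
  proof -
    have "1 - 7 * r \<le> 1 * (1 / (1 + r) ^ 7)" using ip by simp
    also have "\<dots> \<le> w / w'" unfolding e using t2 pw by (intro mult_right_mono) auto
    finally show ?thesis by simp
  qed
  moreover have "w / w' \<le> (1 + 2 * th) * 1" unfolding e using t2 ip th pw by (intro mult_mono) auto
  moreover have "r \<le> K^2 * r" using K2 r by simp
  moreover have "1 - 7 * r \<le> b \<Longrightarrow> b \<le> 1 + 2 * t \<Longrightarrow> r \<le> x \<Longrightarrow> t \<le> 3 * x \<Longrightarrow> \<bar>1 - b\<bar> \<le> 13 * x"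
    if "r > 0" for b r t x :: real using that by (simp add: abs_le_iff)
  ultimately show "\<bar>1 - w / w'\<bar> \<le> 13 * K^2 * r" using th(2) r(1)
    by (simp add: mult.assoc)
qed

text \<open>The difference decays at rate 2 th, its bound only at th - 7 r. The spare th + 7 r must
  cover 2.3 (T + i) / T^2 = 2.3 / T + 0.77 th, besides th / 50 and the noise: early in the run 7 r
  does this, later the surplus of th.\<close>

lemma w_window:
  assumes D: "D \<ge> (1 - 1 / K ^ 4) * w" and w': "w' = w * ((1 - th) * (1 + r) ^ 7)"
    and mean: "\<mu> \<le> - 2 * th * D + (23 / 10 * (T + i) / T^2 + th / 50) * w"
    and V: "V = 2 * hM * (4 * hM * WM / q)"
  shows "\<mu> / w' - D / w * (1 - w / w') + 10 * K ^ 6 * (2 * V / w'^2 + 2 * (1 - w / w')^2) \<le> 0"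
proof -
  define b where "b = w / w'"
  define e where "e = 23 / 10 * (T + i) / T^2 + th / 50"
  note wf = w'_facts[OF w', folded b_def]
  have w'0: "w' > 0" using wf(1) w0 by linarith
  have b0: "b > 0" using w0 w'0 by (simp add: b_def)
  have e0: "e \<ge> 0" using th T1 i by (simp add: e_def)
  have r7: "1 + 7 * r > 0" using r by simp
  have noise: "10 * K ^ 6 * (2 * V / w'^2 + 2 * (1 - b)^2) \<le> 1 / 20 * (1 / T)"
  proof -
    have V0: "V \<ge> 0" unfolding V using kap0 w0 hM_le q0 T1
      by (intro mult_nonneg_nonneg divide_nonneg_pos add_nonneg_nonneg) auto
    have "2 * V / w'^2 \<le> 2 * V / (w / 2)^2" using V0 w0 wf(1) by (intro divide_left_mono power_mono) auto
    also have "\<dots> = 8 * V / w^2" by (simp add: power_divide)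
    finally have "10 * K ^ 6 * (2 * V / w'^2) \<le> 10 * K ^ 6 * (8 * V / w^2)" using K1 by (intro mult_left_mono) auto
    also have "\<dots> \<le> 1 / 50 * (1 / T)" unfolding V by (rule w_var)
    finally have 1: "10 * K ^ 6 * (2 * V / w'^2) \<le> 1 / 50 * (1 / T)" .
    have "(1 - b)^2 \<le> (13 * K^2 * r)^2" using wf(4) r by (intro power2_le_iff_abs_le[THEN iffD2]) auto
    then have "10 * K ^ 6 * (2 * (1 - b)^2) \<le> 10 * K ^ 6 * (2 * (13 * K^2 * r)^2)" using K1 by (intro mult_left_mono) auto
    also have "\<dots> = 3380 * K ^ 10 * (r * r)"
    proof -
      have e: "(13 * K^2 * r)^2 = 169 * K ^ 4 * (r * r)"
        by (simp add: power_mult_distrib power2_eq_square[of r] flip: power_mult)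
      have "10 * K ^ 6 * (2 * (13 * K^2 * r)^2) = 3380 * (K ^ 6 * K ^ 4) * (r * r)" by (simp add: e)
      also have "K ^ 6 * K ^ 4 = K ^ 10" by (simp flip: power_add)
      finally show ?thesis .
    qed
    also have "\<dots> \<le> 3380 * K ^ 10 * (1 / T * (1 / T))" using r K1 T1 by (intro mult_left_mono mult_mono) auto
    also have "\<dots> = (3380 * K ^ 10 / T) * (1 / T)" by simp
    also have "\<dots> \<le> 3 / 100 * (1 / T)"
    proof (intro mult_right_mono)
      have "0 \<le> K ^ 10" using K1 by simp
      then have "3380 * K ^ 10 \<le> 3 / 100 * (10 ^ 6 * K ^ 10)" by simp
      also have "\<dots> \<le> 3 / 100 * T" using K6_T by simp
      finally show "3380 * K ^ 10 / T \<le> 3 / 100" using T1 by (simp add: divide_le_eq)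
    qed (use T1 in auto)
    finally show ?thesis using 1 by (simp add: distrib_left)
  qed
  have "\<mu> / w' - D / w * (1 - b) \<le> (- 2 * th * D + e * w) / w' - D / w * (1 - b)"
    using mean w'0 unfolding e_def by (intro diff_right_mono divide_right_mono) auto
  also have "\<dots> = (D / w) * ((1 - 2 * th) * b - 1) + e * b"
    using w0 w'0 by (simp add: b_def field_simps)
  also have "\<dots> \<le> (1 - 1 / K ^ 4) * ((1 - 2 * th) * b - 1) + e * b"
  proof (intro add_right_mono mult_right_mono_neg)
    show "1 - 1 / K ^ 4 \<le> D / w" using D w0 by (simp add: le_divide_eq)
    have "(1 - th) / (1 + 7 * r) \<le> 1" using th r by (simp add: divide_le_eq)
    then show "(1 - 2 * th) * b - 1 \<le> 0" using wf(3) by linarith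
  qed
  also have "\<dots> \<le> (1 - 1 / K ^ 4) * (- (th + 7 * r) / (1 + 7 * r)) + e * (1 + 2 * th) / (1 + 7 * r)"
  proof (intro add_mono mult_left_mono)
    have "(1 - th) / (1 + 7 * r) - 1 = - (th + 7 * r) / (1 + 7 * r)" using r7 by (simp add: field_simps)
    then show "(1 - 2 * th) * b - 1 \<le> - (th + 7 * r) / (1 + 7 * r)" using wf(3) by linarith
    show "e * b \<le> e * (1 + 2 * th) / (1 + 7 * r)"
      using mult_left_mono[OF wf(2) e0] by simp
    show "0 \<le> 1 - 1 / K ^ 4" using K1 by (simp add: divide_le_eq)
  qed
  also have "\<dots> = (1 / K ^ 4 * (th + 7 * r) - (th + 7 * r) + e * (1 + 2 * th)) / (1 + 7 * r)"
    by (simp add: diff_divide_distrib[symmetric] add_divide_distrib[symmetric] algebra_simps)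
  also have "\<dots> \<le> (- (1 / 5) * (1 / T)) / (1 + 7 * r)"
  proof (intro divide_right_mono)
    have x: "(T + i) / T^2 = 1 / T + th / 3" using T1 by (simp add: th_def power2_eq_square field_simps)
    have "e * (1 + 2 * th) \<le> e * (1002 / 1000)" using th_small e0 by (intro mult_left_mono) auto
    also have "\<dots> \<le> 231 / 100 * (1 / T) + 79 / 100 * th"
    proof -
      have "(23 / 10 * (y + t / 3) + t / 50) * (1002 / 1000) \<le> 231 / 100 * y + 79 / 100 * t" if "y > 0" "t \<ge> 0" for y t :: real
        using that by (simp add: field_simps)
      from this[of "1 / T" th] show ?thesis
        unfolding e_def times_divide_eq_right[symmetric] x using th T1 by simp
    qed
    finally have ee: "e * (1 + 2 * th) \<le> 231 / 100 * (1 / T) + 79 / 100 * th" .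
    \<comment> \<open>In hundredths, 251 is 231 plus the desired margin 20, 21 is what 79 leaves of
      th, and 675 is 7 r minus the window loss r / 4. Multiplied out, the claim is quadratic in R /
      T with minimum near 5/2, which explains the square used.\<close>
    have am: "251 / 100 * (1 / T) \<le> 21 / 100 * th + 675 / 100 * r"
    proof -
      define R where "R = T + i"
      have R: "R > 0" "r = 1 / R" "th = 3 * (R - T) / T^2" using T1 i by (auto simp: R_def r_def th_def)
      have "251 / 100 * (T * R) \<le> 63 / 100 * (R - T) * R + 675 / 100 * T^2"
      proof -
        have "5 * (T * R) \<le> R * R + 25 / 4 * (T * T)"
          using zero_le_power2[of "R - 5 / 2 * T"] by (simp add: power2_eq_square algebra_simps)
        moreover have "0 < T * R" "0 \<le> T * T" using R(1) T1 by auto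
        moreover have "63 / 100 * (R - T) * R + 675 / 100 * T^2 = 63 / 100 * (R * R) - 63 / 100 * (T * R) + 675 / 100 * (T * T)"
          by (simp add: power2_eq_square field_simps)
        ultimately show ?thesis by linarith
      qed
      then show ?thesis unfolding R(2,3) using R(1) T1
        by (simp add: divide_simps power2_eq_square)
    qed
    show "1 / K ^ 4 * (th + 7 * r) - (th + 7 * r) + e * (1 + 2 * th) \<le> - (1 / 5) * (1 / T)"
      using ee am delta_absorb(2) by linarith
  qed (use r7 in simp)
  also have "\<dots> \<le> - (1 / 20) * (1 / T)"
  proof -
    have "10 ^ 6 * 1 \<le> 10 ^ 6 * K ^ 10" using K1 by (intro mult_left_mono one_le_power) auto
    then have "T \<ge> 16" using K6_T by simp
    then have "1 / T \<le> 1 / 16" by (intro divide_left_mono) auto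
    then have "1 + 7 * r \<le> 4" using r by linarith
    then have "(1 / 5 * (1 / T)) / 4 \<le> (1 / 5 * (1 / T)) / (1 + 7 * r)" using r7 T1 by (intro divide_left_mono) auto
    then show ?thesis by simp
  qed
  finally show ?thesis using noise by (simp add: b_def)
qed

lemma w_jump:
  assumes w': "w' = w * ((1 - th) * (1 + r) ^ 7)"
  shows "10 * K ^ 6 * (2 * hM / w' + \<bar>1 - w / w'\<bar>) \<le> 1"
proof -
  note wf = w'_facts[OF w']
  have "10 * K ^ 6 * (13 * K^2 * r) = 130 * K ^ 8 * r" by (simp flip: power_add)
  also have "\<dots> \<le> 130 * K ^ 8 * (1 / T)" using r K1 by (intro mult_left_mono) auto
  also have "\<dots> \<le> 1 / 2"
  proof -
    have "K ^ 8 \<le> K ^ 10" using K1 by (intro power_increasing) auto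
    moreover have "0 \<le> K ^ 10" using K1 by simp
    ultimately show ?thesis using K6_T T1 by (simp add: divide_le_eq)
  qed
  finally have 1: "10 * K ^ 6 * (13 * K^2 * r) \<le> 1 / 2" .
  have "20 * K ^ 7 * (12 * c + 28 * u) \<le> 4 * (T * p * u)"
  proof -
    have "240 * K ^ 7 * c \<le> 240 * K ^ 7 * (3 / 2 * (T * K * p))" using c_le2 K1 by (intro mult_left_mono) auto
    also have "\<dots> = (T * p) * (360 * K ^ 8)" by (simp add: power_Suc[symmetric] eval_nat_numeral)
    also have "\<dots> \<le> (T * p) * (2 * u)"
    proof (intro mult_left_mono)
      have "p * u \<le> 1 * u" using p u by (intro mult_right_mono) auto
      moreover have "0 \<le> K ^ 8" using K1 by simp
      ultimately show "360 * K ^ 8 \<le> 2 * u" using pu(2) by linarith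
    qed (use T1 p in auto)
    finally have a: "240 * K ^ 7 * c \<le> (T * p) * (2 * u)" .
    have "K ^ 7 \<le> K ^ 10" using K1 by (intro power_increasing) auto
    moreover have "0 \<le> K ^ 10" using K1 by simp
    ultimately have "560 * K ^ 7 \<le> 2 * (T * p)" using Tp by linarith
    then have "560 * K ^ 7 * u \<le> 2 * (T * p) * u" using u by (intro mult_right_mono) auto
    then show ?thesis using a by (simp add: algebra_simps)
  qed
  also have "\<dots> \<le> w * K" using w_ge by simp
  finally have "20 * K ^ 6 * (12 * c + 28 * u) * K \<le> w * K" by (simp add: eval_nat_numeral mult_ac)
  then have h: "20 * K ^ 6 * (12 * c + 28 * u) \<le> w" using K1 by simp
  have "2 * hM / w' \<le> 2 * (3 * c + 7 * u) / (w / 2)" using hM_le c0 u wf(1) w0 by (intro frac_le) auto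
  also have "\<dots> = (12 * c + 28 * u) / w" by (simp add: field_simps)
  also have "\<dots> \<le> 1 / (20 * K ^ 6)" using h w0 K1 by (simp add: divide_le_eq le_divide_eq mult_ac)
  finally have "10 * K ^ 6 * (2 * hM / w') \<le> 10 * K ^ 6 * (1 / (20 * K ^ 6))" using K1 by (intro mult_left_mono) auto
  also have "\<dots> = 1 / 2" using K1 by simp
  finally have 2: "10 * K ^ 6 * (2 * hM / w') \<le> 1 / 2" .
  have "10 * K ^ 6 * (2 * hM / w' + \<bar>1 - w / w'\<bar>) \<le> 10 * K ^ 6 * (2 * hM / w' + 13 * K^2 * r)"
    using wf(4) K1 by (intro mult_left_mono add_left_mono) auto
  also have "\<dots> = 10 * K ^ 6 * (2 * hM / w') + 10 * K ^ 6 * (13 * K^2 * r)" by (rule distrib_left)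
  finally have "10 * K ^ 6 * (2 * hM / w' + \<bar>1 - w / w'\<bar>) \<le> 10 * K ^ 6 * (2 * hM / w') + 10 * K ^ 6 * (13 * K^2 * r)" .
  then show ?thesis using 1 2 by linarith
qed

end

subsection \<open>The deterministic trajectory\<close>

text \<open>To be used with K the square root of ln n and Y the fourth root of 2n, which keeps all powers
  integral; m is the number of steps.\<close>

locale trajectory =
  fixes n m :: nat and K Y :: real
  assumes K: "K \<ge> 10 ^ 8" and Y: "Y \<ge> K ^ 10" and n: "2 * real n = Y ^ 4"
    and m: "Y^2 + m \<le> Y^2 * K"
    and Pm: "(\<Prod>j<m. 1 - 3 * real j / (2 * real n)) \<ge> K ^ 18 / Y"
begin

definition "T = Y^2"
definition "P i = (\<Prod>j<i. 1 - 3 * real j / T^2)"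
text \<open>The initial value Y K^6 is the square root of T K^12, the size the variance bound asks
  for; the growth factor stays below K^8.\<close>

definition "ub i = Y * K ^ 6 * ((T + real i) / T) ^ 8"
definition "wb i = 4 * T^2 * P i * ub i / (T + real i)"
text \<open>An overlap rises with probability about 2 i / q per step, and such terms sum to a
  multiple of 1 / P, since 1 / P grows by at least th / P per step. The initial 10 K^2 makes the
  initial potential of a pair exp (- 10 K^2); the second summand pays for step 0, where th
  vanishes.\<close>

definition "kp i = 10 * K^2 / P i + 10 * K^2 * real i / T^2"
text \<open>Error budget for |Q| / P, spent at a constant rate and equal to T^2 / 4 after m
  steps.\<close>

definition "er i = real i * T^2 / (4 * real m)"
definition "th i = 3 * real i / T^2"
definition "r i = 1 / (T + real i)"

lemma K1: "K \<ge> 1" "K > 0" using K by auto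

lemma Y1: "Y > 0" "Y \<ge> 1" "Y \<ge> K"
proof -
  have "K ^ 1 \<le> K ^ 10" using K1 by (intro power_increasing) auto
  then show "Y \<ge> K" using Y by simp
  then show "Y > 0" "Y \<ge> 1" using K1 by auto
qed

lemma T_big: "T \<ge> K ^ 20"
proof -
  have "(K ^ 10)^2 \<le> Y^2" using Y K1 by (intro power_mono) auto
  then show ?thesis by (simp add: T_def flip: power_mult)
qed

lemma T_sq: "T^2 = 2 * real n"
  using n by (simp add: T_def flip: power_mult)

lemma T1: "T > 0" "T \<ge> 1" "T \<ge> Y" "T \<ge> K"
proof -
  show "T > 0" "T \<ge> 1" using Y1 by (auto simp: T_def)
  show "T \<ge> Y" using Y1 by (simp add: T_def power2_eq_square)
  then show "T \<ge> K" using Y1 by simp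
qed

lemma i_le: "i \<le> m \<Longrightarrow> T + real i \<le> T * K" "i \<le> m \<Longrightarrow> real i \<le> T * K"
  using m T1 by (auto simp: T_def)

lemma th0: "th i \<ge> 0" by (simp add: th_def)

lemma th_le: "i \<le> m \<Longrightarrow> th i \<le> 1 / 1000"
proof -
  assume "i \<le> m"
  then have "th i \<le> 3 * (T * K) / T^2" unfolding th_def using i_le by (intro divide_right_mono) auto
  also have "\<dots> = 3 * K / T" using T1 by (simp add: power2_eq_square)
  also have "\<dots> \<le> 3 * K / K ^ 20" using T_big K1 T1 by (intro divide_left_mono mult_pos_pos) auto
  also have "\<dots> = 3 / K ^ 19" using K1 by (simp add: divide_simps flip: power_Suc)
  also have "\<dots> \<le> 3 / K ^ 1" using K1 by (intro divide_left_mono power_increasing) auto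
  also have "\<dots> \<le> 1 / 1000" using K by (simp add: divide_le_eq)
  finally show ?thesis .
qed

lemma P_Suc: "P (Suc i) = P i * (1 - th i)" by (simp add: P_def th_def)

lemma P_0: "P 0 = 1" by (simp add: P_def)

lemma P_pos: "i \<le> Suc m \<Longrightarrow> 0 < P i \<and> P i \<le> 1"
proof (induction i)
  case 0 then show ?case by (simp add: P_def)
next
  case (Suc i)
  then have IH: "0 < P i" "P i \<le> 1" and t: "th i \<le> 1 / 1000" using th_le[of i] by auto
  have "P i * (1 - th i) \<le> 1 * 1" using IH t th0[of i] by (intro mult_mono) auto
  then show ?case using IH t by (simp add: P_Suc)
qed

lemma P_antimono: "i \<le> m \<Longrightarrow> P m \<le> P i"
proof (induction rule: inc_induct)
  case (step j)
  have "P j * (1 - th j) \<le> P j * 1" using P_pos[of j] th0[of j] step by (intro mult_left_mono) auto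
  then show ?case using step by (simp add: P_Suc)
qed simp

lemma P_ge: "i \<le> m \<Longrightarrow> K ^ 18 / Y \<le> P i"
  using P_antimono[of i] Pm by (simp add: P_def T_sq)

lemma inv_P_le: "i \<le> m \<Longrightarrow> 1 / P i \<le> Y / K ^ 18"
  using P_ge[of i] P_pos[of i] Y1 K1 by (simp add: divide_simps mult_ac)

lemma ub_bounds: "i \<le> m \<Longrightarrow> Y * K ^ 6 \<le> ub i \<and> ub i \<le> Y * K ^ 14"
proof
  assume i: "i \<le> m"
  have "1 \<le> (T + real i) / T" "(T + real i) / T \<le> K" using T1 i_le[OF i] by (auto simp: le_divide_eq divide_le_eq mult_ac)
  then have b: "1 \<le> ((T + real i) / T) ^ 8" "((T + real i) / T) ^ 8 \<le> K ^ 8" by (auto intro: one_le_power power_mono)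
  have "Y * K ^ 6 * 1 \<le> ub i" unfolding ub_def using b Y1 K1 by (intro mult_left_mono) auto
  then show "Y * K ^ 6 \<le> ub i" by simp
  have "ub i \<le> Y * K ^ 6 * K ^ 8" unfolding ub_def using b Y1 K1 by (intro mult_left_mono) auto
  also have "\<dots> = Y * K ^ 14" by (simp flip: power_add)
  finally show "ub i \<le> Y * K ^ 14" .
qed

lemma kp_le: "i \<le> m \<Longrightarrow> kp i \<le> 20 * K^2 / P i"
proof -
  assume i: "i \<le> m"
  have "T * K \<le> T * T" using T1 by (intro mult_left_mono) auto
  then have "real i \<le> T^2" using i_le(2)[OF i] unfolding power2_eq_square by linarith
  then have "real i / T^2 \<le> 1" using T1 by (simp add: divide_le_eq)
  also have "1 \<le> 1 / P i" using P_pos[of i] i by (simp add: le_divide_eq)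
  finally have "10 * K^2 * (real i / T^2) \<le> 10 * K^2 * (1 / P i)" by (intro mult_left_mono) auto
  then show ?thesis by (simp add: kp_def)
qed

lemma kp_ge: "i \<le> m \<Longrightarrow> 10 * K^2 \<le> kp i"
proof -
  assume i: "i \<le> m"
  have "1 \<le> 1 / P i" using P_pos[of i] i by (simp add: le_divide_eq)
  then have "10 * K^2 * 1 \<le> 10 * K^2 * (1 / P i)" by (intro mult_left_mono) auto
  then have "10 * K^2 \<le> 10 * K^2 / P i" by simp
  moreover have "0 \<le> 10 * K^2 * real i / T^2" by simp
  ultimately show ?thesis unfolding kp_def by linarith
qed

lemma kp_ub: "i \<le> m \<Longrightarrow> 1000 * K^2 * kp i \<le> ub i" and kp_Y: "i \<le> m \<Longrightarrow> kp i \<le> 20 * Y / K ^ 16"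
proof -
  assume i: "i \<le> m"
  have "kp i \<le> 20 * K^2 * (1 / P i)" using kp_le[OF i] by simp
  also have "\<dots> \<le> 20 * K^2 * (Y / K ^ 18)" using inv_P_le[OF i] by (intro mult_left_mono) auto
  also have "\<dots> = 20 * Y / K ^ 16" using K1 by (simp add: divide_simps flip: power_add)
  finally show 1: "kp i \<le> 20 * Y / K ^ 16" .
  have "1000 * K^2 * kp i \<le> 1000 * K^2 * (20 * Y / K ^ 16)" using 1 by (intro mult_left_mono) auto
  also have "\<dots> = 20000 / K ^ 14 * Y" using K1 by (simp add: divide_simps flip: power_add)
  also have "\<dots> \<le> K ^ 6 * Y"
  proof (intro mult_right_mono)
    have "20000 / K ^ 14 \<le> 20000 / K ^ 1" using K1 by (intro divide_left_mono power_increasing) auto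
    also have "\<dots> \<le> 1" using K by (simp add: divide_le_eq)
    also have "1 \<le> K ^ 6" using K1 by simp
    finally show "20000 / K ^ 14 \<le> K ^ 6" .
  qed (use Y1 in auto)
  also have "\<dots> \<le> ub i" using ub_bounds[OF i] by (simp add: mult.commute)
  finally show "1000 * K^2 * kp i \<le> ub i" .
qed

text \<open>The exponent 18 is used here: T P \<ge> Y K^18 against ub \<le> Y K^14 leaves K^4, of
  which K^2 is demanded and K^2 absorbs the constant 1000.\<close>

lemma drift:
  assumes i: "i \<le> m" and q: "2 / 3 * (T^2 * P i) \<le> q" "q \<le> 3 / 2 * (T^2 * P i)"
    and c: "c = real i * q / T^2" "lo \<le> c" "c \<le> hi" "hi \<le> c + ub i + kp i" "hi - lo \<le> ub i + kp i"
  shows "drift_numerics K T (P i) (ub i) (kp i) (real i) q c lo hi (wb i)"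
proof
  have pp: "0 < P i" "P i \<le> 1" using P_pos[of i] i by auto
  have u: "Y * K ^ 6 \<le> ub i" "ub i \<le> Y * K ^ 14" using ub_bounds[OF i] by auto
  show "10 ^ 8 \<le> K" "K ^ 20 \<le> T" "0 < P i" "P i \<le> 1" "0 \<le> real i" "T + real i \<le> T * K"
    using K T_big pp i_le[OF i] by auto
  have YK: "0 < Y * K ^ 6" using Y1 K1 by simp
  then show "0 < ub i" using u by linarith
  have "T * K ^ 12 = (Y * K ^ 6)^2" by (simp add: T_def power_mult_distrib flip: power_mult)
  also have "\<dots> \<le> (ub i)^2" using u YK by (intro power_mono) auto
  finally show "T * K ^ 12 \<le> (ub i)^2" .
  show "1000 * K^2 * kp i \<le> ub i" by (rule kp_ub[OF i])
  show "10 * K^2 \<le> kp i" by (rule kp_ge[OF i])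
  show "kp i * P i \<le> 20 * K^2" using kp_le[OF i] pp by (simp add: le_divide_eq)
  have PY: "Y * K ^ 18 \<le> T * P i"
  proof -
    have "T * (K ^ 18 / Y) \<le> T * P i" using P_ge[OF i] T1 by (intro mult_left_mono) auto
    then show ?thesis using Y1 by (simp add: T_def power2_eq_square)
  qed
  have K2: "1000 \<le> K^2"
  proof -
    have "10 ^ 8 * 1 \<le> K * K" using K by (intro mult_mono) auto
    then show ?thesis by (simp add: power2_eq_square)
  qed
  have "1000 * K^2 * ub i \<le> 1000 * K^2 * (Y * K ^ 14)" using u by (intro mult_left_mono) auto
  also have "\<dots> = 1000 * (Y * K ^ 16)" by (simp flip: power_add)
  also have "\<dots> \<le> K^2 * (Y * K ^ 16)" using K2 Y1 K1 by (intro mult_right_mono) auto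
  also have "\<dots> = Y * K ^ 18" by (simp flip: power_add)
  finally show "1000 * K^2 * ub i \<le> T * P i" using PY by linarith
  have "1000 * K ^ 10 \<le> K^2 * K ^ 10" using K2 K1 by (intro mult_right_mono) auto
  also have "\<dots> = K ^ 12" by (simp flip: power_add)
  also have "\<dots> \<le> K ^ 24" using K1 by (intro power_increasing) auto
  also have "\<dots> = (K ^ 18 / Y) * (Y * K ^ 6)" using Y1 by (simp flip: power_add)
  also have "\<dots> \<le> P i * ub i" using P_ge[OF i] u YK pp by (intro mult_mono) auto
  finally show "1000 * K ^ 10 \<le> P i * ub i" .
  show "wb i = 4 * T^2 * P i * ub i / (T + real i)" by (simp add: wb_def)
qed (use q c in auto)

lemma ub_Suc: "ub (Suc i) = ub i * (1 + r i) ^ 8"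
proof -
  have "(T + real (Suc i)) / T = (T + real i) / T * (1 + r i)"
  proof -
    have "T + real i > 0" using T1 by (simp add: add_pos_nonneg)
    then have "(T + real i) * (1 + r i) = T + real (Suc i)" by (simp add: r_def distrib_left)
    then show ?thesis by (simp only: times_divide_eq_left)
  qed
  then show ?thesis unfolding ub_def by (simp only: power_mult_distrib mult.assoc)
qed

text \<open>The factor 1 / (T + i) in \<open>wb\<close> takes one power of 1 + r away from the eight
  of \<open>ub\<close>.\<close>

lemma wb_Suc: "wb (Suc i) = wb i * ((1 - th i) * (1 + r i) ^ 7)"
proof -
  have r1: "1 + r i > 0" using T1 by (simp add: r_def add_pos_nonneg)
  have e: "T + real (Suc i) = (T + real i) * (1 + r i)"
  proof -
    have "T + real i > 0" using T1 by (simp add: add_pos_nonneg)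
    then show ?thesis by (simp add: r_def distrib_left)
  qed
  have "wb (Suc i) = 4 * T^2 * (P i * (1 - th i)) * (ub i * (1 + r i) ^ 8) / ((T + real i) * (1 + r i))"
    unfolding wb_def P_Suc ub_Suc e ..
  also have "(1 + r i) ^ 8 = (1 + r i) ^ 7 * (1 + r i)" by (simp add: power_Suc2[symmetric])
  finally show ?thesis using r1 by (simp add: wb_def)
qed

text \<open>52 is 26 times 2: at most 2 i + 2 choices raise an overlap, by at most 3, and exp 3
  \<le> 1 + 26.\<close>

lemma kp_increment:
  assumes i: "i < m" and q: "2 / 3 * (T^2 * P i) \<le> q"
  shows "52 * (real i + 1) / q \<le> kp (Suc i) - kp i"
proof -
  have pp: "0 < P i" "P i \<le> 1" using P_pos[of i] i by auto
  have t: "0 \<le> th i" "th i \<le> 1 / 1000" using th0 th_le[of i] i by auto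
  have TP: "T^2 * P i > 0" using T1 pp by simp
  have eq: "52 * x / (2 / 3 * A) = 78 * x / A" if "A > 0" for x A :: real
    using that by (simp add: field_simps)
  have "52 * (real i + 1) / q \<le> 52 * (real i + 1) / (2 / 3 * (T^2 * P i))"
    using q TP by (intro divide_left_mono) auto
  also have "\<dots> = 78 * (real i + 1) / (T^2 * P i)" by (rule eq[OF TP])
  also have "\<dots> \<le> 10 * K^2 * (th i / P i) + 10 * K^2 / T^2"
  proof (cases "i = 0")
    case True
    have "78 \<le> 10 * K^2" using K power_mono[of "10 ^ 8" K 2] by simp
    then show ?thesis using True T1 by (simp add: P_0 th_def divide_right_mono)
  next
    case False
    then have "78 * (real i + 1) \<le> 156 * real i" by simp
    also have "\<dots> \<le> 30 * K^2 * real i" using K power_mono[of "10 ^ 8" K 2] by (intro mult_right_mono) auto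
    finally have "78 * (real i + 1) / (T^2 * P i) \<le> 30 * K^2 * real i / (T^2 * P i)"
      using TP by (intro divide_right_mono) auto
    also have "\<dots> = 10 * K^2 * (th i / P i)" by (simp add: th_def)
    also have "\<dots> \<le> 10 * K^2 * (th i / P i) + 10 * K^2 / T^2" by simp
    finally show ?thesis .
  qed
  also have "\<dots> \<le> kp (Suc i) - kp i"
  proof -
    have "1 / P i + th i / P i \<le> 1 / P (Suc i)"
    proof -
      have "(1 + th i) * (1 - th i) \<le> 1" by (simp add: algebra_simps)
      then have "1 + th i \<le> 1 / (1 - th i)" using t by (simp add: le_divide_eq)
      then have "(1 + th i) * (1 / P i) \<le> 1 / (1 - th i) * (1 / P i)" using pp by (intro mult_right_mono) auto
      then show ?thesis by (simp add: P_Suc add_divide_distrib mult_ac)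
    qed
    then have "10 * K^2 * (1 / P i + th i / P i) \<le> 10 * K^2 * (1 / P (Suc i))" by (intro mult_left_mono) auto
    moreover have "10 * K^2 * real (Suc i) / T^2 = 10 * K^2 * real i / T^2 + 10 * K^2 / T^2"
      by (simp add: distrib_left add_divide_distrib)
    ultimately show ?thesis by (simp add: kp_def distrib_left)
  qed
  finally show ?thesis .
qed

text \<open>Bounds the whole correction for exceptional choices in \<open>tracked\<close>, since
  \<open>R0\<close> is itself an overlap.\<close>

lemma m_kp: "i \<le> m \<Longrightarrow> 5 * real m * kp i \<le> T^2 / 4"
proof -
  assume i: "i \<le> m"
  have "5 * real m * kp i \<le> 5 * (T * K) * (20 * Y / K ^ 16)"
    using kp_Y[OF i] i_le(2)[of m] kp_ge[OF i] T1 K1 by (intro mult_mono) (auto intro: order_trans[rotated])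
  also have "\<dots> = 100 / K ^ 15 * (T * Y)" using K1 by (simp add: divide_simps flip: power_Suc)
  also have "\<dots> \<le> 1 / 4 * (T * T)"
  proof (intro mult_mono)
    have "100 / K ^ 15 \<le> 100 / K ^ 1" using K1 by (intro divide_left_mono power_increasing) auto
    also have "\<dots> \<le> 1 / 4" using K by (simp add: divide_le_eq)
    finally show "100 / K ^ 15 \<le> 1 / 4" .
  qed (use T1 Y1 in auto)
  finally show ?thesis by (simp add: power2_eq_square)
qed

text \<open>4 u + 2 kap bounds the deviation of a closed set from 3 c in one step. The budget grows
  by at least T / (4 K) per step, which P \<ge> K^18 / Y makes sufficient.\<close>

lemma er_increment:
  assumes i: "i < m"
  shows "4 * ub i + 2 * kp i \<le> P (Suc i) * (er (Suc i) - er i)"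
proof -
  have pp: "0 < P i" "P i \<le> 1" using P_pos[of i] i by auto
  have t: "0 \<le> th i" "th i \<le> 1 / 1000" using th0 th_le[of i] i by auto
  have i': "i \<le> m" using i by simp
  have m0: "real m > 0" using i by simp
  have e: "er (Suc i) - er i = T^2 / (4 * real m)"
    using m0 by (simp add: er_def field_simps)
  have "real m \<le> T * K" using i_le(2)[of m] by simp
  then have "T^2 / (4 * (T * K)) \<le> T^2 / (4 * real m)" using m0 T1 K1 by (intro divide_left_mono) auto
  moreover have "T^2 / (4 * (T * K)) = T / (4 * K)" using T1 by (simp add: power2_eq_square)
  ultimately have 1: "T / (4 * K) \<le> er (Suc i) - er i" using e by simp
  have "1000 * kp i \<le> ub i"
  proof -
    have "1 * kp i \<le> K^2 * kp i" using K1 kp_ge[OF i'] by (intro mult_right_mono) (auto intro: order_trans[rotated])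
    then show ?thesis using kp_ub[OF i'] by simp
  qed
  moreover have "ub i > 0" using ub_bounds[OF i'] Y1 K1 mult_pos_pos[of Y "K ^ 6"] by (smt (verit) zero_less_power)
  ultimately have "4 * ub i + 2 * kp i \<le> 5 * ub i" by simp
  also have "\<dots> \<le> 5 * (Y * K ^ 14)" using ub_bounds[OF i'] by simp
  also have "\<dots> \<le> (1 / 2 * (K ^ 18 / Y)) * (T / (4 * K))"
  proof -
    have eq: "(1 / 2 * (K ^ 18 / Y)) * (T / (4 * K)) = 1 / 8 * (Y * K ^ 17)"
    proof -
      have "K ^ 18 = K ^ 17 * K" by (simp flip: power_Suc2)
      then show ?thesis using Y1 K1 by (simp add: T_def power2_eq_square divide_simps)
    qed
    moreover have "40 * K ^ 14 \<le> K ^ 3 * K ^ 14"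
    proof (intro mult_right_mono)
      have "K ^ 1 \<le> K ^ 3" using K1 by (intro power_increasing) auto
      then show "40 \<le> K ^ 3" using K by simp
    qed (use K1 in auto)
    moreover have "K ^ 3 * K ^ 14 = K ^ 17" by (simp flip: power_add)
    ultimately have "40 * K ^ 14 \<le> K ^ 17" by simp
    then have "Y * (40 * K ^ 14) \<le> Y * K ^ 17" using Y1 by (intro mult_left_mono) auto
    then show ?thesis unfolding eq by simp
  qed
  also have "\<dots> \<le> P (Suc i) * (er (Suc i) - er i)"
  proof (intro mult_mono 1)
    have "1 / 2 * (K ^ 18 / Y) \<le> (1 - th i) * P i" using P_ge[OF i'] t K1 Y1 by (intro mult_mono) auto
    then show "1 / 2 * (K ^ 18 / Y) \<le> P (Suc i)" by (simp add: P_Suc mult.commute)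
    show "0 \<le> P (Suc i)" using P_pos[of "Suc i"] i by simp
    show "0 \<le> T / (4 * K)" using T1 K1 by simp
  qed
  finally show ?thesis .
qed

end

subsection \<open>The total potential\<close>

lemma active_insert: "active N (insert s S) g \<Longrightarrow> active N S g"
  by (auto simp: active_def)

context trajectory
begin

abbreviation "NN \<equiv> 2 * int n"
abbreviation "shifts a \<equiv> (UNIV :: bool set) \<times> {a..<NN}"
text \<open>Together with the window width 1 / K^4 this gives lam / K^4 = 10 K^2 = 10 log n, so
  falling out of the window costs a factor n^(-10), against about n^2 pairs and at most 2 n
  steps.\<close>

definition "lam = 10 * K ^ 6"

text \<open>Overlaps are controlled for shift 0 too, because S and - S enter through the exceptional
  elements.\<close>

definition "good i S Q \<longleftrightarrow>
   (\<forall>g\<in>shifts 0. \<forall>h\<in>shifts 0. g \<noteq> h \<longrightarrow> real (overlap NN g h S) \<le> kp i)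
 \<and> (\<forall>g h. active NN S g \<longrightarrow> active NN S h \<longrightarrow> real (cnt NN g S Q) - cnt NN h S Q \<le> ub i)
 \<and> (\<forall>g\<in>shifts 1. \<forall>h\<in>shifts 1. real (cnt NN g Q Q) - cnt NN h Q Q \<le> wb i)"

lemma goodD:
  assumes "good i S Q"
  shows "g \<in> shifts 0 \<Longrightarrow> h \<in> shifts 0 \<Longrightarrow> g \<noteq> h \<Longrightarrow> real (overlap NN g h S) \<le> kp i"
    "active NN S g \<Longrightarrow> active NN S h \<Longrightarrow> real (cnt NN g S Q) - cnt NN h S Q \<le> ub i"
    "snd g \<in> {1..<NN} \<Longrightarrow> snd h \<in> {1..<NN} \<Longrightarrow> real (cnt NN g Q Q) - cnt NN h Q Q \<le> wb i"
  using assms unfolding good_def by (blast, blast, metis UNIV_I mem_Times_iff)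

abbreviation "R0 S \<equiv> real (overlap NN (True, 0) (False, 0) S)"

text \<open>An exceptional choice adds an element to the intersection of S and - S, so R0 pays for the
  steps in which q does not decrease enough for the upper bound.\<close>

definition "tracked i S Q \<longleftrightarrow> valid_state NN S Q \<and> card S = i
   \<and> P i * (T^2 - 1 - er i) \<le> card Q \<and> card Q \<le> P i * (T^2 + er i + 5 * real m * R0 S)"

definition "rpot i S g h = (if g = h then 0 else exp (real (overlap NN g h S) - kp i))"
text \<open>Inactivity is permanent, so a pair with an inactive member is dropped for good.\<close>

definition "upot i S Q g h = (if active NN S g \<and> active NN S h
    then exp (lam * ((real (cnt NN g S Q) - cnt NN h S Q) / ub i - 1)) else 0)"
definition "wpot i Q g h = exp (lam * ((real (cnt NN g Q Q) - cnt NN h Q Q) / wb i - 1))"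

definition "pot i S Q =
    (\<Sum>g\<in>shifts 0. \<Sum>h\<in>shifts 0. rpot i S g h)
  + (\<Sum>g\<in>shifts 1. \<Sum>h\<in>shifts 1. upot i S Q g h)
  + (\<Sum>g\<in>shifts 1. \<Sum>h\<in>shifts 1. wpot i Q g h)"

text \<open>Two families with at most (4 n)^2 pairs each, every pair with the additive term of
  \<open>potential_step\<close>.\<close>

definition "eps = 32 * (real n)^2 * exp (1 - lam * (1 / K ^ 4))"

lemma NN: "real_of_int NN = T^2" "NN > 2"
proof -
  show 1: "real_of_int NN = T^2" by (simp add: T_sq)
  have "10 ^ 8 * 1 \<le> T * T" using T1 K by (intro mult_mono) auto
  then have "real_of_int NN > 2" unfolding 1 by (simp add: power2_eq_square)
  then show "NN > 2" by linarith
qed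

lemma ub_pos: "i \<le> m \<Longrightarrow> ub i > 0"
  using ub_bounds[of i] Y1 K1 mult_pos_pos[of Y "K ^ 6"] by (smt (verit) zero_less_power)

lemma wb_pos: "i \<le> m \<Longrightarrow> wb i > 0"
  unfolding wb_def using ub_pos[of i] P_pos[of i] T1 by (intro divide_pos_pos mult_pos_pos add_pos_nonneg) auto

lemma lam_pos: "lam > 0" using K1 by (simp add: lam_def)

lemma pot_nonneg: "0 \<le> rpot i S g h" "0 \<le> upot i S Q g h" "0 \<le> wpot i Q g h"
  by (auto simp: rpot_def upot_def wpot_def)

lemma sums_nonneg:
  "0 \<le> (\<Sum>g\<in>shifts 0. \<Sum>h\<in>shifts 0. rpot i S g h)"
  "0 \<le> (\<Sum>g\<in>shifts 1. \<Sum>h\<in>shifts 1. upot i S Q g h)"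
  "0 \<le> (\<Sum>g\<in>shifts 1. \<Sum>h\<in>shifts 1. wpot i Q g h)"
  by (intro sum_nonneg pot_nonneg)+

lemma pot_nonneg': "0 \<le> pot i S Q"
  unfolding pot_def using sums_nonneg by (intro add_nonneg_nonneg) blast+

lemma double_sum_ge:
  fixes f :: "'a \<Rightarrow> 'b \<Rightarrow> real"
  assumes "finite A" "finite B" "g \<in> A" "h \<in> B" "\<And>g h. 0 \<le> f g h"
  shows "f g h \<le> (\<Sum>g\<in>A. \<Sum>h\<in>B. f g h)"
proof -
  have "f g h \<le> (\<Sum>h\<in>B. f g h)" using assms by (intro member_le_sum) auto
  also have "\<dots> \<le> (\<Sum>g\<in>A. \<Sum>h\<in>B. f g h)"
    using assms by (intro member_le_sum[of g A "\<lambda>g. \<Sum>h\<in>B. f g h"]) (auto intro: sum_nonneg)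
  finally show ?thesis .
qed

lemma one_le_exp: "1 < x \<Longrightarrow> 1 \<le> exp (lam * (x - 1))"
  using lam_pos by simp

lemma bad_pot:
  assumes i: "i \<le> m" and bad: "\<not> good i S Q"
  shows "1 \<le> pot i S Q"
proof -
  have fin: "finite (shifts a)" for a by simp
  consider (r) g h where "g \<in> shifts 0" "h \<in> shifts 0" "g \<noteq> h" "kp i < overlap NN g h S"
    | (u) g h where "active NN S g" "active NN S h" "ub i < real (cnt NN g S Q) - cnt NN h S Q"
    | (w) g h where "g \<in> shifts 1" "h \<in> shifts 1" "wb i < real (cnt NN g Q Q) - cnt NN h Q Q"
    using bad unfolding good_def by (meson not_le)
  then show ?thesis
  proof cases
    case r
    have "1 \<le> rpot i S g h" using r by (simp add: rpot_def)
    also have "\<dots> \<le> (\<Sum>g\<in>shifts 0. \<Sum>h\<in>shifts 0. rpot i S g h)"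
      by (intro double_sum_ge fin r pot_nonneg)
    finally show ?thesis using sums_nonneg(1)[of i S] sums_nonneg(2)[of i S Q] sums_nonneg(3)[of i Q]
      unfolding pot_def by linarith
  next
    case u
    have gh: "g \<in> shifts 1" "h \<in> shifts 1" using u by (auto simp: active_def mem_Times_iff)
    have "1 < (real (cnt NN g S Q) - cnt NN h S Q) / ub i" using u ub_pos[OF i] by (simp add: less_divide_eq)
    then have "1 \<le> upot i S Q g h" using u one_le_exp by (simp add: upot_def)
    also have "\<dots> \<le> (\<Sum>g\<in>shifts 1. \<Sum>h\<in>shifts 1. upot i S Q g h)"
      by (intro double_sum_ge fin gh pot_nonneg)
    finally show ?thesis using sums_nonneg(1)[of i S] sums_nonneg(2)[of i S Q] sums_nonneg(3)[of i Q]
      unfolding pot_def by linarith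
  next
    case w
    have "1 < (real (cnt NN g Q Q) - cnt NN h Q Q) / wb i" using w wb_pos[OF i] by (simp add: less_divide_eq)
    then have "1 \<le> wpot i Q g h" using one_le_exp by (simp add: wpot_def)
    also have "\<dots> \<le> (\<Sum>g\<in>shifts 1. \<Sum>h\<in>shifts 1. wpot i Q g h)"
      by (intro double_sum_ge fin w pot_nonneg)
    finally show ?thesis using sums_nonneg(1)[of i S] sums_nonneg(2)[of i S Q] sums_nonneg(3)[of i Q]
      unfolding pot_def by linarith
  qed
qed

end

section \<open>One step from a tracked state within all bounds\<close>

locale trajectory_step = trajectory +
  fixes i :: nat and S Q :: "int set"
  assumes i: "i < m" and tracked: "tracked i S Q" and good: "good i S Q"
begin

abbreviation "cl \<equiv> closed_by NN S Q"
abbreviation "q \<equiv> real (card Q)"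

lemma im: "i \<le> m" using i by simp

lemma valid: "valid_state NN S Q" and cardS: "card S = i"
  using tracked by (auto simp: tracked_def)

lemmas vD = valid_stateD[OF valid]

lemma Pp: "0 < P i" "P i \<le> 1" using P_pos[of i] im by auto

lemma er_le: "er i \<le> T^2 / 4"
proof -
  have "real i * T^2 \<le> real m * T^2" using i by (intro mult_right_mono) auto
  then show ?thesis using i by (simp add: er_def divide_le_eq mult.commute)
qed

lemma T2_big: "T^2 \<ge> 10 ^ 8"
proof -
  have "10 ^ 8 * 1 \<le> T * T" using T1 K by (intro mult_mono) auto
  then show ?thesis by (simp add: power2_eq_square)
qed

lemma R0_le: "R0 S \<le> kp i"
  by (rule goodD(1)[OF good]) (use NN(2) in auto)

lemma q_lower: "2 / 3 * (T^2 * P i) \<le> q"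
proof -
  have "P i * (2 / 3 * T^2) \<le> P i * (T^2 - 1 - er i)" using Pp er_le T2_big by (intro mult_left_mono) auto
  also have "\<dots> \<le> q" using tracked by (simp add: tracked_def)
  finally show ?thesis by (simp add: mult_ac)
qed

lemma q_slack: "T^2 + er i + 5 * real m * R0 S \<le> 3 / 2 * T^2"
proof -
  have "5 * real m * R0 S \<le> 5 * real m * kp i" using R0_le by (intro mult_left_mono) auto
  then show ?thesis using m_kp[OF im] er_le by linarith
qed

lemma q_upper: "q \<le> 3 / 2 * (T^2 * P i)"
proof -
  have "q \<le> P i * (T^2 + er i + 5 * real m * R0 S)" using tracked by (simp add: tracked_def)
  also have "\<dots> \<le> P i * (3 / 2 * T^2)" using Pp q_slack by (intro mult_left_mono) auto
  finally show ?thesis by (simp add: mult_ac)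
qed

lemma q_pos: "q > 0"
proof -
  have "0 < 2 / 3 * (T^2 * P i)" using T1 Pp by simp
  then show ?thesis using q_lower by linarith
qed

lemma Q_ne: "Q \<noteq> {}" "finite Q" using q_pos vD by (auto simp: card_gt_0_iff)

definition "c = real i * q / T^2"

lemma kp1: "kp i \<ge> 10 ^ 17"
proof -
  have "(10 ^ 8)^2 \<le> K^2" using K by (intro power_mono) auto
  then show ?thesis using kp_ge[OF im] by simp
qed

lemma bounds_ex: "\<exists>lo hi. good_state NN S Q lo hi (kp i) c
    \<and> drift_numerics K T (P i) (ub i) (kp i) (real i) q c lo hi (wb i)"
proof -
  have ii: "real i + 1 \<le> T * K" using i_le(2)[of m] i by simp
  have "(real i + 1)^2 \<le> (T * K)^2" using ii by (intro power_mono) auto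
  then have "2 * (real (card S) + 1)^2 / NN \<le> 2 * (T * K)^2 / T^2"
    unfolding NN(1) cardS by (intro divide_right_mono) auto
  also have "\<dots> = 2 * K^2" using T1 by (simp add: power_mult_distrib)
  also have "\<dots> \<le> kp i" using kp_ge[OF im] zero_le_power2[of K] by linarith
  finally have k2: "2 * (real (card S) + 1)^2 / NN \<le> kp i" .
  have "2 * (real i + 1) \<le> 2 * (T * K)" using ii by simp
  also have "\<dots> \<le> T * T"
  proof -
    have "2 * K \<le> K ^ 1 * K ^ 1" using K by simp
    also have "\<dots> \<le> K ^ 20" using K1 power_increasing[of 2 20 K] by (simp add: power2_eq_square)
    finally have "2 * K \<le> T" using T_big by linarith
    then have "T * (2 * K) \<le> T * T" using T1 by (intro mult_left_mono) auto
    then show ?thesis by simp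
  qed
  finally have "real_of_int (2 * (int (card S) + 1)) \<le> real_of_int NN"
    unfolding NN(1) cardS by (simp add: power2_eq_square)
  then have k3: "2 * (int (card S) + 1) \<le> NN" by (simp only: of_int_le_iff)
  have "\<exists>(lo::real) (hi::real). lo \<le> real (card S) * real (card Q) / NN \<and> real (card S) * real (card Q) / NN \<le> hi
      \<and> hi \<le> real (card S) * real (card Q) / NN + ub i + kp i \<and> hi - lo \<le> ub i + kp i
     \<and> (\<forall>g. active NN S g \<longrightarrow> lo \<le> cnt NN g S Q \<and> cnt NN g S Q \<le> hi)"
    using ub_pos[OF im] kp1 NN(2)
    by (intro cnt_bounds_by_average[OF _ valid _ k2 k3] goodD(2)[OF good]) auto
  then obtain lo hi :: real where lh: "lo \<le> c" "c \<le> hi" "hi \<le> c + ub i + kp i" "hi - lo \<le> ub i + kp i"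
     "\<And>g. active NN S g \<Longrightarrow> lo \<le> cnt NN g S Q \<and> cnt NN g S Q \<le> hi"
    unfolding NN(1) cardS c_def[symmetric] by blast
  have "good_state NN S Q lo hi (kp i) c"
  proof
    show "0 < NN" "valid_state NN S Q" using NN valid by auto
    show "real (overlap NN g h S) \<le> kp i" if "snd g \<in> {0..<NN}" "snd h \<in> {0..<NN}" "g \<noteq> h" for g h
      using that by (intro goodD(1)[OF good]) (auto simp: mem_Times_iff)
    show "0 \<le> c" by (simp add: c_def)
  qed (use lh in auto)
  moreover have "drift_numerics K T (P i) (ub i) (kp i) (real i) q c lo hi (wb i)"
    by (rule drift[OF im q_lower q_upper c_def lh(1-4)])
  ultimately show ?thesis by blast
qed

lemma W_le:
  assumes "snd g \<in> {1..<NN}" shows "real (cnt NN g Q Q) \<le> q^2 / T^2 + wb i + 2"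
proof -
  have "real (cnt NN g Q Q) \<le> q^2 / NN + wb i + 2"
    by (intro cnt_upper_by_average NN vD goodD(3)[OF good] assms)
  then show ?thesis unfolding NN(1) .
qed

lemma u_step:
  "(\<Sum>s\<in>Q. upot (Suc i) (insert s S) (Q - cl s) g h)
    \<le> q * (upot i S Q g h + exp (1 - lam * (1 / K ^ 4)))"
proof (cases "active NN S g \<and> active NN S h")
  case False
  then have "(\<Sum>s\<in>Q. upot (Suc i) (insert s S) (Q - cl s) g h) = 0"
    by (intro sum.neutral) (auto simp: upot_def dest: active_insert)
  then show ?thesis using pot_nonneg(2)[of i S Q g h] by simp
next
  case True
  then have gr: "snd g \<in> {1..<NN}" "snd h \<in> {1..<NN}" by (auto simp: active_def)
  obtain lo hi where gs: "good_state NN S Q lo hi (kp i) c"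
    and dn: "drift_numerics K T (P i) (ub i) (kp i) (real i) q c lo hi (wb i)" using bounds_ex by blast
  interpret gs: good_state NN S Q lo hi "kp i" c by (rule gs)
  interpret dn: drift_numerics K T "P i" "ub i" "kp i" "real i" q c lo hi "wb i" by (rule dn)
  define D where "D = real (cnt NN g S Q) - cnt NN h S Q"
  define X where "X = (2 * (q^2 / T^2 + wb i + 2) + 2 * (hi * (3 * hi + 4))) / q"
  define \<mu> where "\<mu> = - dn.th * D + (dn.th + 25 / 4 * dn.r) * ub i"
  have u': "ub (Suc i) = ub i * (1 + dn.r) ^ 8" by (simp add: ub_Suc r_def dn.r_def)
  \<comment> \<open>When s deactivates one of the maps the left term is 0, below any
    exponential.\<close>
  have "(\<Sum>s\<in>Q. upot (Suc i) (insert s S) (Q - cl s) g h)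
      \<le> (\<Sum>s\<in>Q. exp (lam * ((D + gs.dU g h s) / ub (Suc i) - 1)))"
    by (intro sum_mono) (auto simp: upot_def gs.dU_def D_def)
  also have "\<dots> \<le> q * (exp (lam * (D / ub i - 1)) + exp (1 - lam * (1 / K ^ 4)))"
  proof (rule potential_step)
    show "finite Q" "Q \<noteq> {}" using Q_ne by auto
    show "ub i > 0" "ub (Suc i) > 0" "lam > 0" using ub_pos i lam_pos by auto
    show "\<bar>D\<bar> \<le> ub i" using goodD(2)[OF good, of g h] goodD(2)[OF good, of h g] True
      by (simp add: D_def abs_le_iff)
    show "\<bar>gs.dU g h s\<bar> \<le> 3 * kp i + 5" if "s \<in> Q" for s by (rule gs.dU_bound[OF that])
    show "sum (gs.dU g h) Q \<le> q * \<mu>"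
    proof -
      let ?E = "wb i + hi * (3 * (hi - lo) + 3 * kp i + 4) + (kp i + 2) * (3 * c) + 4 * real i + 12 + 4 * hi"
      have "real (cnt NN g Q Q) - cnt NN h Q Q \<le> wb i"
        by (rule goodD(3)[OF good gr])
      then have "sum (gs.dU g h) Q \<le> - 3 * c * D + ?E"
        using gs.sum_dU[of g h] True unfolding D_def cardS by linarith
      also have "?E = q * (?E / q)" using q_pos by simp
      also have "\<dots> \<le> q * ((dn.th + 25 / 4 * dn.r) * ub i)"
        using dn.u_drift q_pos by (intro mult_left_mono) auto
      finally show ?thesis using dn.th(3) by (simp add: \<mu>_def algebra_simps)
    qed
    show "(\<Sum>s\<in>Q. (gs.dU g h s)^2) \<le> q * ((3 * kp i + 5) * X)"
    proof -
      have "(\<Sum>s\<in>Q. (gs.dU g h s)^2) \<le> (\<Sum>s\<in>Q. (3 * kp i + 5) * \<bar>gs.dU g h s\<bar>)"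
      proof (rule sum_mono)
        fix s assume "s \<in> Q"
        then have "\<bar>gs.dU g h s\<bar> * \<bar>gs.dU g h s\<bar> \<le> (3 * kp i + 5) * \<bar>gs.dU g h s\<bar>"
          by (intro mult_right_mono gs.dU_bound) auto
        then show "(gs.dU g h s)^2 \<le> (3 * kp i + 5) * \<bar>gs.dU g h s\<bar>" by (simp add: power2_eq_square)
      qed
      also have "\<dots> = (3 * kp i + 5) * (\<Sum>s\<in>Q. \<bar>gs.dU g h s\<bar>)" by (simp add: sum_distrib_left)
      also have "\<dots> \<le> (3 * kp i + 5) * (q * X)"
      proof (intro mult_left_mono)
        have "(\<Sum>s\<in>Q. \<bar>gs.dU g h s\<bar>) \<le> 2 * (q^2 / T^2 + wb i + 2) + 2 * (hi * (3 * hi + 4))"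
          using True by (intro gs.sum_abs_dU W_le gr) auto
        then show "(\<Sum>s\<in>Q. \<bar>gs.dU g h s\<bar>) \<le> q * X" using q_pos by (simp add: X_def)
      qed (use kp1 in simp)
      finally show ?thesis by (simp add: mult_ac)
    qed
    show "lam * ((3 * kp i + 5) / ub (Suc i) + \<bar>1 - ub i / ub (Suc i)\<bar>) \<le> 1"
      using dn.u_jump[OF u'] by (simp add: lam_def)
    show "\<mu> / ub (Suc i) - D / ub i * (1 - ub i / ub (Suc i))
        + lam * (2 * ((3 * kp i + 5) * X) / (ub (Suc i))^2 + 2 * (1 - ub i / ub (Suc i))^2) \<le> 0"
      if "D \<ge> (1 - 1 / K ^ 4) * ub i"
      unfolding lam_def by (rule dn.u_window[OF that u']) (simp_all add: \<mu>_def X_def)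
  qed
  also have "exp (lam * (D / ub i - 1)) = upot i S Q g h" using True by (simp add: upot_def D_def)
  finally show ?thesis .
qed

lemma w_step:
  assumes g: "g \<in> shifts 1" and h: "h \<in> shifts 1"
  shows "(\<Sum>s\<in>Q. wpot (Suc i) (Q - cl s) g h) \<le> q * (wpot i Q g h + exp (1 - lam * (1 / K ^ 4)))"
proof -
  have gr: "snd g \<in> {1..<NN}" "snd h \<in> {1..<NN}" using g h by auto
  obtain lo hi where gs: "good_state NN S Q lo hi (kp i) c"
    and dn: "drift_numerics K T (P i) (ub i) (kp i) (real i) q c lo hi (wb i)" using bounds_ex by blast
  interpret gs: good_state NN S Q lo hi "kp i" c by (rule gs)
  interpret dn: drift_numerics K T "P i" "ub i" "kp i" "real i" q c lo hi "wb i" by (rule dn)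
  define D where "D = real (cnt NN g Q Q) - cnt NN h Q Q"
  define WM where "WM = q^2 / T^2 + wb i + 2"
  define hM where "hM = 3 * hi + 4"
  define e where "e = 23 / 10 * (T + real i) / T^2 + dn.th / 50"
  define \<mu> where "\<mu> = - 2 * dn.th * D + e * wb i"
  have hM0: "hM \<ge> 0" using gs.hi0 by (simp add: hM_def)
  have WM: "real (cnt NN g Q Q) \<le> WM" "real (cnt NN h Q Q) \<le> WM" using W_le gr by (auto simp: WM_def)
  have w': "wb (Suc i) = wb i * ((1 - dn.th) * (1 + dn.r) ^ 7)"
    by (simp add: wb_Suc r_def th_def dn.r_def dn.th_def)
  have "(\<Sum>s\<in>Q. wpot (Suc i) (Q - cl s) g h) = (\<Sum>s\<in>Q. exp (lam * ((D + gs.dW g h s) / wb (Suc i) - 1)))"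
    by (simp add: wpot_def gs.dW_def D_def)
  also have "\<dots> \<le> q * (exp (lam * (D / wb i - 1)) + exp (1 - lam * (1 / K ^ 4)))"
  proof (rule potential_step)
    show "finite Q" "Q \<noteq> {}" using Q_ne by auto
    show "wb i > 0" "wb (Suc i) > 0" "lam > 0" using wb_pos i lam_pos by auto
    show "\<bar>D\<bar> \<le> wb i" using goodD(3)[OF good gr] goodD(3)[OF good gr(2,1)]
      by (simp add: D_def abs_le_iff)
    show "\<bar>gs.dW g h s\<bar> \<le> 2 * hM" if "s \<in> Q" for s unfolding hM_def by (rule gs.dW_bound[OF that])
    show "sum (gs.dW g h) Q \<le> q * \<mu>"
    proof -
      let ?E = "WM * (6 * (hi - lo) + 15 * kp i + 16) + (2 * hi + 8) * (6 * c)"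
      have "sum (gs.dW g h) Q \<le> - 6 * c * D + ?E"
        using gs.sum_dW[OF gr(1) WM] unfolding D_def by simp
      also have "?E = q * (?E / q)" using q_pos by simp
      also have "\<dots> \<le> q * (e * wb i)"
        using dn.w_drift q_pos unfolding e_def WM_def by (intro mult_left_mono) auto
      finally have "sum (gs.dW g h) Q \<le> - 2 * (3 * c) * D + q * (e * wb i)" by simp
      then show ?thesis unfolding dn.th(3) \<mu>_def by (simp add: algebra_simps)
    qed
    show "(\<Sum>s\<in>Q. (gs.dW g h s)^2) \<le> q * (2 * hM * (4 * hM * WM / q))"
    proof -
      have "(\<Sum>s\<in>Q. (gs.dW g h s)^2) \<le> (\<Sum>s\<in>Q. 2 * hM * \<bar>gs.dW g h s\<bar>)"
      proof (rule sum_mono)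
        fix s assume "s \<in> Q"
        then have "\<bar>gs.dW g h s\<bar> * \<bar>gs.dW g h s\<bar> \<le> 2 * hM * \<bar>gs.dW g h s\<bar>"
          unfolding hM_def by (intro mult_right_mono gs.dW_bound) auto
        then show "(gs.dW g h s)^2 \<le> 2 * hM * \<bar>gs.dW g h s\<bar>" by (simp add: power2_eq_square)
      qed
      also have "\<dots> = 2 * hM * (\<Sum>s\<in>Q. \<bar>gs.dW g h s\<bar>)" by (simp add: sum_distrib_left)
      also have "\<dots> \<le> 2 * hM * (4 * hM * WM)"
        using gs.sum_abs_dW[OF WM] hM0 unfolding hM_def by (intro mult_left_mono) auto
      finally show ?thesis using q_pos by simp
    qed
    show "lam * (2 * hM / wb (Suc i) + \<bar>1 - wb i / wb (Suc i)\<bar>) \<le> 1"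
      using dn.w_jump[OF w'] by (simp add: lam_def hM_def)
    show "\<mu> / wb (Suc i) - D / wb i * (1 - wb i / wb (Suc i))
        + lam * (2 * (2 * hM * (4 * hM * WM / q)) / (wb (Suc i))^2 + 2 * (1 - wb i / wb (Suc i))^2) \<le> 0"
      if "D \<ge> (1 - 1 / K ^ 4) * wb i"
      unfolding lam_def by (rule dn.w_window[OF that w']) (simp_all add: \<mu>_def e_def WM_def hM_def)
  qed
  also have "exp (lam * (D / wb i - 1)) = wpot i Q g h" by (simp add: wpot_def D_def)
  finally show ?thesis .
qed

text \<open>Only choices in \<open>B\<close> raise the overlap, by at most 3. The resulting factor 1
  + 26 |B| / q is absorbed by the rise of \<open>kp\<close>, so this family grows without an
  additive error.\<close>

lemma r_step:
  assumes g: "g \<in> shifts 0" and h: "h \<in> shifts 0"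
  shows "(\<Sum>s\<in>Q. rpot (Suc i) (insert s S) g h) \<le> q * rpot i S g h"
proof (cases "g = h")
  case True
  then show ?thesis by (simp add: rpot_def)
next
  case False
  define B where "B = {s \<in> Q. act NN g s \<in> act NN h ` S \<or> act NN h s \<in> act NN g ` S \<or> act NN g s = act NN h s}"
  have N0: "NN > 0" using NN by simp
  have cB: "real (card B) \<le> 2 * real i + 2"
    using card_overlap_increase[OF N0 vD(1,2) False] g h cardS unfolding B_def by (auto simp: mem_Times_iff)
  have e3: "exp 3 \<le> (27::real)"
  proof -
    have "exp 3 = exp (1::real) ^ 3" by (simp flip: exp_of_nat_mult)
    also have "\<dots> \<le> 3 ^ 3" using exp_le by (intro power_mono) auto
    finally show ?thesis by simp
  qed
  have pt: "rpot (Suc i) (insert s S) g h \<le> exp (real (overlap NN g h S) - kp (Suc i)) * (1 + 26 * of_bool (s \<in> B))"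
    if s: "s \<in> Q" for s
  proof -
    have sr: "s \<in> {0..<NN}" using s vD by auto
    have o: "overlap NN g h (insert s S) \<le> overlap NN g h S
      + (of_bool (act NN g s \<in> act NN h ` S) + of_bool (act NN h s \<in> act NN g ` S) + of_bool (act NN g s = act NN h s))"
      by (rule overlap_insert[OF N0 vD(1) sr])
    have "exp (real (overlap NN g h (insert s S)) - kp (Suc i))
        \<le> exp (real (overlap NN g h S) - kp (Suc i)) * exp (3 * of_bool (s \<in> B))"
    proof -
      have "overlap NN g h (insert s S) \<le> overlap NN g h S + 3 * of_bool (s \<in> B)"
        using o s by (auto simp: B_def of_bool_def split: if_splits)
      then have "real (overlap NN g h (insert s S)) \<le> real (overlap NN g h S) + 3 * of_bool (s \<in> B)"
        by (cases "s \<in> B") auto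
      then show ?thesis unfolding exp_add[symmetric] by simp
    qed
    also have "exp (3 * of_bool (s \<in> B)) \<le> (1 + 26 * of_bool (s \<in> B) :: real)"
      using e3 by (cases "s \<in> B") auto
    finally show ?thesis using False by (simp add: rpot_def)
  qed
  have "(\<Sum>s\<in>Q. rpot (Suc i) (insert s S) g h)
      \<le> (\<Sum>s\<in>Q. exp (real (overlap NN g h S) - kp (Suc i)) * (1 + 26 * of_bool (s \<in> B)))"
    by (intro sum_mono pt)
  also have "\<dots> = exp (real (overlap NN g h S) - kp (Suc i)) * (q + 26 * real (card B))"
  proof -
    have "Q \<inter> B = B" by (auto simp: B_def)
    then have "(\<Sum>s\<in>Q. 1 + 26 * of_bool (s \<in> B)) = q + 26 * real (card B)"
      using vD(5) by (simp add: sum.distrib flip: sum_distrib_left)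
    then show ?thesis by (simp flip: sum_distrib_left)
  qed
  also have "\<dots> \<le> exp (real (overlap NN g h S) - kp (Suc i)) * (q * exp (kp (Suc i) - kp i))"
  proof (intro mult_left_mono)
    have "q + 26 * real (card B) \<le> q + 52 * (real i + 1)" using cB by simp
    also have "\<dots> = q * (1 + 52 * (real i + 1) / q)" using q_pos by (simp add: field_simps)
    also have "\<dots> \<le> q * exp (52 * (real i + 1) / q)" using q_pos by (intro mult_left_mono exp_ge_add_one_self) auto
    also have "\<dots> \<le> q * exp (kp (Suc i) - kp i)"
      using kp_increment[OF i q_lower] q_pos by (intro mult_left_mono) auto
    finally show "q + 26 * real (card B) \<le> q * exp (kp (Suc i) - kp i)" .
  qed auto
  also have "\<dots> = q * rpot i S g h" using False by (simp add: rpot_def mult.left_commute flip: exp_add)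
  finally show ?thesis .
qed

text \<open>The size of Q is followed deterministically: within the bounds an unexceptional choice
  closes 3 c = th q elements up to 4 u + 2 kap. An exceptional one may close almost nothing, but it
  raises \<open>R0\<close>, and the extra 5 m exceeds the decrease that failed to happen.\<close>

lemma tracked_step:
  assumes s: "s \<in> Q" shows "tracked (Suc i) (insert s S) (Q - cl s)"
proof -
  obtain lo hi where gs: "good_state NN S Q lo hi (kp i) c"
    and dn: "drift_numerics K T (P i) (ub i) (kp i) (real i) q c lo hi (wb i)" using bounds_ex by blast
  interpret gs: good_state NN S Q lo hi "kp i" c by (rule gs)
  interpret dn: drift_numerics K T "P i" "ub i" "kp i" "real i" q c lo hi "wb i" by (rule dn)
  have sS: "s \<notin> S" using vD s by auto
  have q': "real (card (Q - cl s)) = q - real (card (cl s))"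
    using Q_ne by (intro real_card_Diff) (auto simp: closed_by_def)
  have P': "P (Suc i) = P i * (1 - th i)" by (rule P_Suc)
  have P'0: "P (Suc i) > 0" using P_pos[of "Suc i"] i by simp
  have cth: "3 * c = th i * q" using dn.th(3) by (simp add: dn.th_def th_def)
  have t1: "1 - th i > 0" "th i \<ge> 0" using th_le[OF im] th0 by auto
  have inc: "4 * ub i + 2 * kp i \<le> P (Suc i) * (er (Suc i) - er i)" by (rule er_increment[OF i])
  have ku: "1000 * kp i \<le> ub i" by (rule dn.kap_u)
  have "P (Suc i) * (T^2 - 1 - er (Suc i)) \<le> q - real (card (cl s))"
  proof -
    have "(1 - th i) * (P i * (T^2 - 1 - er i)) \<le> (1 - th i) * q"
      using tracked t1 by (intro mult_left_mono) (auto simp: tracked_def)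
    moreover have "real (card (cl s)) \<le> 3 * hi + 4" by (rule gs.card_cl_le[OF s])
    moreover have "3 * hi + 4 \<le> 3 * c + (4 * ub i + 2 * kp i)" using dn.c(4) ku kp1 by simp
    ultimately show ?thesis using inc cth unfolding P' by (simp add: algebra_simps)
  qed
  moreover have "q - real (card (cl s)) \<le> P (Suc i) * (T^2 + er (Suc i) + 5 * real m * R0 (insert s S))"
  proof (cases "exceptional NN S s")
    case False
    have R: "R0 S \<le> R0 (insert s S)"
      unfolding overlap_def using vD(4) by (intro of_nat_mono card_mono) auto
    have "(1 - th i) * q \<le> (1 - th i) * (P i * (T^2 + er i + 5 * real m * R0 S))"
      using tracked t1 by (intro mult_left_mono) (auto simp: tracked_def)
    then have "(1 - th i) * q \<le> P (Suc i) * (T^2 + er i + 5 * real m * R0 S)" by (simp add: P' mult_ac)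
    also have "\<dots> \<le> P (Suc i) * (T^2 + er i + 5 * real m * R0 (insert s S))"
      using R P'0 by (intro mult_left_mono add_left_mono) auto
    finally have a: "(1 - th i) * q \<le> P (Suc i) * (T^2 + er i + 5 * real m * R0 (insert s S))" .
    have "3 * lo - 3 * kp i \<le> real (card (cl s))" by (rule gs.card_cl_ge[OF s False])
    moreover have "3 * c - (3 * lo - 3 * kp i) \<le> 4 * ub i + 2 * kp i" using dn.c(3,5) ku kp1 by simp
    ultimately have "q - real (card (cl s)) \<le> (1 - th i) * q + (4 * ub i + 2 * kp i)"
      using cth by (simp add: left_diff_distrib)
    also have "\<dots> \<le> P (Suc i) * (T^2 + er i + 5 * real m * R0 (insert s S)) + P (Suc i) * (er (Suc i) - er i)"
      using a inc by (intro add_mono)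
    finally show ?thesis by (simp add: algebra_simps)
  next
    case True
    have R: "R0 S + 1 \<le> R0 (insert s S)"
    proof -
      let ?I = "\<lambda>X. act NN (True, 0) ` X \<inter> act NN (False, 0) ` X"
      have sr: "s \<in> {0..<NN}" using s vD by auto
      have a: "act NN (True, 0) s = s" using sr by (simp add: act_def)
      have "s = act NN (False, 0) ((- s) mod NN)" using sr by (simp add: act_def mod_simps)
      then have sI: "s \<in> ?I (insert s S)" using True a unfolding exceptional_def
        by (metis IntI imageI insertI1)
      have id: "act NN (True, 0) ` S = S"
      proof -
        have "act NN (True, 0) x = x" if "x \<in> S" for x using vD(1) that by (auto simp: act_def)
        then show ?thesis by force
      qed
      then have "s \<notin> ?I S" using sS by auto
      moreover have "finite (?I S)" using vD by auto
      ultimately have "card (insert s (?I S)) = Suc (card (?I S))" by simp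
      moreover have "card (insert s (?I S)) \<le> card (?I (insert s S))"
      proof (rule card_mono)
        show "finite (?I (insert s S))" using vD by auto
        have "?I S \<subseteq> ?I (insert s S)" by auto
        then show "insert s (?I S) \<subseteq> ?I (insert s S)" using sI by blast
      qed
      ultimately show ?thesis unfolding overlap_def by linarith
    qed
    let ?A = "T^2 + er i + 5 * real m * R0 S"
    have A: "?A \<le> 3 / 2 * T^2" by (rule q_slack)
    have "q - real (card (cl s)) \<le> P i * ?A" using tracked by (simp add: tracked_def)
    also have "\<dots> = P (Suc i) * ?A + P i * (th i * ?A)" by (simp add: P' algebra_simps)
    \<comment> \<open>The missing decrease is th times at most 3/2 T^2, that is 9/2 i, and this
      stays below 5 m even after the factor 1 - th.\<close>
    also have "P i * (th i * ?A) \<le> P i * (9 / 2 * real i)"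
    proof (intro mult_left_mono)
      have "th i * ?A \<le> th i * (3 / 2 * T^2)" using A t1 by (intro mult_left_mono) auto
      also have "\<dots> = 9 / 2 * real i" using T1 by (simp add: th_def)
      finally show "th i * ?A \<le> 9 / 2 * real i" .
    qed (use Pp in simp)
    also have "\<dots> \<le> P i * ((1 - th i) * (5 * real m))"
    proof (intro mult_left_mono)
      have "9 / 2 * real i \<le> 9 / 10 * (5 * real m)" using i by simp
      also have "\<dots> \<le> (1 - th i) * (5 * real m)" using th_le[OF im] by (intro mult_right_mono) auto
      finally show "9 / 2 * real i \<le> (1 - th i) * (5 * real m)" .
    qed (use Pp in simp)
    finally have "q - real (card (cl s)) \<le> P (Suc i) * (?A + 5 * real m)" by (simp add: P' algebra_simps)
    also have "\<dots> \<le> P (Suc i) * (T^2 + er (Suc i) + 5 * real m * R0 (insert s S))"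
    proof (intro mult_left_mono)
      have "5 * real m * (R0 S + 1) \<le> 5 * real m * R0 (insert s S)" using R by (intro mult_left_mono) auto
      moreover have "er i \<le> er (Suc i)" unfolding er_def by (intro divide_right_mono mult_right_mono) auto
      ultimately show "?A + 5 * real m \<le> T^2 + er (Suc i) + 5 * real m * R0 (insert s S)"
        by (simp add: distrib_left)
    qed (use P'0 in simp)
    finally show ?thesis .
  qed
  moreover have "valid_state NN (insert s S) (Q - cl s)" by (rule valid_state_step[OF valid s])
  moreover have "card (insert s S) = Suc i" using sS vD cardS by simp
  ultimately show ?thesis unfolding tracked_def q' by simp
qed

lemma pot_step: "(\<Sum>s\<in>Q. pot (Suc i) (insert s S) (Q - cl s)) \<le> q * (pot i S Q + eps)"
proof -
  let ?e = "exp (1 - lam * (1 / K ^ 4))"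
  have fin: "finite (shifts a)" for a by simp
  have swap: "(\<Sum>s\<in>Q. \<Sum>g\<in>A. \<Sum>h\<in>A. f s g h) = (\<Sum>g\<in>A. \<Sum>h\<in>A. \<Sum>s\<in>Q. f s g h)" for A and f :: "int \<Rightarrow> bool \<times> int \<Rightarrow> bool \<times> int \<Rightarrow> real"
    by (subst sum.swap, rule sum.cong[OF refl], rule sum.swap)
  have c1: "real (card (shifts 1)) * (real (card (shifts 1)) * ?e) \<le> 16 * (real n)^2 * ?e"
  proof -
    have "card (shifts 1) \<le> 4 * n" by (simp add: card_cartesian_product)
    then have "real (card (shifts 1)) \<le> 4 * real n" by linarith
    then have "real (card (shifts 1)) * real (card (shifts 1)) \<le> (4 * real n) * (4 * real n)" by (intro mult_mono) auto
    then have "(real (card (shifts 1)) * real (card (shifts 1))) * ?e \<le> (4 * real n) * (4 * real n) * ?e"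
      by (intro mult_right_mono) auto
    then show ?thesis by (simp add: power2_eq_square mult_ac)
  qed
  have "(\<Sum>s\<in>Q. pot (Suc i) (insert s S) (Q - cl s))
     = (\<Sum>g\<in>shifts 0. \<Sum>h\<in>shifts 0. \<Sum>s\<in>Q. rpot (Suc i) (insert s S) g h)
     + (\<Sum>g\<in>shifts 1. \<Sum>h\<in>shifts 1. \<Sum>s\<in>Q. upot (Suc i) (insert s S) (Q - cl s) g h)
     + (\<Sum>g\<in>shifts 1. \<Sum>h\<in>shifts 1. \<Sum>s\<in>Q. wpot (Suc i) (Q - cl s) g h)"
    unfolding pot_def sum.distrib swap ..
  also have "\<dots> \<le> (\<Sum>g\<in>shifts 0. \<Sum>h\<in>shifts 0. q * rpot i S g h)
     + (\<Sum>g\<in>shifts 1. \<Sum>h\<in>shifts 1. q * (upot i S Q g h + ?e))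
     + (\<Sum>g\<in>shifts 1. \<Sum>h\<in>shifts 1. q * (wpot i Q g h + ?e))"
    by (intro add_mono sum_mono r_step u_step w_step)
  also have "\<dots> = q * (pot i S Q + 2 * (real (card (shifts 1)) * (real (card (shifts 1)) * ?e)))"
    by (simp only: pot_def sum_distrib_left[symmetric] sum.distrib sum_constant) (simp add: algebra_simps)
  also have "\<dots> \<le> q * (pot i S Q + eps)"
    using c1 by (intro mult_left_mono add_left_mono) (auto simp: eps_def)
  finally show ?thesis .
qed

end

subsection \<open>The process\<close>

lemma expectation_bind_finite:
  fixes h :: "'b \<Rightarrow> real"
  assumes "finite (set_pmf p)" "\<And>x. x \<in> set_pmf p \<Longrightarrow> finite (set_pmf (f x))"
  shows "measure_pmf.expectation (bind_pmf p f) h = measure_pmf.expectation p (\<lambda>x. measure_pmf.expectation (f x) h)"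
proof -
  have "measure_pmf.expectation (bind_pmf p f) h = (\<Sum>a\<in>set_pmf p. pmf p a *\<^sub>R measure_pmf.expectation (f a) h)"
    using assms by (intro pmf_expectation_bind) auto
  also have "\<dots> = measure_pmf.expectation p (\<lambda>x. measure_pmf.expectation (f x) h)"
    using assms(1) by (subst integral_measure_pmf[of "set_pmf p"]) auto
  finally show ?thesis .
qed

lemma sf_step_finite: "finite Q \<Longrightarrow> finite (set_pmf (sf_step R (S, Q)))"
  by (auto simp: sf_step_def)

lemma sf_process_support:
  assumes "finite (carrier R)"
  shows "finite (set_pmf (sf_process R i))"
    and "st \<in> set_pmf (sf_process R i) \<Longrightarrow> finite (fst st) \<and> finite (snd st)"
proof -
  have sub: "S \<subseteq> carrier R \<and> Q \<subseteq> carrier R" if "(S, Q) \<in> set_pmf (sf_process R i)" for S Q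
    using sf_process_invariant[OF assms that] by blast
  have "set_pmf (sf_process R i) \<subseteq> Pow (carrier R) \<times> Pow (carrier R)" using sub by force
  then show "finite (set_pmf (sf_process R i))" using assms by (meson finite_Pow_iff finite_SigmaI finite_subset)
  show "st \<in> set_pmf (sf_process R i) \<Longrightarrow> finite (fst st) \<and> finite (snd st)"
    using sub[of "fst st" "snd st"] assms finite_subset by (metis prod.collapse)
qed

lemma sf_process_expectation_Suc:
  fixes f :: "'a set \<times> 'a set \<Rightarrow> real"
  assumes "finite (carrier R)"
  shows "measure_pmf.expectation (sf_process R (Suc i)) f
     = measure_pmf.expectation (sf_process R i) (\<lambda>st. measure_pmf.expectation (sf_step R st) f)"
  unfolding sf_process.simps
  by (intro expectation_bind_finite sf_process_support(1) assms)
     (metis sf_process_support(2)[OF assms] sf_step_finite prod.collapse)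

lemma expectation_mono_finite:
  fixes f g :: "'a \<Rightarrow> real"
  assumes "finite (set_pmf p)" "\<And>x. x \<in> set_pmf p \<Longrightarrow> f x \<le> g x"
  shows "measure_pmf.expectation p f \<le> measure_pmf.expectation p g"
  using assms by (intro integral_mono_AE integrable_measure_pmf_finite AE_pmfI) auto

lemma expectation_sf_step:
  fixes f :: "'a set \<times> 'a set \<Rightarrow> real"
  assumes "finite Q" "Q \<noteq> {}"
  shows "measure_pmf.expectation (sf_step R (S, Q)) f
    = (\<Sum>s\<in>Q. f (insert s S, open_elements R (insert s S))) / card Q"
  using assms by (simp add: sf_step_def integral_pmf_of_set)

text \<open>The chosen set never shrinks, so being smaller than m can only become less likely with
  time; and a state at time m that still has open elements has exactly m chosen ones.\<close>

lemma sf_final_small: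
  assumes fin: "finite (carrier R)" and m: "m \<le> card (carrier R)"
  shows "measure_pmf.prob (sf_final R) {S. card S < m} \<le> measure_pmf.prob (sf_process R m) {st. snd st = {}}"
proof -
  let ?f = "\<lambda>st :: 'a set \<times> 'a set. indicator {st. card (fst st) < m} st :: real"
  have step: "measure_pmf.expectation (sf_process R (Suc i)) ?f \<le> measure_pmf.expectation (sf_process R i) ?f" for i
    unfolding sf_process_expectation_Suc[OF fin]
  proof (intro expectation_mono_finite sf_process_support(1) fin)
    fix st assume st: "st \<in> set_pmf (sf_process R i)"
    obtain S Q where SQ: "st = (S, Q)" by (cases st)
    have fs: "finite S" "finite Q" using sf_process_support(2)[OF fin st] SQ by auto
    show "measure_pmf.expectation (sf_step R st) ?f \<le> ?f st"
    proof (cases "Q = {}")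
      case True then show ?thesis by (simp add: SQ sf_step_def)
    next
      case False
      have "(\<Sum>s\<in>Q. ?f (insert s S, open_elements R (insert s S))) \<le> (\<Sum>s\<in>Q. ?f st)"
        using fs by (intro sum_mono) (auto simp: SQ indicator_def card_insert_if split: if_splits)
      then show ?thesis unfolding SQ expectation_sf_step[OF fs(2) False]
        using fs False by (simp add: divide_le_eq card_gt_0_iff mult.commute)
    qed
  qed
  have dec: "measure_pmf.expectation (sf_process R (m + k)) ?f \<le> measure_pmf.expectation (sf_process R m) ?f" for k
  proof (induction k)
    case (Suc k) then show ?case using step[of "m + k"] by simp
  qed simp
  have "measure_pmf.prob (sf_final R) {S. card S < m}
      = measure_pmf.prob (sf_process R (m + (card (carrier R) - m))) {st. card (fst st) < m}"
    using m by (simp add: sf_final_def vimage_def)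
  also have "\<dots> = measure_pmf.expectation (sf_process R (m + (card (carrier R) - m))) ?f" by simp
  also have "\<dots> \<le> measure_pmf.expectation (sf_process R m) ?f" by (rule dec)
  also have "\<dots> \<le> measure_pmf.expectation (sf_process R m) (indicator {st. snd st = {}})"
  proof (intro expectation_mono_finite sf_process_support(1) fin)
    fix st assume "st \<in> set_pmf (sf_process R m)"
    then have "snd st = {} \<or> card (fst st) = m"
      using sf_process_invariant[OF fin, of "fst st" "snd st" m] by auto
    then show "?f st \<le> indicator {st. snd st = {}} st" by (auto simp: indicator_def)
  qed
  finally show ?thesis by simp
qed

lemma sum_free_Z2n: "sum_free (Z2n n) S \<longleftrightarrow> mod_sum_free (2 * int n) S"
  by (auto simp: sum_free_def mod_sum_free_def residue_ring_def)

lemma carrier_Z2n: "carrier (Z2n n) = {0..<2 * int n}"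
  by (auto simp: residue_ring_def)

lemma open_elements_valid_state:
  assumes "valid_state (2 * int n) S Q" shows "open_elements (Z2n n) S = Q"
  using assms by (simp add: open_elements_def valid_state_def sum_free_Z2n carrier_Z2n)

context trajectory
begin

abbreviation "Q0 \<equiv> {1..<NN}"

text \<open>The probability that the process started from \<open>st\<close> has no open element
  after k further steps.\<close>

primrec dead :: "nat \<Rightarrow> int set \<times> int set \<Rightarrow> real" where
  "dead 0 st = indicator {st. snd st = {}} st"
| "dead (Suc k) st = measure_pmf.expectation (sf_step (Z2n n) st) (dead k)"

lemma fin: "finite (carrier (Z2n n))" by (simp add: carrier_Z2n)

lemma expectation_dead:
  "measure_pmf.expectation (sf_process (Z2n n) (i + k)) (dead 0) = measure_pmf.expectation (sf_process (Z2n n) i) (dead k)"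
proof (induction k arbitrary: i)
  case (Suc k)
  have "measure_pmf.expectation (sf_process (Z2n n) (i + Suc k)) (dead 0)
      = measure_pmf.expectation (sf_process (Z2n n) (Suc i + k)) (dead 0)" by simp
  also have "\<dots> = measure_pmf.expectation (sf_process (Z2n n) (Suc i)) (dead k)" by (rule Suc)
  also have "\<dots> = measure_pmf.expectation (sf_process (Z2n n) i) (dead (Suc k))"
  proof -
    have "dead (Suc k) = (\<lambda>st. measure_pmf.expectation (sf_step (Z2n n) st) (dead k))"
      by (rule ext) simp
    then show ?thesis by (simp only: sf_process_expectation_Suc[OF fin])
  qed
  finally show ?case .
qed simp

lemma dead_le_1: "finite (snd st) \<Longrightarrow> finite (fst st) \<Longrightarrow> snd st \<subseteq> carrier (Z2n n) \<Longrightarrow> dead k st \<le> 1"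
proof (induction k arbitrary: st)
  case 0 then show ?case by (simp add: indicator_def)
next
  case (Suc k)
  obtain S Q where st: "st = (S, Q)" by (cases st)
  show ?case
  proof (cases "Q = {}")
    case True
    then show ?thesis using Suc by (simp add: st sf_step_def)
  next
    case False
    have "(\<Sum>s\<in>Q. dead k (insert s S, open_elements (Z2n n) (insert s S))) \<le> (\<Sum>s\<in>Q. 1)"
      using Suc.prems fin finite_subset[of "open_elements (Z2n n) _" "carrier (Z2n n)"]
      by (intro sum_mono Suc.IH) (auto simp: st open_elements_def)
    then show ?thesis using False Suc.prems by (simp add: st expectation_sf_step divide_le_eq card_gt_0_iff)
  qed
qed

text \<open>A case split replaces the stopping time. Outside the bounds the potential is at least 1
  and dominates any probability, so the future of such a state is irrelevant; inside them all
  successors are tracked and the induction goes on. After m steps a tracked state still has open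
  elements.\<close>

lemma dead_le_pot:
  assumes "tracked i S Q" "i + k = m"
  shows "dead k (S, Q) \<le> pot i S Q + real k * eps"
  using assms
proof (induction k arbitrary: i S Q)
  case 0
  then have i: "i = m" and pm: "P m > 0" using P_pos[of m] by auto
  have "er m \<le> T^2 / 4" by (simp add: er_def)
  moreover have "10 ^ 8 * 1 \<le> T * T" using T1 K by (intro mult_mono) auto
  ultimately have "0 < T^2 - 1 - er m" by (simp add: power2_eq_square)
  then have "0 < P m * (T^2 - 1 - er m)" using pm by simp
  moreover have "P m * (T^2 - 1 - er m) \<le> real (card Q)" using 0(1) i by (simp add: tracked_def)
  ultimately have "real (card Q) > 0" by linarith
  then have "Q \<noteq> {}" by auto
  then show ?case using pot_nonneg' by simp
next
  case (Suc k)
  have eps0: "eps \<ge> 0" by (simp add: eps_def)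
  have v: "valid_state NN S Q" using Suc.prems by (simp add: tracked_def)
  note vD = valid_stateD[OF v]
  show ?case
  proof (cases "good i S Q")
    case False
    have "1 \<le> pot i S Q" using Suc.prems False by (intro bad_pot) auto
    moreover have "dead (Suc k) (S, Q) \<le> 1" using vD by (intro dead_le_1) (auto simp: carrier_Z2n)
    ultimately show ?thesis using mult_nonneg_nonneg[OF of_nat_0_le_iff eps0, of "Suc k"] by linarith
  next
    case True
    interpret trajectory_step n m K Y i S Q
      using Suc.prems True by unfold_locales auto
    have op: "open_elements (Z2n n) (insert s S) = Q - cl s" if "s \<in> Q" for s
      using tracked_step[OF that] by (intro open_elements_valid_state) (simp add: tracked_def)
    have "dead (Suc k) (S, Q) = (\<Sum>s\<in>Q. dead k (insert s S, open_elements (Z2n n) (insert s S))) / q"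
      using Q_ne by (simp add: expectation_sf_step)
    also have "\<dots> = (\<Sum>s\<in>Q. dead k (insert s S, Q - cl s)) / q" by (simp add: op)
    also have "\<dots> \<le> (\<Sum>s\<in>Q. pot (Suc i) (insert s S) (Q - cl s) + real k * eps) / q"
      using Suc.prems by (intro divide_right_mono sum_mono Suc.IH tracked_step) auto
    also have "\<dots> = (\<Sum>s\<in>Q. pot (Suc i) (insert s S) (Q - cl s)) / q + real k * eps"
      using q_pos by (simp add: sum.distrib add_divide_distrib)
    also have "\<dots> \<le> (q * (pot i S Q + eps)) / q + real k * eps"
      using pot_step by (intro add_right_mono divide_right_mono) auto
    also have "\<dots> = pot i S Q + real (Suc k) * eps" using q_pos by (simp add: distrib_right)
    finally show ?thesis .
  qed
qed

lemma valid_initial: "valid_state NN {} Q0"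
proof -
  have "mod_sum_free NN {x} \<longleftrightarrow> x \<noteq> 0" if "x \<in> {0..<NN}" for x
  proof -
    have "(x + x) mod NN = x \<longleftrightarrow> (x + x) mod NN = x mod NN" using that by simp
    also have "\<dots> \<longleftrightarrow> NN dvd x" unfolding mod_eq_dvd_iff by simp
    also have "\<dots> \<longleftrightarrow> x = 0" using that zdvd_not_zless[of x NN] by fastforce
    finally show ?thesis by (simp add: mod_sum_free_def)
  qed
  then show ?thesis by (auto simp: valid_state_def mod_sum_free_def)
qed

lemma tracked_initial: "tracked 0 {} Q0"
proof -
  have "real (card Q0) = T^2 - 1" using NN by (simp add: T_sq of_nat_diff)
  then show ?thesis using valid_initial by (simp add: tracked_def P_0 er_def overlap_def)
qed

text \<open>The image of the nonzero residues omits the shift alone, so all pair counts agree and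
  every initial difference is 0.\<close>

lemma cnt_initial: "g \<in> shifts 1 \<Longrightarrow> cnt NN g Q0 Q0 = card Q0 - 1"
proof -
  assume g: "g \<in> shifts 1"
  have N0: "NN > 0" using NN by simp
  have im: "act NN g ` {0..<NN} = {0..<NN}"
    using act_inj[of NN g] act_range[OF N0, of g] by (intro endo_inj_surj) auto
  have g0: "act NN g 0 = snd g" using g by (auto simp: act_def)
  have Q0: "Q0 = {0..<NN} - {0}" by auto
  have "act NN g ` ({0..<NN} - {0}) = act NN g ` {0..<NN} - act NN g ` {0}"
    using N0 by (intro inj_on_image_set_diff[OF act_inj[of NN g]]) auto
  then have "act NN g ` Q0 = {0..<NN} - {snd g}" unfolding Q0[symmetric] im by (simp add: g0)
  then have "cnt NN g Q0 Q0 = card (({0..<NN} - {snd g}) \<inter> Q0)"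
    using cnt_eq_card_image[of Q0 NN g Q0] by simp
  also have "({0..<NN} - {snd g}) \<inter> Q0 = Q0 - {snd g}" by auto
  also have "card \<dots> = card Q0 - 1" using g by (intro card_Diff_singleton) auto
  finally show ?thesis .
qed

lemma pot_initial: "pot 0 {} Q0 \<le> 16 * (real n)^2 * (exp (- 10 * K^2) + 2 * exp (- lam))"
proof -
  have k0: "kp 0 = 10 * K^2" by (simp add: kp_def P_0)
  have r: "rpot 0 {} g h \<le> exp (- 10 * K^2)" for g h by (simp add: rpot_def overlap_def k0)
  have u: "upot 0 {} Q0 g h \<le> exp (- lam)" for g h by (simp add: upot_def cnt_def)
  have w: "wpot 0 Q0 g h \<le> exp (- lam)" if "g \<in> shifts 1" "h \<in> shifts 1" for g h
    using that by (simp add: wpot_def cnt_initial)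
  have c: "real (card (shifts a)) \<le> 4 * real n" if "a \<ge> 0" for a
  proof -
    have "card (shifts a) \<le> 4 * n" using that by (simp add: card_cartesian_product)
    then show ?thesis by linarith
  qed
  have ds: "(\<Sum>g\<in>shifts a. \<Sum>h\<in>shifts a. f g h) \<le> 16 * (real n)^2 * e"
    if a: "a \<ge> 0" and e: "e \<ge> 0" and f: "\<And>g h. g \<in> shifts a \<Longrightarrow> h \<in> shifts a \<Longrightarrow> f g h \<le> e" for a e f
  proof -
    have "(\<Sum>g\<in>shifts a. \<Sum>h\<in>shifts a. f g h) \<le> (\<Sum>g\<in>shifts a. \<Sum>h\<in>shifts a. e)"
      by (intro sum_mono f)
    also have "\<dots> = real (card (shifts a)) * real (card (shifts a)) * e" by simp
    also have "\<dots> \<le> (4 * real n) * (4 * real n) * e" using c[OF a] e by (intro mult_right_mono mult_mono) auto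
    finally show ?thesis by (simp add: power2_eq_square)
  qed
  have "pot 0 {} Q0 \<le> 16 * (real n)^2 * exp (- 10 * K^2) + 16 * (real n)^2 * exp (- lam) + 16 * (real n)^2 * exp (- lam)"
    unfolding pot_def by (intro add_mono ds r u w) auto
  then show ?thesis by (simp add: algebra_simps)
qed

lemma m_le: "m \<le> 2 * n"
proof -
  have "real m \<le> T * K" using i_le(2)[of m] by simp
  also have "\<dots> \<le> T * T" using T1 by (intro mult_left_mono) auto
  also have "\<dots> = 2 * real n" using T_sq by (simp add: power2_eq_square)
  finally show ?thesis by linarith
qed

lemma small_final_prob:
  "measure_pmf.prob (sf_final (Z2n n)) {S. card S < m}
    \<le> 16 * (real n)^2 * (exp (- 10 * K^2) + 2 * exp (- lam)) + 2 * real n * eps"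
proof -
  have "measure_pmf.prob (sf_final (Z2n n)) {S. card S < m} \<le> measure_pmf.prob (sf_process (Z2n n) m) {st. snd st = {}}"
    using m_le by (intro sf_final_small fin) (simp add: carrier_Z2n)
  also have "\<dots> = measure_pmf.expectation (sf_process (Z2n n) m) (dead 0)"
  proof -
    have "dead 0 = indicator {st. snd st = {}}" by (rule ext) simp
    then show ?thesis by simp
  qed
  also have "\<dots> = measure_pmf.expectation (sf_process (Z2n n) 0) (dead m)"
    using expectation_dead[of 0 m] by simp
  also have "\<dots> = dead m ({}, Q0)"
  proof -
    have "carrier (Z2n n) - {\<zero>\<^bsub>Z2n n\<^esub>} = Q0" by (auto simp: carrier_Z2n residue_ring_def)
    then show ?thesis by simp
  qed
  also have "\<dots> \<le> pot 0 {} Q0 + real m * eps" by (intro dead_le_pot tracked_initial) simp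
  also have "\<dots> \<le> 16 * (real n)^2 * (exp (- 10 * K^2) + 2 * exp (- lam)) + 2 * real n * eps"
    using m_le by (intro add_mono pot_initial mult_right_mono) (auto simp: eps_def)
  finally show ?thesis .
qed

end

section \<open>The number of steps and the final estimate\<close>

lemma prod_one_minus_ge:
  fixes N :: real
  assumes N: "N > 0" and m: "6 * real m \<le> N"
  shows "exp (- (3 * real m * (real m - 1) / (2 * N)) - 18 * real m ^ 3 / N^2) \<le> (\<Prod>j<m. 1 - 3 * real j / N)"
proof -
  let ?x = "\<lambda>j. 3 * real j / N"
  have x: "0 \<le> ?x j" "?x j \<le> 1 / 2" if "j < m" for j using that m N by (auto simp: divide_le_eq)
  have gauss: "(\<Sum>j<k. real j) = real k * (real k - 1) / 2" for k
    by (induction k) (auto simp: field_simps)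
  have "(\<Sum>j<m. ?x j) = 3 * real m * (real m - 1) / (2 * N)"
    by (simp add: gauss flip: sum_divide_distrib sum_distrib_left)
  moreover have "(\<Sum>j<m. 2 * (?x j)^2) \<le> 18 * real m ^ 3 / N^2"
  proof -
    have "(\<Sum>j<m. 2 * (?x j)^2) \<le> (\<Sum>j<m. 18 * (real m)^2 / N^2)"
    proof (rule sum_mono)
      fix j assume "j \<in> {..<m}"
      then have "(real j)^2 \<le> (real m)^2" by (intro power_mono) auto
      then show "2 * (?x j)^2 \<le> 18 * (real m)^2 / N^2"
        by (simp add: power_divide power_mult_distrib divide_right_mono)
    qed
    then show ?thesis by (simp add: power3_eq_cube power2_eq_square mult_ac)
  qed
  ultimately have "- (3 * real m * (real m - 1) / (2 * N)) - 18 * real m ^ 3 / N^2 \<le> (\<Sum>j<m. - ?x j - 2 * (?x j)^2)"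
    by (simp add: sum_subtractf sum_negf)
  \<comment> \<open>The bound - x - 2 x^2 for ln (1 - x) is used up to x = 1/2, which 6 m \<le> N
    secures.\<close>
  also have "\<dots> \<le> (\<Sum>j<m. ln (1 - ?x j))" using x by (intro sum_mono ln_one_minus_pos_lower_bound) auto
  finally have "exp (- (3 * real m * (real m - 1) / (2 * N)) - 18 * real m ^ 3 / N^2) \<le> exp (\<Sum>j<m. ln (1 - ?x j))" by simp
  also have "\<dots> = (\<Prod>j<m. exp (ln (1 - ?x j)))" by (simp add: exp_sum)
  also have "\<dots> = (\<Prod>j<m. 1 - ?x j)" using x by (intro prod.cong refl exp_ln) (smt (verit) lessThan_iff field_sum_of_halves)
  finally show ?thesis .
qed

definition target :: "nat \<Rightarrow> real" where
  "target n = 1 / sqrt 3 * (1 - 20 * (ln (ln (real n)) / ln (real n))) * sqrt (real n) * sqrt (ln (real n))"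

text \<open>Asking for log n \<ge> 10^16 is what permits crude numerical constants
  throughout.\<close>

lemma parameter_asymptotics:
  "eventually (\<lambda>n::nat. 10 ^ 16 \<le> ln (real n)) at_top"
  "eventually (\<lambda>n::nat. ln (real n) ^ 5 \<le> (2 * real n) powr (1 / 4)) at_top"
  "eventually (\<lambda>n::nat. 20 * ln (ln (real n)) \<le> ln (real n)) at_top"
  "eventually (\<lambda>n::nat. 6 * (sqrt (real n) * sqrt (ln (real n)) + 1) \<le> 2 * real n) at_top"
  "eventually (\<lambda>n::nat. 100 * (ln (ln (real n)))^2 / ln (real n)
      + (sqrt (ln (real n)) + 36 * sqrt (ln (real n)) ^ 3) / sqrt (real n) \<le> ln (ln (real n))) at_top"
  by (real_asymp, real_asymp, real_asymp, real_asymp, real_asymp)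

text \<open>x, l and t stand for n, log n and log log n. The main term is z^2 l / 4 = l / 4 - 10 t +
  100 t^2 / l with z = 1 - 20 t / l; K^18 = l^9 takes nine of the ten t, and \<open>small\<close>
  lets the tenth pay for all remaining terms.\<close>

lemma exponent_ge:
  fixes x l t :: real
  assumes x: "x \<ge> 1" and l: "l \<ge> 1" and ll: "0 \<le> t" "20 * t \<le> l"
    and small: "100 * t^2 / l + (sqrt l + 36 * sqrt l ^ 3) / sqrt x \<le> t"
    and a: "a = 1 / sqrt 3 * (1 - 20 * (t / l)) * sqrt x * sqrt l"
  shows "9 * t - l / 4 \<le> - (3 * (a + 1) * a / (2 * (2 * x))) - 18 * (a + 1) ^ 3 / (2 * x)^2"
proof -
  define z where "z = 1 - 20 * (t / l)"
  have z: "0 \<le> z" "z \<le> 1" using ll l by (auto simp: z_def divide_le_eq)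
  have s3: "1 / sqrt 3 \<le> (1::real)" by simp
  have xl: "sqrt x * sqrt l \<ge> 1" using x l mult_mono[of 1 "sqrt x" 1 "sqrt l"] by simp
  have a0: "0 \<le> a" unfolding a z_def[symmetric] using z x l by (intro mult_nonneg_nonneg) auto
  have a1: "a \<le> sqrt x * sqrt l"
  proof -
    have "(1 / sqrt 3 * z) * (sqrt x * sqrt l) \<le> (1 * 1) * (sqrt x * sqrt l)"
      using z s3 xl by (intro mult_right_mono mult_mono) auto
    then show ?thesis unfolding a z_def[symmetric] by (simp add: mult_ac)
  qed
  have a2: "a^2 = z^2 * x * l / 3" unfolding a z_def[symmetric] using x l by (simp add: power_mult_distrib power_divide)
  have zl: "z^2 * l = l - 40 * t + 400 * t^2 / l"
    using l by (simp add: z_def power2_eq_square field_simps)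
  have "3 * (a + 1) * a / (2 * (2 * x)) = 3 * a^2 / (4 * x) + 3 * a / (4 * x)"
    using x by (simp add: power2_eq_square field_simps)
  also have "3 * a^2 / (4 * x) = z^2 * l / 4" using x by (simp add: a2)
  also have "\<dots> = l / 4 - 10 * t + 100 * t^2 / l" by (simp add: zl)
  also have "3 * a / (4 * x) \<le> sqrt l / sqrt x"
  proof -
    have "3 * a / (4 * x) \<le> 4 * (sqrt x * sqrt l) / (4 * x)" using a1 a0 x by (intro divide_right_mono) auto
    also have "\<dots> = sqrt l * (sqrt x / x)" by simp
    also have "sqrt x / x = 1 / sqrt x" using x by (simp add: real_div_sqrt divide_simps)
    finally show ?thesis by simp
  qed
  finally have 1: "3 * (a + 1) * a / (2 * (2 * x)) \<le> l / 4 - 10 * t + 100 * t^2 / l + sqrt l / sqrt x" by simp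
  have 2: "18 * (a + 1) ^ 3 / (2 * x)^2 \<le> 36 * sqrt l ^ 3 / sqrt x"
  proof -
    have "18 * (a + 1) ^ 3 \<le> 18 * (2 * (sqrt x * sqrt l)) ^ 3"
      using a0 a1 xl by (intro mult_left_mono power_mono) auto
    then have "18 * (a + 1) ^ 3 / (2 * x)^2 \<le> 18 * (2 * (sqrt x * sqrt l)) ^ 3 / (2 * x)^2"
      by (intro divide_right_mono) auto
    also have "\<dots> = 36 * sqrt l ^ 3 * (sqrt x ^ 3 / x^2)" by (simp add: power_mult_distrib)
    also have "sqrt x ^ 3 / x^2 = 1 / sqrt x"
    proof -
      have "x^2 = sqrt x ^ 3 * sqrt x"
        using x by (simp add: power2_eq_square power3_eq_cube)
      then show ?thesis using x by simp
    qed
    finally show ?thesis by simp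
  qed
  have "100 * t^2 / l + sqrt l / sqrt x + 36 * sqrt l ^ 3 / sqrt x \<le> t"
    using small by (simp add: add_divide_distrib)
  then show ?thesis using 1 2 by linarith
qed

lemma trajectory_target:
  assumes L: "10 ^ 16 \<le> ln (real n)"
    and Y: "ln (real n) ^ 5 \<le> (2 * real n) powr (1 / 4)"
    and ll: "20 * ln (ln (real n)) \<le> ln (real n)"
    and m6: "6 * (sqrt (real n) * sqrt (ln (real n)) + 1) \<le> 2 * real n"
    and small: "100 * (ln (ln (real n)))^2 / ln (real n)
      + (sqrt (ln (real n)) + 36 * sqrt (ln (real n)) ^ 3) / sqrt (real n) \<le> ln (ln (real n))"
  shows "trajectory n (nat \<lceil>target n\<rceil>) (sqrt (ln (real n))) ((2 * real n) powr (1 / 4))"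
    and "0 \<le> target n"
proof -
  let ?K = "sqrt (ln (real n))" and ?Y = "(2 * real n) powr (1 / 4)" and ?m = "nat \<lceil>target n\<rceil>"
  define z where "z = 1 - 20 * (ln (ln (real n)) / ln (real n))"
  have L1: "ln (real n) \<ge> 1" using L by simp
  have n0: "n > 0" using L1 by (cases n) auto
  then have n1: "real n \<ge> 1" by simp
  have ll0: "ln (ln (real n)) \<ge> 0" using L1 by simp
  have z: "0 \<le> z" "z \<le> 1" using ll ll0 L1 by (auto simp: z_def divide_le_eq)
  have a: "target n = 1 / sqrt 3 * z * (sqrt (real n) * ?K)" by (simp add: target_def z_def)
  show a0: "0 \<le> target n" unfolding a using z L1 by simp
  have a1: "target n \<le> sqrt (real n) * ?K"
  proof -
    have "1 / sqrt 3 * z * (sqrt (real n) * ?K) \<le> (1 * 1) * (sqrt (real n) * ?K)"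
      using z L1 by (intro mult_right_mono mult_mono) auto
    then show ?thesis by (simp add: a)
  qed
  have Kp: "?K ^ (2 * k) = ln (real n) ^ k" for k using L1 by (simp add: power_mult)
  have Y2: "?Y^2 = sqrt (2 * real n)"
    using n0 by (simp add: powr_half_sqrt[symmetric] powr_powr flip: powr_numeral)
  have mt: "real ?m \<le> target n + 1" using a0 by linarith
  have K8: "10 ^ 8 \<le> ?K"
  proof (rule real_le_rsqrt)
    show "(10 ^ 8)^2 \<le> ln (real n)" using L by simp
  qed
  have s1: "sqrt (2 * real n) \<ge> 1" using n1 by simp
  \<comment> \<open>5/7 is slightly above 1 / sqrt 2, and the remaining 2/7 of sqrt (2 n) K covers 2
    sqrt (2 n) since K \<ge> 7.\<close>
  have s2: "sqrt (real n) \<le> 5 / 7 * sqrt (2 * real n)"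
  proof -
    have "sqrt (real n) \<le> sqrt ((5 / 7)^2 * (2 * real n))" by (intro real_sqrt_le_mono) (simp add: power2_eq_square)
    then show ?thesis by (simp add: real_sqrt_mult)
  qed
  have fit: "sqrt (2 * real n) + (target n + 1) \<le> sqrt (2 * real n) * ?K"
  proof -
    have "sqrt (real n) * ?K \<le> 5 / 7 * sqrt (2 * real n) * ?K" using s2 L1 by (intro mult_right_mono) auto
    moreover have "sqrt (2 * real n) * 7 \<le> sqrt (2 * real n) * ?K" using K8 s1 by (intro mult_left_mono) auto
    ultimately show ?thesis using a1 s1 by linarith
  qed
  have prod: "?K ^ 18 / ?Y \<le> (\<Prod>j<?m. 1 - 3 * real j / (2 * real n))"
  proof -
    \<comment> \<open>Rounding up adds at most 1 to the target. For m = 0 the factor m - 1 is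
      negative, hence the separate case.\<close>
    have "real ?m * (real ?m - 1) \<le> (target n + 1) * target n"
    proof (cases "?m = 0")
      case True then show ?thesis using a0 by simp
    next
      case False then show ?thesis using mt a0 by (intro mult_mono) auto
    qed
    then have 1: "3 * real ?m * (real ?m - 1) / (2 * (2 * real n)) \<le> 3 * (target n + 1) * target n / (2 * (2 * real n))"
      unfolding mult.assoc by (intro divide_right_mono mult_left_mono) auto
    have 2: "18 * real ?m ^ 3 / (2 * real n)^2 \<le> 18 * (target n + 1) ^ 3 / (2 * real n)^2"
      using mt by (intro divide_right_mono mult_left_mono power_mono) auto
    have "?K ^ 18 / ?Y = ln (real n) ^ 9 / ?Y" using Kp[of 9] by simp
    also have "\<dots> \<le> ln (real n) ^ 9 / real n powr (1 / 4)"
      using n1 L1 by (intro divide_left_mono powr_mono2 mult_pos_pos) auto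
    also have "\<dots> = exp (9 * ln (ln (real n)) - ln (real n) / 4)"
    proof -
      have "exp (9 * ln (ln (real n))) = ln (real n) ^ 9" using L1 by (simp add: exp_of_nat_mult[of 9, simplified])
      moreover have "exp (ln (real n) / 4) = real n powr (1 / 4)" using n0 by (simp add: powr_def)
      ultimately show ?thesis by (simp add: exp_diff)
    qed
    also have "\<dots> \<le> exp (- (3 * (target n + 1) * target n / (2 * (2 * real n))) - 18 * (target n + 1) ^ 3 / (2 * real n)^2)"
      unfolding exp_le_cancel_iff by (rule exponent_ge[OF n1 L1 ll0 ll small target_def])
    also have "\<dots> \<le> exp (- (3 * real ?m * (real ?m - 1) / (2 * (2 * real n))) - 18 * real ?m ^ 3 / (2 * real n)^2)"
      using 1 2 by simp
    also have "\<dots> \<le> (\<Prod>j<?m. 1 - 3 * real j / (2 * real n))"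
      using n0 mt m6 a1 by (intro prod_one_minus_ge) auto
    finally show ?thesis .
  qed
  show "trajectory n ?m ?K ?Y"
  proof
    show "10 ^ 8 \<le> ?K" by (rule K8)
    show "?K ^ 10 \<le> ?Y" using Y Kp[of 5] by simp
    show "2 * real n = ?Y ^ 4" using n0 by (simp add: powr_powr flip: powr_numeral)
    show "?Y^2 + real ?m \<le> ?Y^2 * ?K" unfolding Y2 using fit mt by linarith
  qed (rule prod)
qed

lemma error_tendsto_0:
  "(\<lambda>n::nat. 48 * (real n)^2 * (1 / real n ^ 10) + 2 * real n * (32 * (real n)^2 * (3 / real n ^ 10))) \<longlonglongrightarrow> 0"
  by real_asymp

theorem theorem1p3:
  shows "(\<lambda>n::nat. measure_pmf.prob (sf_final (Z2n n))
            {S. real (card S) \<ge> 1 / sqrt 3 * (1 - 20 * (ln (ln (real n)) / ln (real n)))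
                                  * sqrt (real n) * sqrt (ln (real n))})
         \<longlonglongrightarrow> 1"
proof (rule tendsto_sandwich)
  let ?err = "\<lambda>n::nat. 48 * (real n)^2 * (1 / real n ^ 10) + 2 * real n * (32 * (real n)^2 * (3 / real n ^ 10))"
  show "(\<lambda>n. 1 - ?err n) \<longlonglongrightarrow> 1"
    using tendsto_diff[OF tendsto_const error_tendsto_0, of 1] by simp
  show "\<forall>\<^sub>F n in sequentially. 1 - ?err n \<le> measure_pmf.prob (sf_final (Z2n n))
            {S. real (card S) \<ge> 1 / sqrt 3 * (1 - 20 * (ln (ln (real n)) / ln (real n)))
                                  * sqrt (real n) * sqrt (ln (real n))}"
    using parameter_asymptotics
  proof eventually_elim
    case (elim n)
    define K where "K = sqrt (ln (real n))"
    let ?m = "nat \<lceil>target n\<rceil>"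
    interpret trajectory n ?m K "(2 * real n) powr (1 / 4)"
      unfolding K_def by (rule trajectory_target(1)[OF elim])
    have a0: "0 \<le> target n" by (rule trajectory_target(2)[OF elim])
    have L1: "ln (real n) \<ge> 1" using elim(1) by simp
    then have n0: "n > 0" by (cases n) auto
    have K2: "K^2 = ln (real n)" using L1 by (simp add: K_def)
    have e10: "exp (- 10 * ln (real n)) = 1 / real n ^ 10"
    proof -
      have "exp (10 * ln (real n)) = real n ^ 10" using n0 by (simp add: exp_of_nat_mult[of 10, simplified])
      then show ?thesis by (simp add: exp_minus inverse_eq_divide)
    qed
    have lamK: "lam * (1 / K ^ 4) = 10 * ln (real n)"
    proof -
      have "K ^ 6 = K^2 * K ^ 4" by (simp flip: power_add)
      then show ?thesis using K1(2) by (simp add: lam_def K2)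
    qed
    have "lam \<ge> 10 * ln (real n)"
    proof -
      have "lam * (1 / K ^ 4) \<le> lam * 1" using lam_pos K1 by (intro mult_left_mono) auto
      then show ?thesis using lamK by simp
    qed
    then have el: "exp (- lam) \<le> 1 / real n ^ 10" unfolding e10[symmetric] by simp
    have ee: "exp (1 - 10 * ln (real n)) \<le> 3 / real n ^ 10"
    proof -
      have "exp (1 - 10 * ln (real n)) = exp 1 * exp (- 10 * ln (real n))" by (simp flip: exp_add)
      also have "\<dots> \<le> 3 * (1 / real n ^ 10)" unfolding e10 using exp_le by (intro mult_right_mono) auto
      finally show ?thesis by simp
    qed
    have "measure_pmf.prob (sf_final (Z2n n)) {S. card S < ?m}
      \<le> 16 * (real n)^2 * (exp (- 10 * K^2) + 2 * exp (- lam)) + 2 * real n * eps"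
      by (rule small_final_prob)
    also have "\<dots> \<le> 16 * (real n)^2 * (1 / real n ^ 10 + 2 * (1 / real n ^ 10)) + 2 * real n * (32 * (real n)^2 * (3 / real n ^ 10))"
      unfolding eps_def lamK K2 using el ee e10 by (intro add_mono mult_left_mono) auto
    also have "\<dots> = ?err n" by simp
    finally have "measure_pmf.prob (sf_final (Z2n n)) {S. card S < ?m} \<le> ?err n" .
    moreover have "measure_pmf.prob (sf_final (Z2n n)) {S. target n \<le> real (card S)}
        = 1 - measure_pmf.prob (sf_final (Z2n n)) {S. card S < ?m}"
    proof -
      have "target n \<le> real k \<longleftrightarrow> \<not> k < ?m" for k
        using a0 by (simp add: not_less nat_le_iff ceiling_le_iff)
      then have "{S. target n \<le> real (card S)} = UNIV - {S :: int set. card S < ?m}" by blast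
      then show ?thesis
        using measure_pmf.prob_compl[of "{S. card S < ?m}" "sf_final (Z2n n)"] by simp
    qed
    ultimately show ?case unfolding target_def by linarith
  qed
  show "\<forall>\<^sub>F n in sequentially. measure_pmf.prob (sf_final (Z2n n))
            {S. real (card S) \<ge> 1 / sqrt 3 * (1 - 20 * (ln (ln (real n)) / ln (real n)))
                                  * sqrt (real n) * sqrt (ln (real n))} \<le> 1"
    by (intro always_eventually allI measure_pmf.prob_le_1)
qed (rule tendsto_const)

end
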